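(* Perimeter-minimizing tilings of the plane by unit-area convex polygons with at most five sides are given by Cairo and Prismatic tiles. That is: there exist tilings of the plane all of whose tiles are Cairo or Prismatic pentagons; and if $\mathcal{T}_0$ is any tiling of the plane each of whose tiles is a Cairo pentagon or a Prismatic pentagon (only one kind or a mixture), and $\mathcal{T}$ is any tiling of the plane by (not necessarily congruent) convex polygons, each of area $1$ and each having at most five sides, then the perimeter ratio of $\mathcal{T}$ is at least the perimeter ratio of $\mathcal{T}_0$. The tilings are not assumed to be edge to edge.
   Context: A (polygonal) tiling is a decomposition of the plane as a union of polygonal regions (tiles) which meet only along their boundaries. It is edge to edge if the tiles meet only along entire edges; this is not assumed here. The perimeter ratio of a planar tiling is the limit superior, as $R\to\infty$, of the perimeter of the tiling (the total length of the union of the boundaries of the tiles) inside the disc of radius $R$ about the origin, divided by the area $\pi R^2$ of that disc. It may be infinite. The Cairo and Prismatic pentagons are the unit-area convex pentagons circumscribed about a circle with two right angles and three angles of $2\pi/3$. In the Cairo pentagon the two right angles are not adjacent (angles in cyclic order $2\pi/3, 2\pi/3, \pi/2, 2\pi/3, \pi/2$): it has one shorter edge of length $a=\frac{2}{3}\sqrt{6-3\sqrt3}$ and four equal longer edges of length $b=\frac{(3+\sqrt3)\sqrt{2-\sqrt3}}{3}$. In the Prismatic pentagon the two right angles are adjacent (angles in cyclic order $2\pi/3,2\pi/3,2\pi/3,\pi/2,\pi/2$): it has two adjacent edges of length $a$, two edges of length $b$, and a base of length $2\sqrt{2-\sqrt3}$ joining the two right angles. Tiles are used up to congruence. *)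

theory Defs
  imports "HOL-Analysis.Analysis"
begin

definition convex_polygon :: "(real^2) set \<Rightarrow> bool" where
  "convex_polygon P \<longleftrightarrow> polytope P \<and> interior P \<noteq> {}"

(* Sides are geometric edges: a point in the interior of an edge at which other tiles of a tiling
   meet does not subdivide it. *)
definition num_sides :: "(real^2) set \<Rightarrow> nat" where
  "num_sides P = card {e. e edge_of P}"

definition polygonal_region :: "(real^2) set \<Rightarrow> bool" where
  "polygonal_region P \<longleftrightarrow>
     (\<exists>F. finite F \<and> F \<noteq> {} \<and> (\<forall>Q\<in>F. convex_polygon Q) \<and> P = \<Union>F) \<and> connected (interior P)"

(* Neither edge-to-edge nor local finiteness is required. *)
definition tiling :: "(real^2) set set \<Rightarrow> bool" where
  "tiling T \<longleftrightarrow>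
     (\<forall>P\<in>T. polygonal_region P) \<and> \<Union>T = UNIV \<and>
     (\<forall>P\<in>T. \<forall>Q\<in>T. P \<noteq> Q \<longrightarrow> P \<inter> Q \<subseteq> frontier P \<inter> frontier Q)"

(* One-dimensional Hausdorff measure, normalised so that a segment has measure its length.
   Boundedness is needed because diameter is unspecified on unbounded sets. *)
definition hausdorff_length :: "'a::metric_space set \<Rightarrow> ennreal" where
  "hausdorff_length A =
     (SUP \<delta>\<in>{0::real<..}.
        INF U\<in>{U :: nat \<Rightarrow> 'a set. A \<subseteq> (\<Union>n. U n) \<and> (\<forall>n. bounded (U n) \<and> diameter (U n) \<le> \<delta>)}.
          (\<Sum>n. ennreal (diameter (U n))))"

(* An edge shared by two tiles counts once, since the length is that of the union. *)
definition perimeter_ratio :: "(real^2) set set \<Rightarrow> ennreal" where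
  "perimeter_ratio T =
     Limsup at_top (\<lambda>R::real.
       hausdorff_length ((\<Union>P\<in>T. frontier P) \<inter> cball 0 R) / ennreal (pi * R\<^sup>2))"

definition corner_angle :: "real^2 \<Rightarrow> real^2 \<Rightarrow> real^2 \<Rightarrow> real" where
  "corner_angle a b c = arccos (((a - b) \<bullet> (c - b)) / (norm (a - b) * norm (c - b)))"

definition side :: "(nat \<Rightarrow> real^2) \<Rightarrow> nat \<Rightarrow> (real^2) set" where
  "side v i = closed_segment (v i) (v (Suc i mod 5))"

(* v 0, ..., v 4 are the vertices of the convex pentagon P in cyclic order (in either orientation). *)
definition pentagon_vertices :: "(nat \<Rightarrow> real^2) \<Rightarrow> (real^2) set \<Rightarrow> bool" where
  "pentagon_vertices v P \<longleftrightarrow>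
     inj_on v {..<5} \<and> P = convex hull (v ` {..<5}) \<and> (\<forall>i<5. side v i edge_of P)"

definition circumscribed_about :: "(nat \<Rightarrow> real^2) \<Rightarrow> (real^2) set \<Rightarrow> real^2 \<Rightarrow> real \<Rightarrow> bool" where
  "circumscribed_about v P c r \<longleftrightarrow> sphere c r \<subseteq> P \<and> (\<forall>i<5. side v i \<inter> sphere c r \<noteq> {})"

(* (i + 4) mod 5 is the cyclic predecessor of i. *)
definition unit_circumscribed_pentagon :: "real list \<Rightarrow> (real^2) set \<Rightarrow> bool" where
  "unit_circumscribed_pentagon \<theta> P \<longleftrightarrow>
     measure lebesgue P = 1 \<and>
     (\<exists>v. pentagon_vertices v P \<and>
        (\<forall>i<5. corner_angle (v ((i + 4) mod 5)) (v i) (v (Suc i mod 5)) = \<theta> ! i) \<and>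
        (\<exists>c r. r > 0 \<and> circumscribed_about v P c r))"

(* Angles, incircle and area determine the pentagon up to congruence, and the two predicates are
   invariant under congruence.  The inradius is sqrt (2 - sqrt 3), and a side joining angles
   alpha and beta has length sqrt (2 - sqrt 3) * (cot (alpha / 2) + cot (beta / 2)). *)
definition cairo_pentagon :: "(real^2) set \<Rightarrow> bool" where
  "cairo_pentagon = unit_circumscribed_pentagon [2*pi/3, 2*pi/3, pi/2, 2*pi/3, pi/2]"

definition prismatic_pentagon :: "(real^2) set \<Rightarrow> bool" where
  "prismatic_pentagon = unit_circumscribed_pentagon [2*pi/3, 2*pi/3, 2*pi/3, pi/2, pi/2]"

end

theory Submission
  imports Defs
begin

text \<open>Both ratios are compared with \<open>c0 = sqrt (2 + sqrt 3)\<close>, half the perimeter of a Cairo or Prismatic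
  pentagon. Lower bound: by L'Huilier, a convex polygon of area 1 with angles \<open>\<alpha>\<^sub>i\<close> has half perimeter at
  least \<open>sqrt (\<Sum> cot (\<alpha>\<^sub>i / 2))\<close>. For at most five sides this is bounded below by \<open>c0\<close> plus a
  multiple of a sum of corner weights, affine in the angles, whose tangent point is \<open>2 * pi / 3\<close> at points where exactly
  three tiles meet, all in corners, and \<open>pi / 2\<close> at all other points. Around every point of the plane the weights add up to
  something nonnegative, so the tiles inside a large disc have perimeter at least \<open>c0\<close> each on average,
  up to the tiles crossing its boundary. Each crossing tile has boundary of length at least \<open>1/2\<close> within a thin annulus;
  if the ratio were finite and the crossing tiles were not negligible for some sequence of radii,
  the annuli would contain too much perimeter. Upper bound: almost every boundary point lies
  on two tiles, so counting the tiles that meet the disc, of perimeter \<open>2 * c0\<close> and bounded diameter, suffices.\<close>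

section \<open>Hausdorff length\<close>

text \<open>A corner weight is the tangent of \<open>cot (\<alpha> / 2)\<close> at
  \<open>pi / 2\<close> or \<open>2 * pi / 3\<close> minus the chord of that function through both
  points. Summed over five angles with total \<open>3 * pi\<close>, the chord gives exactly
  \<open>c0\<^sup>2\<close>, the value for the Cairo and Prismatic angles; this fixes the constants.
  The perimeter bound must be linear in the weights, so that it can be summed over tiles and
  regrouped by vertex, but L'Huilier's inequality bounds the square of the perimeter. Taking the
  root costs a term quadratic in the weights; the quadratic gain of the convex cotangent over its
  tangent pays for it. Angles are read off from areas in small discs. Around a point they then add
  up by additivity of area, without any cyclic ordering of the tiles; a tile with the point inside a
  side contributes \<open>pi\<close>. Local finiteness is not given. In the lower bound it follows
  from finite boundary length in discs, since each tile has a fixed amount of boundary nearby and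
  almost every point lies on at most two frontiers. In the upper bound it follows from the bounded
  diameter of the tiles.\<close>

definition hausdorff_pre :: "real \<Rightarrow> 'a::metric_space set \<Rightarrow> ennreal" where
  "hausdorff_pre \<delta> A =
     (INF U\<in>{U :: nat \<Rightarrow> 'a set. A \<subseteq> (\<Union>n. U n) \<and> (\<forall>n. bounded (U n) \<and> diameter (U n) \<le> \<delta>)}.
        (\<Sum>n. ennreal (diameter (U n))))"

lemma hausdorff_length_eq_SUP: "hausdorff_length A = (SUP \<delta>\<in>{0<..}. hausdorff_pre \<delta> A)"
  unfolding hausdorff_length_def hausdorff_pre_def ..

lemma hausdorff_pre_lower:
  assumes "A \<subseteq> (\<Union>n. U n)" "\<And>n. bounded (U n)" "\<And>n. diameter (U n) \<le> \<delta>"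
  shows "hausdorff_pre \<delta> A \<le> (\<Sum>n. ennreal (diameter (U n)))"
  unfolding hausdorff_pre_def using assms by (intro INF_lower) auto

lemma hausdorff_pre_mono: "A \<subseteq> B \<Longrightarrow> hausdorff_pre \<delta> A \<le> hausdorff_pre \<delta> B"
  unfolding hausdorff_pre_def by (intro INF_superset_mono) auto

lemma hausdorff_pre_antimono: "\<delta> \<le> \<delta>' \<Longrightarrow> hausdorff_pre \<delta>' A \<le> hausdorff_pre \<delta> A"
  unfolding hausdorff_pre_def by (intro INF_superset_mono) (auto intro: order_trans)

lemma hausdorff_pre_le_length: "0 < \<delta> \<Longrightarrow> hausdorff_pre \<delta> A \<le> hausdorff_length A"
  unfolding hausdorff_length_eq_SUP by (intro SUP_upper) auto

lemma hausdorff_length_mono: "A \<subseteq> B \<Longrightarrow> hausdorff_length A \<le> hausdorff_length B"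
  unfolding hausdorff_length_eq_SUP by (intro SUP_mono) (auto intro: hausdorff_pre_mono)

lemma hausdorff_length_empty [simp]: "hausdorff_length ({}::'a::metric_space set) = 0"
proof -
  have "hausdorff_pre \<delta> ({}::'a::metric_space set) \<le> 0" if "\<delta> > 0" for \<delta> :: real
    using hausdorff_pre_lower[of "{}::'a set" "\<lambda>n. {}" \<delta>] that by simp
  then show ?thesis unfolding hausdorff_length_eq_SUP by (intro antisym SUP_least) auto
qed

text \<open>Each piece gets a cover that is optimal up to \<open>e * (1/2)^Suc i\<close>. These
  errors add up to \<open>e\<close>, and the pairing function turns the doubly indexed family into
  one sequence.\<close>

lemma hausdorff_pre_UN_le:
  fixes A :: "nat \<Rightarrow> 'a::metric_space set"
  shows "hausdorff_pre \<delta> (\<Union>i. A i) \<le> (\<Sum>i. hausdorff_pre \<delta> (A i))"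
proof (cases "(\<Sum>i. hausdorff_pre \<delta> (A i)) = top")
  case False
  then have fin: "hausdorff_pre \<delta> (A i) \<noteq> top" for i
    using suminf_eq_zero_iff ennreal_suminf_lessD[of "\<lambda>i. hausdorff_pre \<delta> (A i)" top i]
    by (simp add: less_top)
  show ?thesis
  proof (rule ennreal_le_epsilon)
    fix e :: real assume e: "0 < e"
    have "\<exists>U. A i \<subseteq> (\<Union>n. U n) \<and> (\<forall>n. bounded (U n) \<and> diameter (U n) \<le> \<delta>) \<and>
            (\<Sum>n. ennreal (diameter (U n))) \<le> hausdorff_pre \<delta> (A i) + ennreal (e * (1/2)^Suc i)" for i
    proof -
      have "hausdorff_pre \<delta> (A i) < hausdorff_pre \<delta> (A i) + ennreal (e * (1/2)^Suc i)"
        using fin[of i] e by (simp add: ennreal_add_left_cancel_less[of _ 0, simplified] less_top)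
      then show ?thesis
        unfolding hausdorff_pre_def[of \<delta> "A i"] by (subst (asm) INF_less_iff) (auto intro: less_imp_le)
    qed
    then obtain U where U: "\<And>i. A i \<subseteq> (\<Union>n. U i n)" "\<And>i n. bounded (U i n)" "\<And>i n. diameter (U i n) \<le> \<delta>"
      "\<And>i. (\<Sum>n. ennreal (diameter (U i n))) \<le> hausdorff_pre \<delta> (A i) + ennreal (e * (1/2)^Suc i)"
      by metis
    define W where "W k = (case prod_decode k of (i, n) \<Rightarrow> U i n)" for k
    have "hausdorff_pre \<delta> (\<Union>i. A i) \<le> (\<Sum>k. ennreal (diameter (W k)))"
    proof (rule hausdorff_pre_lower)
      show "(\<Union>i. A i) \<subseteq> (\<Union>k. W k)"
      proof
        fix x assume "x \<in> (\<Union>i. A i)"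
        then obtain i n where "x \<in> U i n" using U(1) by blast
        then have "x \<in> W (prod_encode (i, n))" by (simp add: W_def)
        then show "x \<in> (\<Union>k. W k)" by blast
      qed
    qed (auto simp: W_def U split: prod.split)
    also have "\<dots> = (\<Sum>k. (case prod_decode k of (i, n) \<Rightarrow> ennreal (diameter (U i n))))"
      by (intro suminf_cong) (simp add: W_def split: prod.split)
    also have "\<dots> = (\<Sum>i. \<Sum>n. ennreal (diameter (U i n)))"
      by (subst suminf_ennreal_2dimen[where f = "\<lambda>(i, n). ennreal (diameter (U i n))", symmetric]) (auto)
    also have "\<dots> \<le> (\<Sum>i. hausdorff_pre \<delta> (A i) + ennreal (e * (1/2)^Suc i))"
      by (intro suminf_le U) auto
    also have "\<dots> = (\<Sum>i. hausdorff_pre \<delta> (A i)) + (\<Sum>i. ennreal (e * (1/2)^Suc i))"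
      by (rule suminf_add[symmetric]) auto
    also have "(\<Sum>i. ennreal (e * (1/2)^Suc i)) = ennreal e"
      using sums_mult[OF power_half_series, of e] e
      by (intro suminf_ennreal_eq) auto
    finally show "hausdorff_pre \<delta> (\<Union>i. A i) \<le> (\<Sum>i. hausdorff_pre \<delta> (A i)) + ennreal e" .
  qed
qed simp

lemma hausdorff_length_UN_le:
  fixes A :: "nat \<Rightarrow> 'a::metric_space set"
  shows "hausdorff_length (\<Union>i. A i) \<le> (\<Sum>i. hausdorff_length (A i))"
  unfolding hausdorff_length_eq_SUP[of "\<Union>i. A i"]
proof (intro SUP_least)
  fix \<delta> :: real assume "\<delta> \<in> {0<..}"
  then show "hausdorff_pre \<delta> (\<Union>i. A i) \<le> (\<Sum>i. hausdorff_length (A i))"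
    using hausdorff_pre_UN_le[of \<delta> A]
    by (auto elim!: order_trans intro!: suminf_le hausdorff_pre_le_length)
qed

lemma hausdorff_length_Un_le: "hausdorff_length (A \<union> B) \<le> hausdorff_length A + hausdorff_length B"
proof -
  have "hausdorff_length (\<Union>i. binaryset A B i) \<le> (\<Sum>i. hausdorff_length (binaryset A B i))"
    by (rule hausdorff_length_UN_le)
  then show ?thesis
    using suminf_binaryset_eq[of hausdorff_length A B] by (simp add: UN_binaryset_eq)
qed

text \<open>A set of diameter below \<open>d\<close> cannot meet both \<open>A\<close> and
  \<open>B\<close>, so every fine cover splits into a cover of \<open>A\<close> and a cover of
  \<open>B\<close>.\<close>

lemma hausdorff_length_Un_separated:
  assumes d: "0 < d" "\<And>x y. x \<in> A \<Longrightarrow> y \<in> B \<Longrightarrow> d \<le> dist x y"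
  shows "hausdorff_length A + hausdorff_length B \<le> hausdorff_length (A \<union> B)"
proof -
  have pre: "hausdorff_pre \<delta> A + hausdorff_pre \<delta> B \<le> hausdorff_pre \<delta> (A \<union> B)" if \<delta>: "0 < \<delta>" "\<delta> < d" for \<delta>
    unfolding hausdorff_pre_def[of \<delta> "A \<union> B"]
  proof (intro INF_greatest, clarify)
    fix U :: "nat \<Rightarrow> 'a set"
    assume U: "A \<union> B \<subseteq> (\<Union>n. U n)" "\<forall>n. bounded (U n) \<and> diameter (U n) \<le> \<delta>"
    define UA where "UA n = (if U n \<inter> A = {} then {} else U n)" for n
    define UB where "UB n = (if U n \<inter> A = {} then U n else {})" for n
    have "hausdorff_pre \<delta> A \<le> (\<Sum>n. ennreal (diameter (UA n)))"
    proof (rule hausdorff_pre_lower)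
      show "A \<subseteq> (\<Union>n. UA n)" using U(1) by (fastforce simp: UA_def)
    qed (use U \<delta> in \<open>auto simp: UA_def\<close>)
    moreover have "hausdorff_pre \<delta> B \<le> (\<Sum>n. ennreal (diameter (UB n)))"
    proof (rule hausdorff_pre_lower)
      show "B \<subseteq> (\<Union>n. UB n)"
      proof
        fix y assume y: "y \<in> B"
        then obtain n where n: "y \<in> U n" using U(1) by blast
        have "U n \<inter> A = {}"
        proof (rule ccontr)
          assume "U n \<inter> A \<noteq> {}"
          then obtain x where x: "x \<in> U n" "x \<in> A" by blast
          have "dist x y \<le> diameter (U n)" using diameter_bounded_bound[of "U n" x y] U(2) x n by blast
          then show False using d(2)[OF x(2) y] U(2) \<delta> by (smt (verit, best))
        qed
        then show "y \<in> (\<Union>n. UB n)" using n by (auto simp: UB_def intro!: exI[of _ n])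
      qed
    qed (use U \<delta> in \<open>auto simp: UB_def\<close>)
    ultimately have "hausdorff_pre \<delta> A + hausdorff_pre \<delta> B \<le>
        (\<Sum>n. ennreal (diameter (UA n))) + (\<Sum>n. ennreal (diameter (UB n)))"
      by (rule add_mono)
    also have "\<dots> = (\<Sum>n. ennreal (diameter (UA n)) + ennreal (diameter (UB n)))"
      by (rule suminf_add) auto
    also have "\<dots> = (\<Sum>n. ennreal (diameter (U n)))"
      by (intro suminf_cong) (auto simp: UA_def UB_def)
    finally show "hausdorff_pre \<delta> A + hausdorff_pre \<delta> B \<le> (\<Sum>n. ennreal (diameter (U n)))" .
  qed
  have "hausdorff_pre \<delta>1 A + hausdorff_pre \<delta>2 B \<le> hausdorff_length (A \<union> B)"
    if "0 < \<delta>1" "0 < \<delta>2" for \<delta>1 \<delta>2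
  proof -
    define \<delta> where "\<delta> = Min {\<delta>1, \<delta>2, d/2}"
    have \<delta>: "0 < \<delta>" "\<delta> < d" "\<delta> \<le> \<delta>1" "\<delta> \<le> \<delta>2" using that d(1) by (auto simp: \<delta>_def)
    have "hausdorff_pre \<delta>1 A + hausdorff_pre \<delta>2 B \<le> hausdorff_pre \<delta> A + hausdorff_pre \<delta> B"
      using \<delta> by (intro add_mono hausdorff_pre_antimono)
    also have "\<dots> \<le> hausdorff_pre \<delta> (A \<union> B)" using pre \<delta> by blast
    also have "\<dots> \<le> hausdorff_length (A \<union> B)" using \<delta> by (intro hausdorff_pre_le_length)
    finally show ?thesis .
  qed
  then have "hausdorff_pre \<delta>1 A + hausdorff_length B \<le> hausdorff_length (A \<union> B)" if "0 < \<delta>1" for \<delta>1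
    unfolding hausdorff_length_eq_SUP[of B] add.commute[of "hausdorff_pre \<delta>1 A"] using that
    by (subst ennreal_SUP_add_left[symmetric]) (auto intro!: SUP_least simp: add.commute[of _ "hausdorff_pre \<delta>1 A"])
  then show ?thesis
    unfolding hausdorff_length_eq_SUP[of A]
    by (subst ennreal_SUP_add_left[symmetric]) (auto intro!: SUP_least)
qed

text \<open>The classical argument for metric outer measures. The part \<open>K k\<close> of
  \<open>E\<close> keeps a positive distance from \<open>C\<close>, so it adds to
  \<open>E \<inter> C\<close>; the rest of \<open>E - C\<close> is cut into the shells
  \<open>R\<close>. Their lengths form a convergent series, so the shells missed by
  \<open>K k\<close> become negligible.\<close>

lemma caratheodory_closed:
  fixes C :: "'a::metric_space set"
  assumes C: "closed C"
  shows "hausdorff_length (E \<inter> C) + hausdorff_length (E - C) \<le> hausdorff_length E"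
proof (cases "C = {} \<or> hausdorff_length E = top")
  case False
  then have Cne: "C \<noteq> {}" and fin: "hausdorff_length E < top" by (auto simp: less_top)
  let ?H = "hausdorff_length"
  define K where "K k = {x\<in>E. 1 / real (Suc k) \<le> infdist x C}" for k
  define R where "R k = {x\<in>E. 1 / real (Suc (Suc k)) \<le> infdist x C \<and> infdist x C < 1 / real (Suc k)}" for k
  have infd: "infdist x C \<le> dist x y + infdist y C" for x y
    using infdist_triangle[of x C y] by (simp add: dist_commute)
  have KC: "?H (E \<inter> C) + ?H (K k) \<le> ?H E" for k
  proof -
    have "?H (E \<inter> C) + ?H (K k) \<le> ?H ((E \<inter> C) \<union> K k)"
    proof (rule hausdorff_length_Un_separated[of "1 / real (Suc k)"])
      fix x y assume "x \<in> E \<inter> C" "y \<in> K k"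
      then show "1 / real (Suc k) \<le> dist x y"
        using infd[of y x] by (auto simp: K_def dist_commute)
    qed simp
    also have "\<dots> \<le> ?H E" by (intro hausdorff_length_mono) (auto simp: K_def)
    finally show ?thesis .
  qed
  \<comment> \<open>Adjacent shells may touch, so only every second one is used; \<open>i\<close>
    selects the parity.\<close>
  have sep: "(\<Sum>k<n. ?H (R (2*k+i))) \<le> ?H (\<Union>k<n. R (2*k+i))" for n i
  proof (induction n)
    case (Suc n)
    have "(\<Sum>k<Suc n. ?H (R (2*k+i))) \<le> ?H (\<Union>k<n. R (2*k+i)) + ?H (R (2*n+i))"
      using Suc by (simp add: add_right_mono)
    also have "\<dots> \<le> ?H ((\<Union>k<n. R (2*k+i)) \<union> R (2*n+i))"
    proof (cases "n = 0")
      case False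
      let ?d = "1 / real (2*n+i) - 1 / real (Suc (2*n+i))"
      show ?thesis
      proof (rule hausdorff_length_Un_separated[of ?d])
        have "1 / real (Suc (2*n+i)) < 1 / real (2*n+i)"
          using False by (intro divide_strict_left_mono) auto
        then show "0 < ?d" by simp
      next
        fix x y assume x: "x \<in> (\<Union>k<n. R (2*k+i))" and y: "y \<in> R (2*n+i)"
        obtain k where k: "k < n" "x \<in> R (2*k+i)" using x by blast
        then have "1 / real (Suc (Suc (2*k+i))) \<le> infdist x C" by (simp add: R_def)
        moreover have "1 / real (2*n+i) \<le> 1 / real (Suc (Suc (2*k+i)))"
          using k False by (intro divide_left_mono) auto
        moreover have "infdist y C < 1 / real (Suc (2*n+i))" using y by (auto simp: R_def)
        ultimately show "?d \<le> dist x y" using infd[of x y] by linarith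
      qed
    qed simp
    also have "\<dots> = ?H (\<Union>k<Suc n. R (2*k+i))" by (simp add: lessThan_Suc Un_commute)
    finally show ?case .
  qed simp
  have sepE: "(\<Sum>k<n. ?H (R (2*k+i))) \<le> ?H E" for n i
    by (rule order_trans[OF sep]) (intro hausdorff_length_mono, auto simp: R_def)
  have "(\<Sum>k<n. ?H (R k)) \<le> 2 * ?H E" for n
  proof -
    have eo: "(\<Sum>k<2*n. ?H (R k)) = (\<Sum>k<n. ?H (R (2*k))) + (\<Sum>k<n. ?H (R (2*k+1)))"
      by (induction n) (auto simp: add_ac)
    have "(\<Sum>k<n. ?H (R k)) \<le> (\<Sum>k<2*n. ?H (R k))" by (intro sum_mono2) auto
    also have "\<dots> \<le> ?H E + ?H E"
      unfolding eo using sepE[of 0 n] sepE[of 1 n] by (simp add: add_mono)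
    finally show ?thesis by (simp add: mult_2)
  qed
  then have "(\<Sum>k. ?H (R k)) \<le> 2 * ?H E" by (intro suminf_le_const) auto
  then have Rfin: "(\<Sum>k. ?H (R k)) < top"
    using fin by (auto simp: ennreal_mult_less_top elim!: order.strict_trans1)
  have cover: "E - C \<subseteq> K k \<union> (\<Union>j. R (j + k))" for k
  proof
    fix x assume x: "x \<in> E - C"
    then have pos: "0 < infdist x C"
      using C Cne infdist_pos_not_in_closed by blast
    show "x \<in> K k \<union> (\<Union>j. R (j + k))"
    proof (cases "1 / real (Suc k) \<le> infdist x C")
      case True then show ?thesis using x by (simp add: K_def)
    next
      case False
      \<comment> \<open>The first scale at which \<open>x\<close> is no longer close to
        \<open>C\<close>; its shell has index one less.\<close>
      define m where "m = (LEAST m. 1 / real (Suc m) \<le> infdist x C)"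
      obtain m0 where "1 / real (Suc m0) \<le> infdist x C"
        using reals_Archimedean[OF pos] by (auto simp: inverse_eq_divide intro: less_imp_le)
      then have m: "1 / real (Suc m) \<le> infdist x C" unfolding m_def by (rule LeastI)
      have "k < m"
      proof (rule ccontr)
        assume "\<not> k < m"
        then have "1 / real (Suc k) \<le> 1 / real (Suc m)" by (intro divide_left_mono) auto
        then show False using m False by linarith
      qed
      then obtain j where j: "m = Suc (j + k)" by (metis less_iff_Suc_add add.commute)
      have "\<not> 1 / real (Suc (j + k)) \<le> infdist x C"
        using not_less_Least[of "j + k" "\<lambda>m. 1 / real (Suc m) \<le> infdist x C"] j m_def by simp
      then have "x \<in> R (j + k)" using x m j by (simp add: R_def)
      then show ?thesis by blast
    qed
  qed
  have tail: "?H (E \<inter> C) + ?H (E - C) \<le> ?H E + (\<Sum>j. ?H (R (j + k)))" for k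
  proof -
    have "?H (E - C) \<le> ?H (K k \<union> (\<Union>j. R (j + k)))" by (intro hausdorff_length_mono cover)
    also have "\<dots> \<le> ?H (K k) + ?H (\<Union>j. R (j + k))" by (rule hausdorff_length_Un_le)
    also have "\<dots> \<le> ?H (K k) + (\<Sum>j. ?H (R (j + k)))" by (intro add_left_mono hausdorff_length_UN_le)
    finally have "?H (E \<inter> C) + ?H (E - C) \<le> (?H (E \<inter> C) + ?H (K k)) + (\<Sum>j. ?H (R (j + k)))"
      by (simp add: add.assoc add_left_mono)
    also have "\<dots> \<le> ?H E + (\<Sum>j. ?H (R (j + k)))" using KC by (intro add_right_mono)
    finally show ?thesis .
  qed
  show ?thesis
  proof (rule ennreal_le_epsilon)
    fix e :: real assume e: "0 < e"
    let ?S = "\<Sum>k. ?H (R k)"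
    have "\<exists>k. (\<Sum>j. ?H (R (j + k))) \<le> ennreal e"
    proof (cases "?S = 0")
      case True
      then show ?thesis by (intro exI[of _ 0]) simp
    next
      case False
      then have "?S - ennreal e < ?S" using e Rfin by (intro ennreal_between) (auto simp: zero_less_iff_neq_zero simp del: suminf_eq_zero_iff)
      then obtain k where k: "?S - ennreal e < (\<Sum>j<k. ?H (R j))"
        by (auto simp: suminf_eq_SUP less_SUP_iff)
      have fk: "(\<Sum>j<k. ?H (R j)) < top"
        using Rfin sum_le_suminf[of "\<lambda>k. ?H (R k)" "{..<k}"] by (simp add: order.strict_trans1 del: ennreal_sum_less_top)
      have "?S = (\<Sum>j. ?H (R (j + k))) + (\<Sum>j<k. ?H (R j))"
        by (rule suminf_offset) auto
      moreover have "?S \<le> (\<Sum>j<k. ?H (R j)) + ennreal e"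
        using k by (metis add.commute diff_le_self_ennreal ennreal_minus_le_iff less_imp_le)
      ultimately have "(\<Sum>j<k. ?H (R j)) + (\<Sum>j. ?H (R (j + k))) \<le> (\<Sum>j<k. ?H (R j)) + ennreal e"
        by (simp add: add.commute)
      then show ?thesis using fk by (metis ennreal_add_left_cancel_le less_irrefl infinity_ennreal_def)
    qed
    then obtain k where "(\<Sum>j. ?H (R (j + k))) \<le> ennreal e" by blast
    then show "?H (E \<inter> C) + ?H (E - C) \<le> ?H E + ennreal e"
      using tail[of k] by (meson add_left_mono order_trans)
  qed
next
  case True
  then show ?thesis by (auto simp: less_top[symmetric] top_unique)
qed


section \<open>Hausdorff length as a measure on the Borel sets\<close>

lemma outer_measure_space_hausdorff: "outer_measure_space (Pow UNIV) hausdorff_length"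
  unfolding outer_measure_space_def positive_def increasing_def countably_subadditive_def
  by (auto intro: hausdorff_length_mono hausdorff_length_UN_le)

lemma borel_subset_lambda_system:
  "sets (borel :: 'a::metric_space measure) \<subseteq> lambda_system UNIV (Pow UNIV) hausdorff_length"
proof -
  interpret sigma_algebra "UNIV :: 'a set" "Pow UNIV" by (rule sigma_algebra_Pow)
  let ?L = "lambda_system UNIV (Pow (UNIV::'a set)) hausdorff_length"
  have "measure_space UNIV ?L hausdorff_length"
    by (rule caratheodory_lemma[OF outer_measure_space_hausdorff])
  then have sa: "sigma_algebra UNIV ?L" by (simp add: measure_space_def)
  have "C \<in> ?L" if "closed C" for C :: "'a set"
  proof -
    have "hausdorff_length (C \<inter> E) + hausdorff_length (- C \<inter> E) = hausdorff_length E" for E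
    proof (rule antisym)
      show "hausdorff_length (C \<inter> E) + hausdorff_length (- C \<inter> E) \<le> hausdorff_length E"
        using caratheodory_closed[OF that, of E] by (simp add: Int_commute Diff_eq)
      have "hausdorff_length E = hausdorff_length ((C \<inter> E) \<union> (- C \<inter> E))"
        by (rule arg_cong[of _ _ hausdorff_length]) auto
      then show "hausdorff_length E \<le> hausdorff_length (C \<inter> E) + hausdorff_length (- C \<inter> E)"
        using hausdorff_length_Un_le[of "C \<inter> E" "- C \<inter> E"] by simp
    qed
    then show ?thesis by (simp add: lambda_system_def Compl_eq_Diff_UNIV)
  qed
  then show ?thesis
    unfolding borel_eq_closed using sigma_algebra.sigma_sets_subset[OF sa, of "Collect closed"] by auto
qed

text \<open>On Borel sets the length is countably additive, so lengths counted with multiplicity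
  become integrals of counting functions.\<close>

definition hausdorff_measure :: "'a::metric_space measure" where
  "hausdorff_measure = measure_of UNIV (sets borel) hausdorff_length"

lemma sets_hausdorff_measure [simp, measurable_cong]: "sets hausdorff_measure = sets borel"
  unfolding hausdorff_measure_def by (metis sets.sets_measure_of_eq space_borel)

lemma emeasure_hausdorff_measure:
  assumes "A \<in> sets borel"
  shows "emeasure hausdorff_measure A = hausdorff_length A"
proof -
  interpret sigma_algebra "UNIV :: 'a set" "Pow UNIV" by (rule sigma_algebra_Pow)
  have "measure_space UNIV (lambda_system UNIV (Pow (UNIV::'a set)) hausdorff_length) hausdorff_length"
    by (rule caratheodory_lemma[OF outer_measure_space_hausdorff])
  then have "measure_space (UNIV::'a set) (sets borel) hausdorff_length"
    by (rule measure_down) (use borel_subset_lambda_system sets.sigma_algebra_axioms[of borel] in auto)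
  then show ?thesis
    unfolding hausdorff_measure_def using assms
    by (intro emeasure_measure_of_sigma) (auto simp: measure_space_def)
qed

text \<open>A 1-Lipschitz map to the line does not increase diameters, so a cover of
  \<open>A\<close> yields intervals covering \<open>{a..b}\<close> of no greater total length, and
  Lebesgue measure bounds that total. The lower bounds for boundary lengths rest on this.\<close>

lemma hausdorff_length_ge_Lipschitz_image:
  fixes f :: "'a::metric_space \<Rightarrow> real"
  assumes lip: "\<And>x y. \<bar>f x - f y\<bar> \<le> dist x y" and ab: "{a..b} \<subseteq> f ` A" "a \<le> b"
  shows "ennreal (b - a) \<le> hausdorff_length A"
proof -
  have "ennreal (b - a) \<le> hausdorff_pre 1 A"
    unfolding hausdorff_pre_def
  proof (intro INF_greatest, clarify)
    fix U :: "nat \<Rightarrow> 'a set"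
    assume U: "A \<subseteq> (\<Union>n. U n)" "\<forall>n. bounded (U n) \<and> diameter (U n) \<le> 1"
    \<comment> \<open>The image of \<open>U n\<close> need not be measurable; its interval hull is,
      and has the same bound on its length.\<close>
    have "\<exists>I. f ` U n \<subseteq> I \<and> I \<in> sets borel \<and> emeasure lborel I \<le> ennreal (diameter (U n))" for n
    proof (cases "U n = {}")
      case False
      then obtain x0 where x0: "x0 \<in> U n" by blast
      have bd: "bounded (U n)" using U by blast
      have d: "dist x y \<le> diameter (U n)" if "x \<in> U n" "y \<in> U n" for x y
        using diameter_bounded_bound[OF bd that] .
      have "\<bar>f x - f x0\<bar> \<le> diameter (U n)" if "x \<in> U n" for x
        using lip[of x x0] d[OF that x0] by linarith
      then have bb: "bdd_below (f ` U n)" "bdd_above (f ` U n)"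
        by (auto intro!: bdd_belowI2[of _ "f x0 - diameter (U n)"] bdd_aboveI2[of _ _ "f x0 + diameter (U n)"] simp: abs_le_iff)
          (smt (verit, best))+
      have "Sup (f ` U n) - Inf (f ` U n) \<le> diameter (U n)"
      proof -
        have "f y \<le> Inf (f ` U n) + diameter (U n)" if y: "y \<in> U n" for y
        proof -
          have "f y - diameter (U n) \<le> Inf (f ` U n)"
          proof (rule cINF_greatest)
            fix x assume x: "x \<in> U n"
            show "f y - diameter (U n) \<le> f x" using lip[of y x] d[OF y x] by linarith
          qed (use False in auto)
          then show ?thesis by simp
        qed
        then have "Sup (f ` U n) \<le> Inf (f ` U n) + diameter (U n)"
          using False by (intro cSUP_least) auto
        then show ?thesis by simp
      qed
      moreover have "Inf (f ` U n) \<le> Sup (f ` U n)" using bb False by (intro cInf_le_cSup) auto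
      ultimately show ?thesis
        using bb by (intro exI[of _ "{Inf (f ` U n)..Sup (f ` U n)}"])
          (auto intro!: cInf_lower cSup_upper ennreal_leI)
    qed (auto intro!: exI[of _ "{}"])
    then obtain I where I: "\<And>n. f ` U n \<subseteq> I n" "\<And>n. I n \<in> sets borel" "\<And>n. emeasure lborel (I n) \<le> ennreal (diameter (U n))"
      by metis
    have "{a..b} \<subseteq> (\<Union>n. f ` U n)" using order_trans[OF ab(1) image_mono[OF U(1)]] by (simp add: image_UN)
    also have "\<dots> \<subseteq> (\<Union>n. I n)" using I(1) by (intro UN_mono) auto
    finally have "{a..b} \<subseteq> (\<Union>n. I n)" .
    then have "emeasure lborel {a..b} \<le> emeasure lborel (\<Union>n. I n)"
      using I(2) by (intro emeasure_mono) auto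
    also have "\<dots> \<le> (\<Sum>n. emeasure lborel (I n))" using I(2) by (intro emeasure_subadditive_countably) auto
    also have "\<dots> \<le> (\<Sum>n. ennreal (diameter (U n)))" by (intro suminf_le I) auto
    finally show "ennreal (b - a) \<le> (\<Sum>n. ennreal (diameter (U n)))" using ab(2) by simp
  qed
  then show ?thesis using hausdorff_pre_le_length[of 1 A] by simp
qed

text \<open>Cutting into \<open>N\<close> equal pieces gives arbitrarily fine covers whose diameters
  add up to at most the length.\<close>

lemma hausdorff_length_closed_segment_le:
  fixes a b :: "'a::euclidean_space"
  shows "hausdorff_length (closed_segment a b) \<le> ennreal (dist a b)"
  unfolding hausdorff_length_eq_SUP
proof (intro SUP_least)
  fix \<delta> :: real assume "\<delta> \<in> {0<..}"
  then have \<delta>: "0 < \<delta>" by simp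
  obtain N :: nat where N: "dist a b / \<delta> < real N" using reals_Archimedean2 by blast
  then have N0: "0 < N" using \<delta> by (metis divide_nonneg_pos of_nat_0 gr0I not_less zero_le_dist)
  define g where "g t = (1 - t) *\<^sub>R a + t *\<^sub>R b" for t
  have gd: "dist (g s) (g t) = \<bar>t - s\<bar> * dist a b" for s t
  proof -
    have "g s - g t = (t - s) *\<^sub>R (a - b)" by (simp add: g_def algebra_simps)
    then show ?thesis by (simp add: dist_norm)
  qed
  define U where "U n = (if n < N then closed_segment (g (real n / N)) (g (real (Suc n) / N)) else {})" for n
  have len: "dist (g (real n / N)) (g (real (Suc n) / N)) = dist a b / N" for n
    using N0 by (simp add: gd diff_divide_distrib[symmetric])
  have seg: "diameter (closed_segment p q) \<le> dist p q" for p q :: 'a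
  proof (rule diameter_le)
    fix x y assume "x \<in> closed_segment p q" "y \<in> closed_segment p q"
    then obtain s t where st: "0 \<le> s" "s \<le> 1" "0 \<le> t" "t \<le> 1"
      "x = (1 - s) *\<^sub>R p + s *\<^sub>R q" "y = (1 - t) *\<^sub>R p + t *\<^sub>R q"
      by (auto simp: closed_segment_def)
    have "x - y = (s - t) *\<^sub>R (q - p)" unfolding st(5,6) by (simp add: algebra_simps)
    then show "norm (x - y) \<le> dist p q"
      using st by (simp add: dist_norm norm_minus_commute mult_left_le_one_le)
  qed simp
  have dU: "diameter (U n) \<le> (if n < N then dist a b / N else 0)" for n
    using len[of n] seg[of "g (real n / N)" "g (real (Suc n) / N)"] by (auto simp: U_def)
  have dU0: "diameter (U n) = 0" if "\<not> n < N" for n using that by (simp add: U_def)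
  have "hausdorff_pre \<delta> (closed_segment a b) \<le> (\<Sum>n. ennreal (diameter (U n)))"
  proof (rule hausdorff_pre_lower)
    show "closed_segment a b \<subseteq> (\<Union>n. U n)"
    proof
      fix x assume "x \<in> closed_segment a b"
      then obtain t where t: "0 \<le> t" "t \<le> 1" "x = g t" by (auto simp: closed_segment_def g_def)
      \<comment> \<open>At \<open>t = 1\<close> the floor would give \<open>N\<close>, one past the
        last piece.\<close>
      define n where "n = (if t = 1 then N - 1 else nat \<lfloor>t * N\<rfloor>)"
      have n: "n < N" "real n \<le> t * N" "t * N \<le> real (Suc n)"
      proof -
        have "n < N \<and> real n \<le> t * N \<and> t * N \<le> real (Suc n)"
        proof (cases "t = 1")
          case True then show ?thesis using N0 by (auto simp: n_def)
        next
          case False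
          then have "t * N < N" using t N0 by simp
          moreover have "0 \<le> t * N" using t by simp
          ultimately show ?thesis using False unfolding n_def by (simp add: nat_less_iff floor_less_iff) linarith
        qed
        then show "n < N" "real n \<le> t * N" "t * N \<le> real (Suc n)" by auto
      qed
      define u where "u = t * N - real n"
      have u: "0 \<le> u" "u \<le> 1" using n by (auto simp: u_def)
      have "t = (1 - u) * (real n / N) + u * (real (Suc n) / N)"
        using N0 by (simp add: u_def field_simps)
      then have "x = (1 - u) *\<^sub>R g (real n / N) + u *\<^sub>R g (real (Suc n) / N)"
        unfolding t(3) g_def by (simp add: algebra_simps flip: scaleR_add_left)
      then have "x \<in> U n" using u n by (auto simp: U_def closed_segment_def)
      then show "x \<in> (\<Union>n. U n)" by blast
    qed
    show "bounded (U n)" for n by (auto simp: U_def bounded_closed_segment)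
    show "diameter (U n) \<le> \<delta>" for n
    proof -
      have "dist a b / N \<le> \<delta>" using N \<delta> N0 by (simp add: field_simps)
      then show ?thesis using dU[of n] \<delta> by (auto split: if_splits)
    qed
  qed
  also have "\<dots> = (\<Sum>n<N. ennreal (diameter (U n)))"
    by (rule suminf_finite) (auto simp: dU0)
  also have "\<dots> \<le> (\<Sum>n<N. ennreal (dist a b / N))"
    using dU by (intro sum_mono ennreal_leI) (metis lessThan_iff)
  also have "\<dots> = ennreal (dist a b)"
    using N0 by (simp add: ennreal_of_nat_eq_real_of_nat ennreal_mult[symmetric])
  finally show "hausdorff_pre \<delta> (closed_segment a b) \<le> ennreal (dist a b)" .
qed

text \<open>The distance from \<open>a\<close> is 1-Lipschitz and maps the segment onto
  \<open>{0..dist a b}\<close>.\<close>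

lemma hausdorff_length_closed_segment_ge:
  fixes a b :: "'a::euclidean_space"
  assumes "closed_segment a b \<subseteq> A"
  shows "ennreal (dist a b) \<le> hausdorff_length A"
proof -
  have "ennreal (dist a b - 0) \<le> hausdorff_length A"
  proof (rule hausdorff_length_ge_Lipschitz_image[where f = "\<lambda>x. dist a x"])
    show "\<bar>dist a x - dist a y\<bar> \<le> dist x y" for x y
      using dist_triangle[of a x y] dist_triangle[of a y x] by (simp add: dist_commute abs_le_iff)
    have "s \<in> (\<lambda>x. dist a x) ` closed_segment a b" if s: "0 \<le> s" "s \<le> dist a b" for s
    proof (cases "a = b")
      case False
      then show ?thesis using s
        by (intro image_eqI[of _ _ "(1 - s / dist a b) *\<^sub>R a + (s / dist a b) *\<^sub>R b"])
          (auto simp: closed_segment_def dist_norm algebra_simps simp flip: scaleR_diff_right intro!: exI[of _ "s / dist a b"])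
    qed (use s in auto)
    then show "{0..dist a b} \<subseteq> (\<lambda>x. dist a x) ` A" using assms by fastforce
  qed simp
  then show ?thesis by simp
qed

lemma hausdorff_length_finite_set: "finite A \<Longrightarrow> hausdorff_length (A :: 'a::euclidean_space set) = 0"
proof (induction A rule: finite_induct)
  case (insert x A)
  have "hausdorff_length {x} = 0" using hausdorff_length_closed_segment_le[of x x] by simp
  then show ?case using insert hausdorff_length_Un_le[of "{x}" A] by simp
qed simp

text \<open>The left side is the integral of the number of sets \<open>A i\<close> through a point;
  the finite set \<open>Z\<close>, where that number may be larger, has length zero. It is applied
  to frontiers of tiles with \<open>k = 2\<close> and to edges of one polygon with
  \<open>k = 1\<close>, with vertices in \<open>Z\<close>.\<close>

lemma sum_hausdorff_length_le:
  fixes A :: "'i \<Rightarrow> 'a::euclidean_space set"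
  assumes F: "finite F" and A: "\<And>i. i \<in> F \<Longrightarrow> A i \<in> sets borel" and Z: "finite Z"
    and le: "\<And>x. x \<notin> Z \<Longrightarrow> card {i\<in>F. x \<in> A i} \<le> k" and B: "(\<Union>i\<in>F. A i) \<subseteq> B"
  shows "(\<Sum>i\<in>F. hausdorff_length (A i)) \<le> of_nat k * hausdorff_length B"
proof -
  let ?M = "hausdorff_measure :: 'a measure"
  let ?U = "\<Union>i\<in>F. A i"
  have Um: "?U \<in> sets borel" using F A by auto
  have Zm: "Z \<in> sets borel" using Z by (simp add: finite_imp_closed borel_closed)
  have "(\<Sum>i\<in>F. hausdorff_length (A i)) = (\<Sum>i\<in>F. \<integral>\<^sup>+x. indicator (A i) x \<partial>?M)"
    using A by (intro sum.cong) (simp_all add: emeasure_hausdorff_measure)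
  also have "\<dots> = (\<integral>\<^sup>+x. (\<Sum>i\<in>F. indicator (A i) x) \<partial>?M)"
    using A by (intro nn_integral_sum[symmetric]) auto
  also have "\<dots> \<le> (\<integral>\<^sup>+x. of_nat k * indicator ?U x \<partial>?M)"
  proof (rule nn_integral_mono_AE)
    have "Z \<in> null_sets ?M"
      using Zm Z by (simp add: null_sets_def emeasure_hausdorff_measure hausdorff_length_finite_set)
    then have "AE x in ?M. x \<notin> Z" by (rule AE_not_in)
    then show "AE x in ?M. (\<Sum>i\<in>F. indicator (A i) x) \<le> (of_nat k * indicator ?U x :: ennreal)"
    proof (eventually_elim)
      case (elim x)
      have "(\<Sum>i\<in>F. indicator (A i) x) = (of_nat (card {i\<in>F. x \<in> A i}) :: ennreal)"
        using F by (simp add: indicator_def sum.If_cases Int_def)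
      also have "\<dots> \<le> of_nat k * indicator ?U x"
      proof (cases "x \<in> ?U")
        case True then show ?thesis using le[OF elim] by simp
      next
        case False
        then have "{i\<in>F. x \<in> A i} = {}" by auto
        show ?thesis unfolding \<open>{i\<in>F. x \<in> A i} = {}\<close> by simp
      qed
      finally show ?case .
    qed
  qed
  also have "\<dots> = of_nat k * hausdorff_length ?U"
    using Um by (simp add: nn_integral_cmult_indicator emeasure_hausdorff_measure)
  also have "\<dots> \<le> of_nat k * hausdorff_length B" using B by (intro mult_left_mono hausdorff_length_mono) auto
  finally show ?thesis .
qed

lemma hausdorff_length_le_sum:
  fixes A :: "'i \<Rightarrow> 'a::euclidean_space set"
  assumes F: "finite F" and A: "\<And>i. i \<in> F \<Longrightarrow> A i \<in> sets borel" and B: "B \<in> sets borel"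
    and ge: "\<And>x. x \<in> B \<Longrightarrow> k \<le> card {i\<in>F. x \<in> A i}"
  shows "of_nat k * hausdorff_length B \<le> (\<Sum>i\<in>F. hausdorff_length (A i))"
proof -
  let ?M = "hausdorff_measure :: 'a measure"
  have "of_nat k * hausdorff_length B = (\<integral>\<^sup>+x. of_nat k * indicator B x \<partial>?M)"
    using B by (simp add: nn_integral_cmult_indicator emeasure_hausdorff_measure)
  also have "\<dots> \<le> (\<integral>\<^sup>+x. (\<Sum>i\<in>F. indicator (A i) x) \<partial>?M)"
  proof (rule nn_integral_mono)
    fix x
    have "(\<Sum>i\<in>F. indicator (A i) x) = (of_nat (card {i\<in>F. x \<in> A i}) :: ennreal)"
      using F by (simp add: indicator_def sum.If_cases Int_def)
    then show "(of_nat k * indicator B x :: ennreal) \<le> (\<Sum>i\<in>F. indicator (A i) x)"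
      using ge[of x] by (auto simp: indicator_def)
  qed
  also have "\<dots> = (\<Sum>i\<in>F. \<integral>\<^sup>+x. indicator (A i) x \<partial>?M)"
    using A by (intro nn_integral_sum) auto
  also have "\<dots> = (\<Sum>i\<in>F. hausdorff_length (A i))"
    using A by (intro sum.cong) (simp_all add: emeasure_hausdorff_measure)
  finally show ?thesis .
qed

section \<open>Plane sectors and angles as area densities\<close>

definition cross2 :: "real^2 \<Rightarrow> real^2 \<Rightarrow> real" where
  "cross2 a b = a$1 * b$2 - a$2 * b$1"

definition dir :: "real \<Rightarrow> real^2" where "dir \<phi> = vector [cos \<phi>, sin \<phi>]"

lemma dir_nth [simp]: "dir \<phi> $ 1 = cos \<phi>" "dir \<phi> $ 2 = sin \<phi>"
  by (simp_all add: dir_def)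

lemma inner_real2: "(a :: real^2) \<bullet> b = a$1 * b$1 + a$2 * b$2"
  by (simp add: inner_vec_def sum_2)

lemma real2_eq_iff: "(a :: real^2) = b \<longleftrightarrow> a$1 = b$1 \<and> a$2 = b$2"
  by (simp add: vec_eq_iff forall_2)

lemma norm_real2: "norm (a :: real^2) = sqrt ((a$1)\<^sup>2 + (a$2)\<^sup>2)"
  by (simp add: norm_eq_sqrt_inner inner_real2 power2_eq_square)

lemma norm_dir [simp]: "norm (dir \<phi>) = 1"
  by (simp add: norm_real2)

lemma dir_neq_0 [simp]: "dir \<phi> \<noteq> 0"
  using norm_dir[of \<phi>] by force

lemma cross2_simps [simp]:
  "cross2 (a + b) c = cross2 a c + cross2 b c" "cross2 a (b + c) = cross2 a b + cross2 a c"
  "cross2 (a - b) c = cross2 a c - cross2 b c" "cross2 a (b - c) = cross2 a b - cross2 a c"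
  "cross2 (- a) c = - cross2 a c" "cross2 a (- c) = - cross2 a c"
  "cross2 (r *\<^sub>R a) c = r * cross2 a c" "cross2 a (r *\<^sub>R c) = r * cross2 a c"
  "cross2 a a = 0" "cross2 0 a = 0" "cross2 a 0 = 0"
  by (auto simp: cross2_def algebra_simps)

lemma cross2_commute: "cross2 a b = - cross2 b a"
  by (simp add: cross2_def)

lemma cross2_dir: "cross2 (dir a) (dir b) = sin (b - a)"
  by (simp add: cross2_def sin_diff)

lemma inner_dir: "dir a \<bullet> dir b = cos (b - a)"
  by (simp add: inner_real2 cos_diff)

lemma cross2_eq_inner: "cross2 a x = vector [- a$2, a$1] \<bullet> x"
  by (simp add: cross2_def inner_real2)

lemma bounded_linear_cross2: "bounded_linear (cross2 a)"
  unfolding cross2_eq_inner[abs_def] by (rule bounded_linear_inner_right)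

lemma cross2_vector_eq_0: "vector [- a$2, a$1] = (0::real^2) \<longleftrightarrow> (a::real^2) = 0"
  by (auto simp: real2_eq_iff)

lemma dir_add_2pi [simp]: "dir (\<phi> + 2*pi) = dir \<phi>" "dir (\<phi> + pi) = - dir \<phi>"
  by (simp_all add: real2_eq_iff)

text \<open>The range of \<phi> starts at an arbitrary \<psi>, so that angles can be measured from
  whatever direction an argument singles out.\<close>

lemma polar_real2:
  obtains \<phi> where "\<psi> \<le> \<phi>" "\<phi> < \<psi> + 2*pi" "x = norm x *\<^sub>R dir \<phi>"
proof (cases "x = 0")
  case True then show ?thesis using that[of \<psi>] by simp
next
  case False
  define y where "y = (1 / norm x) *\<^sub>R x"
  have "norm y = 1" using False by (simp add: y_def)
  then have y1: "(y$1)\<^sup>2 + (y$2)\<^sup>2 = 1" by (simp add: norm_real2)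
  define c where "c = y$1 * cos \<psi> + y$2 * sin \<psi>"
  define s where "s = y$2 * cos \<psi> - y$1 * sin \<psi>"
  have "c\<^sup>2 + s\<^sup>2 = ((y$1)\<^sup>2 + (y$2)\<^sup>2) * ((cos \<psi>)\<^sup>2 + (sin \<psi>)\<^sup>2)"
    unfolding c_def s_def by algebra
  then have "c\<^sup>2 + s\<^sup>2 = 1" using y1 by simp
  then obtain t where t: "0 \<le> t" "t < 2*pi" "c = cos t" "s = sin t"
    using sincos_total_2pi[of c s] by metis
  have pyth: "cos \<psi> * cos \<psi> + sin \<psi> * sin \<psi> = 1" using sin_cos_squared_add3[of \<psi>] by simp
  have "y = dir (\<psi> + t)"
  proof -
    have "cos \<psi> * c - sin \<psi> * s = y$1 * (cos \<psi> * cos \<psi> + sin \<psi> * sin \<psi>)"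
      "sin \<psi> * c + cos \<psi> * s = y$2 * (cos \<psi> * cos \<psi> + sin \<psi> * sin \<psi>)"
      unfolding c_def s_def by algebra+
    then show ?thesis unfolding pyth t by (simp add: real2_eq_iff cos_add sin_add)
  qed
  moreover have "x = norm x *\<^sub>R y" using False by (simp add: y_def)
  ultimately have "x = norm x *\<^sub>R dir (\<psi> + t)" by simp
  then show ?thesis using that[of "\<psi> + t"] t by simp
qed

section \<open>Areas of circular sectors\<close>

definition sector :: "real \<Rightarrow> real \<Rightarrow> real \<Rightarrow> (real^2) set" where
  "sector \<epsilon> \<psi> \<theta> = (\<lambda>(\<rho>, \<phi>). \<rho> *\<^sub>R dir \<phi>) ` ({0..\<epsilon>} \<times> {\<psi>..\<psi>+\<theta>})"

lemma sectorI: "0 \<le> \<rho> \<Longrightarrow> \<rho> \<le> \<epsilon> \<Longrightarrow> \<psi> \<le> \<phi> \<Longrightarrow> \<phi> \<le> \<psi> + \<theta> \<Longrightarrow> \<rho> *\<^sub>R dir \<phi> \<in> sector \<epsilon> \<psi> \<theta>"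
  unfolding sector_def by force

lemma compact_sector: "compact (sector \<epsilon> \<psi> \<theta>)"
proof -
  have "continuous_on ({0..\<epsilon>} \<times> {\<psi>..\<psi>+\<theta>}) (\<lambda>(\<rho>, \<phi>). \<rho> *\<^sub>R dir \<phi>)"
  proof -
    have d: "dir = (\<lambda>\<phi>. cos \<phi> *\<^sub>R axis 1 1 + sin \<phi> *\<^sub>R axis 2 1)"
      by (rule ext) (simp add: real2_eq_iff axis_def)
    show ?thesis unfolding d case_prod_unfold by (intro continuous_intros)
  qed
  then show ?thesis unfolding sector_def by (intro compact_continuous_image compact_Times) auto
qed

lemma sector_lmeasurable: "sector \<epsilon> \<psi> \<theta> \<in> lmeasurable"
  by (simp add: compact_sector lmeasurable_compact)

lemma measure_sector_rotate: "measure lebesgue (sector \<epsilon> \<psi> \<theta>) = measure lebesgue (sector \<epsilon> 0 \<theta>)"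
proof -
  define R :: "real^2 \<Rightarrow> real^2" where "R x = x$1 *\<^sub>R dir \<psi> + x$2 *\<^sub>R dir (\<psi> + pi/2)" for x
  have Rd: "R (\<rho> *\<^sub>R dir \<phi>) = \<rho> *\<^sub>R dir (\<psi> + \<phi>)" for \<rho> \<phi>
    by (simp add: R_def real2_eq_iff cos_add sin_add algebra_simps)
  have "linear R" by (rule linearI) (simp_all add: R_def algebra_simps)
  moreover have "R x \<bullet> R y = x \<bullet> y" for x y
  proof -
    have Rn: "R z $ 1 = z$1 * cos \<psi> - z$2 * sin \<psi>" "R z $ 2 = z$1 * sin \<psi> + z$2 * cos \<psi>" for z
      by (simp_all add: R_def cos_add sin_add)
    have "R x \<bullet> R y = (x$1*y$1 + x$2*y$2) * (cos \<psi> * cos \<psi> + sin \<psi> * sin \<psi>)"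
      unfolding inner_real2 Rn by algebra
    then show ?thesis using sin_cos_squared_add3[of \<psi>] by (simp add: inner_real2)
  qed
  ultimately have R: "orthogonal_transformation R" by (simp add: orthogonal_transformation_def)
  have "R ` sector \<epsilon> 0 \<theta> = sector \<epsilon> \<psi> \<theta>"
  proof
    show "R ` sector \<epsilon> 0 \<theta> \<subseteq> sector \<epsilon> \<psi> \<theta>"
      by (auto simp: sector_def[of _ 0] Rd intro!: sectorI)
    have "\<rho> *\<^sub>R dir \<phi> \<in> R ` sector \<epsilon> 0 \<theta>" if "0 \<le> \<rho>" "\<rho> \<le> \<epsilon>" "\<psi> \<le> \<phi>" "\<phi> \<le> \<psi> + \<theta>" for \<rho> \<phi>
      using that by (intro image_eqI[of _ _ "\<rho> *\<^sub>R dir (\<phi> - \<psi>)"]) (auto simp: Rd intro!: sectorI)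
    then show "sector \<epsilon> \<psi> \<theta> \<subseteq> R ` sector \<epsilon> 0 \<theta>" unfolding sector_def[of _ \<psi>] by auto
  qed
  then show ?thesis using measure_orthogonal_image[OF R sector_lmeasurable, of \<epsilon> 0 \<theta>] by simp
qed

lemma negligible_line_through_0: "a \<noteq> 0 \<Longrightarrow> negligible {x. cross2 a x = 0}"
  unfolding cross2_eq_inner by (rule negligible_hyperplane) (simp add: cross2_vector_eq_0)

text \<open>The two sectors overlap only along bounding rays. Two lines are needed to contain the
  overlap, because for a full turn the sectors also meet along the initial ray.\<close>

lemma measure_sector_add:
  assumes "0 \<le> \<alpha>" "0 \<le> \<beta>" "\<alpha> + \<beta> \<le> 2*pi"
  shows "measure lebesgue (sector \<epsilon> 0 (\<alpha> + \<beta>)) =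
    measure lebesgue (sector \<epsilon> 0 \<alpha>) + measure lebesgue (sector \<epsilon> 0 \<beta>)"
proof -
  have U: "sector \<epsilon> 0 (\<alpha> + \<beta>) = sector \<epsilon> 0 \<alpha> \<union> sector \<epsilon> \<alpha> \<beta>"
  proof -
    have "{0..0+(\<alpha>+\<beta>)} = {0..0+\<alpha>} \<union> {\<alpha>..\<alpha>+\<beta>}" using assms by auto
    then show ?thesis unfolding sector_def by (simp only: Times_Un_distrib1 Sigma_Un_distrib2 image_Un)
  qed
  have "sector \<epsilon> 0 \<alpha> \<inter> sector \<epsilon> \<alpha> \<beta> \<subseteq> {x. cross2 (dir 0) x = 0} \<union> {x. cross2 (dir \<alpha>) x = 0}"
  proof
    fix x assume "x \<in> sector \<epsilon> 0 \<alpha> \<inter> sector \<epsilon> \<alpha> \<beta>"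
    then have "\<exists>\<rho> \<phi>. x = \<rho> *\<^sub>R dir \<phi> \<and> 0 \<le> \<rho> \<and> 0 \<le> \<phi> \<and> \<phi> \<le> \<alpha>"
      "\<exists>\<rho> \<phi>. x = \<rho> *\<^sub>R dir \<phi> \<and> 0 \<le> \<rho> \<and> \<alpha> \<le> \<phi> \<and> \<phi> \<le> \<alpha> + \<beta>"
      unfolding sector_def by fastforce+
    then obtain \<rho> \<phi> \<rho>' \<phi>' where x: "x = \<rho> *\<^sub>R dir \<phi>" "x = \<rho>' *\<^sub>R dir \<phi>'" "0 \<le> \<rho>" "0 \<le> \<rho>'"
      "0 \<le> \<phi>" "\<phi> \<le> \<alpha>" "\<alpha> \<le> \<phi>'" "\<phi>' \<le> \<alpha> + \<beta>" by blast
    have "norm x = \<rho>" "norm x = \<rho>'" by (simp add: x(1,3)) (simp add: x(2,4))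
    then have rr: "\<rho> = \<rho>'" by simp
    show "x \<in> {x. cross2 (dir 0) x = 0} \<union> {x. cross2 (dir \<alpha>) x = 0}"
    proof (cases "\<rho> = 0")
      case False
      then have "dir \<phi> = dir \<phi>'" using x(1,2) rr by simp
      then have "cos (\<phi>' - \<phi>) = 1" using inner_dir[of \<phi> \<phi>'] by (simp add: dot_square_norm)
      then obtain k :: int where k: "\<phi>' - \<phi> = 2 * pi * k" by (auto simp: cos_one_2pi_int)
      have "0 \<le> \<phi>' - \<phi>" "\<phi>' - \<phi> \<le> 2*pi" using x assms by linarith+
      then have "0 \<le> real_of_int k" "real_of_int k \<le> 1" unfolding k using pi_gt_zero by (auto simp: zero_le_mult_iff)
      then have "k = 0 \<or> k = 1" by linarith
      then have "\<phi> = \<alpha> \<or> \<phi> = 0"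
      proof
        assume "k = 0"
        then have "\<phi>' = \<phi>" using k by simp
        then show ?thesis using x by linarith
      next
        assume "k = 1"
        then have "\<phi>' = \<phi> + 2*pi" using k by simp
        then show ?thesis using x assms by linarith
      qed
      then show ?thesis using x(1) by auto
    qed (use x in simp)
  qed
  then have "negligible (sector \<epsilon> 0 \<alpha> \<inter> sector \<epsilon> \<alpha> \<beta>)"
    by (rule negligible_subset[rotated]) (intro negligible_Un negligible_line_through_0 dir_neq_0)
  then show ?thesis unfolding U
    by (simp add: measure_Un3 sector_lmeasurable negligible_imp_measure0 measure_sector_rotate[of _ \<alpha>])
qed

text \<open>The area is additive and monotone in the angle and known for the full disc. Additivity
  fixes it at rational multiples of a full turn, and monotonicity squeezes the values in
  between.\<close>

lemma measure_sector:
  assumes "0 \<le> \<epsilon>" "0 \<le> \<theta>" "\<theta> \<le> 2*pi"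
  shows "measure lebesgue (sector \<epsilon> \<psi> \<theta>) = \<theta> / 2 * \<epsilon>\<^sup>2"
proof -
  define m where "m \<alpha> = measure lebesgue (sector \<epsilon> 0 \<alpha>)" for \<alpha>
  have add: "m (\<alpha> + \<beta>) = m \<alpha> + m \<beta>" if "0 \<le> \<alpha>" "0 \<le> \<beta>" "\<alpha> + \<beta> \<le> 2*pi" for \<alpha> \<beta>
    using measure_sector_add[OF that] by (simp add: m_def)
  have m0: "0 \<le> m \<alpha>" for \<alpha> by (simp add: m_def)
  have mono: "m \<alpha> \<le> m \<beta>" if "0 \<le> \<alpha>" "\<alpha> \<le> \<beta>" "\<beta> \<le> 2*pi" for \<alpha> \<beta>
    using add[of \<alpha> "\<beta> - \<alpha>"] m0[of "\<beta> - \<alpha>"] that by simp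
  have "sector \<epsilon> 0 (2*pi) = cball 0 \<epsilon>"
  proof
    show "sector \<epsilon> 0 (2*pi) \<subseteq> cball 0 \<epsilon>" by (auto simp: sector_def)
    show "cball 0 \<epsilon> \<subseteq> sector \<epsilon> 0 (2*pi)"
    proof
      fix x :: "real^2" assume "x \<in> cball 0 \<epsilon>"
      then have n: "norm x \<le> \<epsilon>" by simp
      obtain \<phi> where \<phi>: "0 \<le> \<phi>" "\<phi> < 0 + 2*pi" "x = norm x *\<^sub>R dir \<phi>" by (rule polar_real2)
      have "norm x *\<^sub>R dir \<phi> \<in> sector \<epsilon> 0 (2*pi)" using \<phi> n by (intro sectorI) auto
      then show "x \<in> sector \<epsilon> 0 (2*pi)" using \<phi>(3) by simp
    qed
  qed
  then have full: "m (2*pi) = pi * \<epsilon>\<^sup>2"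
    using assms by (simp add: m_def content_cball unit_ball_vol_2)
  have mult: "m (real k * (2*pi / real n)) = real k * (pi * \<epsilon>\<^sup>2 / real n)" if "0 < n" "k \<le> n" for k n
  proof -
    let ?t = "2*pi / real n"
    have "m (real k * ?t) = real k * m ?t" if "k \<le> n" for k using that
    proof (induction k)
      case 0
      show ?case using add[of 0 0] by simp
    next
      case (Suc k)
      have "real (Suc k) * ?t \<le> 2*pi"
        using Suc.prems \<open>0 < n\<close> by (simp add: divide_simps mult.commute flip: of_nat_Suc)
      moreover have split: "real (Suc k) * ?t = real k * ?t + ?t" using \<open>0 < n\<close> by (simp add: field_simps)
      ultimately have "m (real k * ?t + ?t) = m (real k * ?t) + m ?t"
        by (intro add) simp_all
      then show ?case unfolding split using Suc by (simp add: distrib_right)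
    qed
    from this[of n] this[of k] show ?thesis using that full by (simp add: field_simps)
  qed
  have "\<bar>m \<theta> - \<theta> / 2 * \<epsilon>\<^sup>2\<bar> \<le> e" if e: "0 < e" for e
  proof -
    obtain n :: nat where n: "pi * \<epsilon>\<^sup>2 / e < real n" using reals_Archimedean2 by blast
    then have n0: "0 < n" using e
      by (metis divide_nonneg_pos gr0I less_le_not_le mult_nonneg_nonneg of_nat_0 pi_ge_zero zero_le_power2)
    define k where "k = nat \<lfloor>\<theta> * n / (2*pi)\<rfloor>"
    have t0: "0 \<le> \<theta> * n / (2*pi)" using assms by simp
    have k1: "real k \<le> \<theta> * n / (2*pi)" "\<theta> * n / (2*pi) < real k + 1"
      unfolding k_def using t0 by (auto simp: of_nat_nat)
    have kn: "k \<le> n"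
    proof -
      have "\<theta> * n \<le> (2*pi) * n" using assms by (intro mult_right_mono) auto
      then have "\<theta> * n / (2*pi) \<le> n" by (simp add: divide_le_eq mult_ac)
      then show ?thesis using k1(1) by linarith
    qed
    let ?E = "pi * \<epsilon>\<^sup>2 / real n"
    have En: "?E \<le> e" using n e n0 by (simp add: field_simps)
    have low: "real k * ?E \<le> m \<theta>"
    proof -
      have "real k * (2*pi/n) \<le> \<theta>" using k1(1) n0 by (simp add: field_simps)
      then have "m (real k * (2*pi/n)) \<le> m \<theta>" using assms by (intro mono) auto
      then show ?thesis using mult[OF n0 kn] by simp
    qed
    have up: "m \<theta> \<le> (real k + 1) * ?E"
    \<comment> \<open>For \<open>k = n\<close> the next grid angle would exceed a full turn, so the
      disc itself serves as upper bound.\<close>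
    proof (cases "k = n")
      case True
      have "m \<theta> \<le> m (2*pi)" using assms by (intro mono) auto
      moreover have "(real k + 1) * ?E = pi * \<epsilon>\<^sup>2 + ?E"
        using n0 unfolding True by (simp add: field_simps)
      moreover have "0 \<le> ?E" by simp
      ultimately show ?thesis using full by linarith
    next
      case False
      then have "Suc k \<le> n" using kn by simp
      moreover have "\<theta> \<le> real (Suc k) * (2*pi/n)" using k1(2) n0 by (simp add: field_simps)
      moreover have "real (Suc k) * (2*pi/n) \<le> 2*pi" using \<open>Suc k \<le> n\<close> n0 by (simp add: field_simps flip: of_nat_Suc)
      ultimately have "m \<theta> \<le> m (real (Suc k) * (2*pi/n))" using assms by (intro mono) auto
      then show ?thesis using mult[OF n0 \<open>Suc k \<le> n\<close>] by (simp add: add.commute)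
    qed
    have "\<theta> / 2 * \<epsilon>\<^sup>2 = (\<theta> * n / (2*pi)) * ?E" using n0 by (simp add: field_simps)
    moreover have E0: "0 \<le> ?E" by simp
    ultimately have "real k * ?E \<le> \<theta> / 2 * \<epsilon>\<^sup>2" "\<theta> / 2 * \<epsilon>\<^sup>2 \<le> (real k + 1) * ?E"
      using mult_right_mono[OF k1(1) E0] mult_right_mono[OF less_imp_le[OF k1(2)] E0] by presburger+
    moreover have "(real k + 1) * ?E = real k * ?E + ?E" by (simp only: distrib_right mult_1)
    ultimately show ?thesis using low up En unfolding abs_le_iff by linarith
  qed
  then have "\<bar>m \<theta> - \<theta> / 2 * \<epsilon>\<^sup>2\<bar> \<le> 0" by (rule field_le_epsilon) simp
  then show ?thesis by (simp add: m_def measure_sector_rotate[of _ \<psi>])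
qed

text \<open>Up to the angle \<open>pi\<close> a wedge is an intersection of two half-planes, the
  form in which a convex polygon presents its corners.\<close>

lemma measure_cone_cball:
  assumes "0 \<le> \<epsilon>" "0 < \<theta>" "\<theta> \<le> pi"
  shows "measure lebesgue ({y. 0 \<le> cross2 (dir \<psi>) (y - x) \<and> 0 \<le> cross2 (y - x) (dir (\<psi> + \<theta>))} \<inter> cball x \<epsilon>)
    = \<theta> / 2 * \<epsilon>\<^sup>2" (is "measure lebesgue (?C \<inter> _) = _")
proof -
  have "?C \<inter> cball x \<epsilon> = (+) x ` sector \<epsilon> \<psi> \<theta>"
  proof (intro equalityI subsetI)
    fix y assume y: "y \<in> ?C \<inter> cball x \<epsilon>"
    obtain \<phi> where \<phi>: "\<psi> \<le> \<phi>" "\<phi> < \<psi> + 2*pi" "y - x = norm (y - x) *\<^sub>R dir \<phi>" by (rule polar_real2)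
    have n: "norm (y - x) \<le> \<epsilon>" using y by (simp add: dist_norm norm_minus_commute)
    show "y \<in> (+) x ` sector \<epsilon> \<psi> \<theta>"
    proof (cases "y = x")
      case True
      have "0 *\<^sub>R dir \<psi> \<in> sector \<epsilon> \<psi> \<theta>" using assms by (intro sectorI) auto
      then show ?thesis using True by force
    next
      case False
      have "0 \<le> cross2 (dir \<psi>) (norm (y - x) *\<^sub>R dir \<phi>)" "0 \<le> cross2 (norm (y - x) *\<^sub>R dir \<phi>) (dir (\<psi> + \<theta>))"
        using y \<phi>(3) by auto
      then have s: "0 \<le> sin (\<phi> - \<psi>)" "0 \<le> sin (\<psi> + \<theta> - \<phi>)"
        using False by (simp_all add: cross2_dir zero_le_mult_iff)
      have le: "\<phi> - \<psi> \<le> pi"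
      proof (rule ccontr)
        assume "\<not> \<phi> - \<psi> \<le> pi"
        then have "sin (\<phi> - \<psi>) < 0" using \<phi> by (intro sin_lt_zero) auto
        then show False using s by simp
      qed
      have "\<phi> \<le> \<psi> + \<theta>"
      proof (rule ccontr)
        assume "\<not> \<phi> \<le> \<psi> + \<theta>"
        then have "0 < sin (\<phi> - (\<psi> + \<theta>))" using le assms by (intro sin_gt_zero) auto
        moreover have "sin (\<phi> - (\<psi> + \<theta>)) = - sin (\<psi> + \<theta> - \<phi>)"
          by (metis minus_diff_eq sin_minus)
        ultimately show False using s by simp
      qed
      then have "norm (y - x) *\<^sub>R dir \<phi> \<in> sector \<epsilon> \<psi> \<theta>" using n \<phi> by (intro sectorI) auto
      then have "y - x \<in> sector \<epsilon> \<psi> \<theta>" using \<phi>(3) by simp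
      then show ?thesis by (intro image_eqI[of _ _ "y - x"]) auto
    qed
  next
    fix y assume "y \<in> (+) x ` sector \<epsilon> \<psi> \<theta>"
    then obtain \<rho> \<phi> where y: "y = x + \<rho> *\<^sub>R dir \<phi>" "0 \<le> \<rho>" "\<rho> \<le> \<epsilon>" "\<psi> \<le> \<phi>" "\<phi> \<le> \<psi> + \<theta>"
      by (auto simp: sector_def)
    have "0 \<le> sin (\<phi> - \<psi>)" "0 \<le> sin (\<psi> + \<theta> - \<phi>)" using y assms by (auto intro!: sin_ge_zero)
    then show "y \<in> ?C \<inter> cball x \<epsilon>" using y by (simp add: cross2_dir dist_norm)
  qed
  then show ?thesis using measure_translation[of x "sector \<epsilon> \<psi> \<theta>"] measure_sector[of \<epsilon> \<theta> \<psi>] assms by simp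
qed

text \<open>Equality for all small radii, rather than in the limit, lets finitely many tiles be
  compared exactly on one common disc.\<close>

definition has_angle :: "(real^2) set \<Rightarrow> real^2 \<Rightarrow> real \<Rightarrow> bool" where
  "has_angle P x \<theta> \<longleftrightarrow> (\<forall>\<^sub>F \<epsilon> in at_right 0. measure lebesgue (P \<inter> cball x \<epsilon>) = \<theta> / 2 * \<epsilon>\<^sup>2)"

definition angle_at :: "(real^2) set \<Rightarrow> real^2 \<Rightarrow> real" where
  "angle_at P x = (THE \<theta>. has_angle P x \<theta>)"

lemma has_angle_unique:
  assumes "has_angle P x \<theta>" "has_angle P x \<theta>'" shows "\<theta> = \<theta>'"
proof -
  have "\<forall>\<^sub>F \<epsilon> in at_right 0. \<theta> / 2 * \<epsilon>\<^sup>2 = \<theta>' / 2 * \<epsilon>\<^sup>2 \<and> \<epsilon> > (0::real)"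
    using assms eventually_at_right_less[of "0::real"] unfolding has_angle_def by eventually_elim auto
  then have "\<exists>\<epsilon>. \<theta> / 2 * \<epsilon>\<^sup>2 = \<theta>' / 2 * \<epsilon>\<^sup>2 \<and> \<epsilon> > (0::real)"
    by (rule eventually_happens'[OF trivial_limit_at_right_real])
  then show ?thesis by auto
qed

lemma has_angle_eq: "has_angle P x \<theta> \<Longrightarrow> angle_at P x = \<theta>"
  unfolding angle_at_def using has_angle_unique by blast

lemma has_angle_cone:
  assumes "0 < \<theta>" "\<theta> \<le> pi" "0 < \<delta>"
    and "\<And>y. dist x y < \<delta> \<Longrightarrow> y \<in> P \<longleftrightarrow> 0 \<le> cross2 (dir \<psi>) (y - x) \<and> 0 \<le> cross2 (y - x) (dir (\<psi> + \<theta>))"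
  shows "has_angle P x \<theta>"
  unfolding has_angle_def
proof (rule eventually_at_rightI[OF _ \<open>0 < \<delta>\<close>])
  fix \<epsilon> assume e: "\<epsilon> \<in> {0<..<\<delta>}"
  then have "P \<inter> cball x \<epsilon> = {y. 0 \<le> cross2 (dir \<psi>) (y - x) \<and> 0 \<le> cross2 (y - x) (dir (\<psi> + \<theta>))} \<inter> cball x \<epsilon>"
  proof (intro equalityI subsetI)
    fix y assume "y \<in> P \<inter> cball x \<epsilon>"
    then show "y \<in> {y. 0 \<le> cross2 (dir \<psi>) (y - x) \<and> 0 \<le> cross2 (y - x) (dir (\<psi> + \<theta>))} \<inter> cball x \<epsilon>"
      using assms(4)[of y] e by simp
  next
    fix y assume "y \<in> {y. 0 \<le> cross2 (dir \<psi>) (y - x) \<and> 0 \<le> cross2 (y - x) (dir (\<psi> + \<theta>))} \<inter> cball x \<epsilon>"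
    then show "y \<in> P \<inter> cball x \<epsilon>" using assms(4)[of y] e by simp
  qed
  then show "measure lebesgue (P \<inter> cball x \<epsilon>) = \<theta> / 2 * \<epsilon>\<^sup>2"
    using measure_cone_cball[of \<epsilon> \<theta> \<psi> x] assms(1,2) e by simp
qed

section \<open>Convex polygons\<close>

lemma cross2_eq_0D:
  assumes "cross2 a b = 0" "a \<noteq> 0" obtains t where "b = t *\<^sub>R a"
proof -
  have n: "a$1 * a$1 + a$2 * a$2 \<noteq> 0"
    using assms(2) by (simp add: real2_eq_iff sum_squares_eq_zero_iff)
  have "b = ((a \<bullet> b) / (a \<bullet> a)) *\<^sub>R a"
    using assms(1) n unfolding real2_eq_iff inner_real2 cross2_def by (simp add: field_simps; algebra)
  then show ?thesis by (rule that)
qed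

lemma cross2_inner_identity:
  "(a \<bullet> p) * cross2 a q - cross2 a p * (a \<bullet> q) = (a \<bullet> a) * cross2 p q"
  by (simp add: cross2_def inner_real2 algebra_simps)

lemma cross2_halfspace: "{x. 0 \<le> cross2 a (x - v)} = {x. vector [- a$2, a$1] \<bullet> x \<ge> cross2 a v}"
  by (simp add: cross2_eq_inner inner_diff_right)

lemma convex_cross2_halfspace: "convex {x. 0 \<le> cross2 a (x - v)}"
  unfolding cross2_halfspace by (rule convex_halfspace_ge)

lemma open_cross2_halfspace: "open {x. 0 < cross2 a (x - v)}"
  by (simp add: cross2_eq_inner inner_diff_right open_halfspace_gt)

section \<open>Vertices in counterclockwise order\<close>

definition vertices :: "(real^2) set \<Rightarrow> (real^2) set" where
  "vertices P = {x. x extreme_point_of P}"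

text \<open>The counterclockwise successor of \<open>v\<close>: the polygon lies to the left of the
  line from \<open>v\<close> to it.\<close>

definition next_vertex :: "(real^2) set \<Rightarrow> real^2 \<Rightarrow> real^2" where
  "next_vertex P v = (THE w. w \<in> vertices P \<and> w \<noteq> v \<and> (\<forall>x\<in>P. 0 \<le> cross2 (w - v) (x - v)))"

text \<open>Of three distinct collinear points one lies strictly between the other two and is not
  extreme; the cases for \<open>t\<close> tell which one.\<close>

lemma extreme_not_collinear:
  assumes "a \<in> vertices P" "b \<in> vertices P" "c \<in> vertices P" "a \<noteq> b" "a \<noteq> c" "b \<noteq> c"
  shows "cross2 (b - a) (c - a) \<noteq> 0"
proof
  assume c0: "cross2 (b - a) (c - a) = 0"
  obtain t where t: "c - a = t *\<^sub>R (b - a)" using cross2_eq_0D[OF c0] assms(4) by auto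
  have ext: "p \<in> P" "\<And>x y. x \<in> P \<Longrightarrow> y \<in> P \<Longrightarrow> p \<notin> open_segment x y" if "p \<in> vertices P" for p
    using that by (auto simp: vertices_def extreme_point_of_def)
  have seg: "x + u *\<^sub>R (y - x) \<in> open_segment x y" if "0 < u" "u < 1" "x \<noteq> y" for x y :: "real^2" and u
    using that by (auto simp: in_segment algebra_simps intro!: exI[of _ u])
  consider "t < 0" | "t = 0" | "0 < t" "t < 1" | "t = 1" | "1 < t" by linarith
  then show False
  proof cases
    case 1
    have "(1 - t) *\<^sub>R a = c - t *\<^sub>R b" using t by (simp add: algebra_simps)
    then have "a = (1 / (1 - t)) *\<^sub>R (c - t *\<^sub>R b)" using 1 by (simp flip: \<open>(1 - t) *\<^sub>R a = _\<close>)
    also have "\<dots> = b + (1 / (1 - t)) *\<^sub>R (c - b)"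
    proof -
      have "(1 / (1 - t)) *\<^sub>R ((1 - t) *\<^sub>R b) = b" using 1 by simp
      then have "b + (1 / (1 - t)) *\<^sub>R (c - b) = (1 / (1 - t)) *\<^sub>R ((1 - t) *\<^sub>R b + (c - b))"
        by (simp add: scaleR_add_right)
      then show ?thesis by (simp add: algebra_simps)
    qed
    finally have ab: "a = b + (1 / (1 - t)) *\<^sub>R (c - b)" .
    have "a \<in> open_segment b c" using seg[of "1 / (1 - t)" b c] 1 assms by (subst ab) (simp add: field_simps)
    then show False using ext assms by blast
  next
    case 3
    have "c = a + t *\<^sub>R (b - a)" using t by (simp add: algebra_simps)
    then have "c \<in> open_segment a b" using seg[of t a b] 3 assms by simp
    then show False using ext assms by blast
  next
    case 5
    have "b - a = (1 / t) *\<^sub>R (c - a)" using t 5 by simp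
    then have "b = a + (1 / t) *\<^sub>R (c - a)" by (simp add: algebra_simps)
    then have "b \<in> open_segment a c" using seg[of "1 / t" a c] 5 assms by simp
    then show False using ext assms by blast
  qed (use t assms in auto)
qed

locale polygon =
  fixes P :: "(real^2) set"
  assumes convex_polygon: "convex_polygon P"
begin

abbreviation "V \<equiv> vertices P"
abbreviation "nxt \<equiv> next_vertex P"

lemma polytope: "polytope P" and interior_nonempty: "interior P \<noteq> {}"
  using convex_polygon by (auto simp: convex_polygon_def)

lemma compact: "compact P" and convex: "convex P" and closed: "closed P" and bounded: "bounded P"
  using polytope by (auto simp: polytope_imp_compact polytope_imp_convex polytope_imp_closed polytope_imp_bounded)

lemma finite_V: "finite V"
  unfolding vertices_def using polytope finite_polyhedron_extreme_points polytope_imp_polyhedron by blast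

lemma hull_V: "P = convex hull V"
  unfolding vertices_def by (rule Krein_Milman_Minkowski[OF compact convex])

lemma V_subset: "V \<subseteq> P"
  by (auto simp: vertices_def extreme_point_of_def)

text \<open>A linear functional separates \<open>v\<close> from the other vertices. Seen from
  \<open>v\<close> they lie in an open half-plane, where directions are ordered by the slope
  \<open>?r\<close>; the vertex of least slope has all others on its left.\<close>

lemma nxt_ex: "v \<in> V \<Longrightarrow> \<exists>w\<in>V. w \<noteq> v \<and> (\<forall>x\<in>P. 0 \<le> cross2 (w - v) (x - v))"
proof -
  assume v: "v \<in> V"
  let ?W = "V - {v}"
  have vnot: "v \<notin> convex hull ?W"
  proof
    assume h: "v \<in> convex hull ?W"
    have "convex hull (insert v ?W) = convex hull ?W" by (rule hull_redundant[OF h])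
    then have "P = convex hull ?W" using hull_V v by (simp add: insert_absorb)
    then have "v \<in> ?W" using v extreme_point_of_convex_hull[of v ?W] by (simp add: vertices_def)
    then show False by simp
  qed
  have Wne: "?W \<noteq> {}"
  proof
    assume "?W = {}"
    then have "V = {v}" using v by blast
    then have "P = {v}" using hull_V by simp
    then show False using interior_nonempty by simp
  qed
  have "closed (convex hull ?W)"
    using finite_V by (intro compact_imp_closed finite_imp_compact_convex_hull) auto
  then obtain a b where ab: "a \<bullet> v < b" "\<And>x. x \<in> convex hull ?W \<Longrightarrow> b < a \<bullet> x"
    using separating_hyperplane_closed_point[of "convex hull ?W" v] vnot by auto
  have f: "0 < a \<bullet> (x - v)" if "x \<in> ?W" for x
    using ab(1) ab(2)[of x] hull_inc[OF that, of convex] by (simp add: inner_diff_right)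
  let ?r = "\<lambda>x. cross2 a (x - v) / (a \<bullet> (x - v))"
  have "Min (?r ` ?W) \<in> ?r ` ?W" using finite_V Wne by (intro Min_in) auto
  then obtain w where w': "Min (?r ` ?W) = ?r w" "w \<in> ?W" by (rule imageE)
  then have w: "w \<in> ?W" "?r w = Min (?r ` ?W)" by simp_all
  have min: "?r w \<le> ?r x" if "x \<in> ?W" for x
    unfolding w(2) using that finite_V by (intro Min_le) auto
  have a0: "0 < a \<bullet> a" using f[OF w(1)] by (auto simp: inner_gt_zero_iff)
  have "0 \<le> cross2 (w - v) (x - v)" if "x \<in> ?W" for x
  proof -
    have "cross2 a (w - v) * (a \<bullet> (x - v)) \<le> cross2 a (x - v) * (a \<bullet> (w - v))"
      using min[OF that] f[OF that] f[OF w(1)] by (simp add: divide_le_eq pos_le_divide_eq field_simps del: cross2_simps)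
    then have "0 \<le> (a \<bullet> a) * cross2 (w - v) (x - v)"
      using cross2_inner_identity[of a "w - v" "x - v"] by (simp add: mult.commute del: cross2_simps)
    then show ?thesis using a0 by (simp add: zero_le_mult_iff del: cross2_simps)
  qed
  then have "V \<subseteq> {x. 0 \<le> cross2 (w - v) (x - v)}" by fastforce
  then have "P \<subseteq> {x. 0 \<le> cross2 (w - v) (x - v)}"
    by (subst hull_V) (intro hull_minimal convex_cross2_halfspace)
  then show ?thesis using w(1) by blast
qed

lemma nxt_eqI:
  assumes "v \<in> V" "w \<in> V" "w \<noteq> v" "\<And>x. x \<in> P \<Longrightarrow> 0 \<le> cross2 (w - v) (x - v)"
  shows "nxt v = w"
  unfolding next_vertex_def
proof (rule the_equality)
  fix u assume u: "u \<in> V \<and> u \<noteq> v \<and> (\<forall>x\<in>P. 0 \<le> cross2 (u - v) (x - v))"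
  have "0 \<le> cross2 (w - v) (u - v)" "0 \<le> cross2 (u - v) (w - v)"
    using assms u V_subset by blast+
  then have "cross2 (w - v) (u - v) = 0" using cross2_commute[of "u - v" "w - v"] by linarith
  then show "u = w" using extreme_not_collinear[of v P w u] assms u by blast
qed (use assms in blast)

lemma nxt_props:
  assumes "v \<in> V"
  shows nxt_in: "nxt v \<in> V" and nxt_neq: "nxt v \<noteq> v"
    and nxt_left: "\<And>x. x \<in> P \<Longrightarrow> 0 \<le> cross2 (nxt v - v) (x - v)"
  using nxt_ex[OF assms] nxt_eqI[OF assms] by (auto simp del: cross2_simps)

lemma nxt_left_strict:
  assumes "v \<in> V" "x \<in> V" "x \<noteq> v" "x \<noteq> nxt v"
  shows "0 < cross2 (nxt v - v) (x - v)"
  using nxt_left[of v x] extreme_not_collinear[of v P "nxt v" x] assms nxt_in[of v] nxt_neq[of v] V_subset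
  by (metis less_le subsetD)

lemma inj_nxt: "inj_on nxt V"
proof (rule inj_onI, rule ccontr)
  fix u v assume uv: "u \<in> V" "v \<in> V" "nxt u = nxt v" "u \<noteq> v"
  have "0 < cross2 (nxt u - u) (v - u)" "0 < cross2 (nxt u - v) (u - v)"
    using nxt_left_strict[of u v] nxt_left_strict[of v u] nxt_neq[of u] nxt_neq[of v] uv by (auto simp del: cross2_simps)
  moreover have "cross2 (nxt u - v) (u - v) = - cross2 (nxt u - u) (v - u)" by (simp add: cross2_def algebra_simps)
  ultimately show False by simp
qed

lemma nxt_image: "nxt ` V = V"
  by (rule endo_inj_surj[OF finite_V _ inj_nxt]) (use nxt_in in blast)

text \<open>If two steps led back to \<open>v\<close>, a third vertex would lie strictly on both
  sides of one line; without one, \<open>P\<close> is a segment.\<close>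

lemma nxt_nxt_neq:
  assumes v: "v \<in> V" shows "nxt (nxt v) \<noteq> v"
proof
  assume e: "nxt (nxt v) = v"
  have "V \<subseteq> {v, nxt v}"
  proof (rule ccontr)
    assume "\<not> V \<subseteq> {v, nxt v}"
    then obtain x where x: "x \<in> V" "x \<noteq> v" "x \<noteq> nxt v" by blast
    have "0 < cross2 (nxt v - v) (x - v)" using nxt_left_strict v x by blast
    moreover have "0 < cross2 (v - nxt v) (x - nxt v)"
      using nxt_left_strict[of "nxt v" x] nxt_in[OF v] x e by auto
    ultimately show False by (simp add: cross2_def algebra_simps)
  qed
  then have "V = {v, nxt v}" using v nxt_in by blast
  then have "P = closed_segment v (nxt v)" using hull_V by (metis segment_convex_hull)
  then show False using interior_nonempty interior_closed_segment_ge2[of v "nxt v"] by simp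
qed

section \<open>Edges and the frontier\<close>

abbreviation "edge v \<equiv> closed_segment v (nxt v)"

lemma edge_props:
  assumes v: "v \<in> V"
  shows edge_eq: "edge v = P \<inter> {x. cross2 (nxt v - v) (x - v) = 0}" and edge_face: "edge v face_of P"
proof -
  let ?F = "P \<inter> {x. cross2 (nxt v - v) (x - v) = 0}"
  have h: "cross2 (nxt v - v) (x - v) = vector [- (nxt v - v)$2, (nxt v - v)$1] \<bullet> x - vector [- (nxt v - v)$2, (nxt v - v)$1] \<bullet> v" for x
    by (simp only: cross2_eq_inner inner_diff_right)
  have "?F face_of P"
    using face_of_Int_supporting_hyperplane_ge[OF convex, of "vector [- (nxt v - v)$2, (nxt v - v)$1] \<bullet> v" "vector [- (nxt v - v)$2, (nxt v - v)$1]"]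
      nxt_left[OF v] unfolding h by simp
  moreover have "?F = edge v"
  proof -
    have "{x. x extreme_point_of ?F} = {v, nxt v}"
    proof -
      \<comment> \<open>The extreme points of a face are the vertices of \<open>P\<close> on it, and
        all vertices but these two are strictly to the left.\<close>
      have "{x. x extreme_point_of ?F} = V \<inter> ?F"
        using extreme_point_of_face[OF \<open>?F face_of P\<close>] by (auto simp: vertices_def simp del: cross2_simps)
      also have "\<dots> = {v, nxt v}"
        using nxt_left_strict[OF v] v nxt_in[OF v] V_subset by (auto simp del: cross2_simps(3,4)) (metis less_irrefl)+
      finally show ?thesis .
    qed
    moreover have "?F = convex hull {x. x extreme_point_of ?F}"
      using \<open>?F face_of P\<close> by (intro Krein_Milman_Minkowski face_of_imp_compact[OF convex compact] face_of_imp_convex[of _ P])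
    ultimately show ?thesis by (metis segment_convex_hull)
  qed
  ultimately show "edge v = ?F" "edge v face_of P" by simp_all
qed

lemma edge_edge_of: "v \<in> V \<Longrightarrow> edge v edge_of P"
  using edge_face nxt_neq[of v] by (simp add: edge_of_def segment_convex_hull aff_dim_convex_hull aff_dim_2)

text \<open>A supporting line cuts the edge out of \<open>P\<close>. Its direction vector is a
  multiple \<open>k\<close> of the rotated normal, and the sign of \<open>k\<close> decides which
  endpoint comes first counterclockwise.\<close>

lemma edge_of_cases:
  assumes e: "e edge_of P" obtains v where "v \<in> V" "e = edge v"
proof -
  have ef: "e face_of P" "aff_dim e = 1" using e by (auto simp: edge_of_def)
  have dP: "aff_dim P = 2" using interior_nonempty aff_dim_nonempty_interior[of P] by simp
  have "e exposed_face_of P" using ef polytope by (simp add: exposed_face_of_polyhedron polytope_imp_polyhedron)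
  then obtain a b where ab: "P \<subseteq> {x. a \<bullet> x \<le> b}" "e = P \<inter> {x. a \<bullet> x = b}"
    by (auto simp: exposed_face_of_def)
  have ene: "e \<noteq> {}" "e \<noteq> P" using ef dP by auto
  have a0: "a \<noteq> 0"
    using ab ene by auto
  have "collinear e" using ef by (simp add: collinear_aff_dim)
  then obtain p q where pq: "e = closed_segment p q"
    using compact_convex_collinear_segment[OF ene(1)] face_of_imp_compact[OF convex compact ef(1)] face_of_imp_convex[OF ef(1)]
    by blast
  have pne: "p \<noteq> q" using pq ef by auto
  have pqV: "p \<in> V" "q \<in> V"
    using extreme_point_of_face[OF ef(1)] extreme_point_of_segment[of _ p q] by (auto simp: vertices_def pq)
  have "p \<in> e" "q \<in> e" using pq by auto
  then have apq: "a \<bullet> p = b" "a \<bullet> q = b" using ab(2) by auto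
  have "cross2 (vector [- a$2, a$1]) (q - p) = 0"
    using apq by (simp add: cross2_def inner_real2 algebra_simps)
  then obtain k where k: "q - p = k *\<^sub>R vector [- a$2, a$1]"
    using a0 by (auto elim!: cross2_eq_0D simp: cross2_vector_eq_0 simp del: cross2_simps)
  have k0: "k \<noteq> 0" using k pne by auto
  have cr: "cross2 (q - p) y = - k * (a \<bullet> y)" for y
    unfolding k by (simp add: cross2_def inner_real2 algebra_simps)
  have ax: "a \<bullet> (x - p) \<le> 0" "a \<bullet> (x - q) \<le> 0" if "x \<in> P" for x
    using ab(1) that apq by (auto simp: inner_diff_right)
  show ?thesis
  proof (cases "0 < k")
    case True
    have "nxt p = q"
      using ax(1) True pqV pne by (intro nxt_eqI) (simp_all add: cr mult_le_0_iff del: cross2_simps)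
    then show ?thesis using that[of p] pqV pq by simp
  next
    case False
    have "cross2 (p - q) y = k * (a \<bullet> y)" for y
      using cr[of y] by simp
    then have "nxt q = p"
      using ax(2) False k0 pqV pne by (intro nxt_eqI) (simp_all add: zero_le_mult_iff del: cross2_simps)
    then show ?thesis using that[of q] pqV pq by (simp add: closed_segment_commute)
  qed
qed

lemma edge_inj: "inj_on edge V"
proof (rule inj_onI)
  fix v w assume vw: "v \<in> V" "w \<in> V" "edge v = edge w"
  then have "{v, nxt v} = {w, nxt w}" by (simp add: closed_segment_eq)
  then show "v = w" using nxt_nxt_neq[of v] nxt_nxt_neq[of w] vw by (auto simp: doubleton_eq_iff)
qed

lemma edges_eq: "{e. e edge_of P} = edge ` V"
  using edge_edge_of by (auto elim!: edge_of_cases)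

lemma num_sides_eq: "num_sides P = card V"
  unfolding num_sides_def edges_eq by (rule card_image[OF edge_inj])

lemma frontier_eq: "frontier P = (\<Union>v\<in>V. edge v)"
proof -
  have dP: "aff_dim P = 2" using interior_nonempty aff_dim_nonempty_interior[of P] by simp
  have "frontier P = rel_frontier P" using interior_nonempty by (simp add: rel_frontier_nonempty_interior)
  also have "\<dots> = \<Union> {F. F facet_of P}" using polytope by (simp add: rel_frontier_of_polyhedron polytope_imp_polyhedron)
  also have "{F. F facet_of P} = {F. F edge_of P}"
    using dP by (auto simp: facet_of_def edge_of_def)
  also have "\<dots> = edge ` V" by (rule edges_eq)
  finally show ?thesis .
qed

lemma edge_frontier: "v \<in> V \<Longrightarrow> edge v \<subseteq> frontier P"
  using frontier_eq by blast

lemma frontier_subset: "frontier P \<subseteq> P"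
  using closed by (simp add: frontier_subset_closed)

lemma interior_left:
  assumes "v \<in> V" "x \<in> interior P" shows "0 < cross2 (nxt v - v) (x - v)"
proof -
  have "x \<in> P" using assms interior_subset by blast
  moreover have "x \<notin> edge v" using edge_frontier[OF assms(1)] assms(2) by (auto simp: frontier_def)
  ultimately show ?thesis using nxt_left[OF assms(1), of x] edge_eq[OF assms(1)]
    by (auto simp: less_le simp del: cross2_simps)
qed

text \<open>Suppose \<open>x\<close> outside \<open>P\<close> satisfied all inequalities. The ray
  from an interior point \<open>c\<close> to \<open>x\<close> leaves \<open>P\<close> through some
  edge, at or before \<open>x\<close>. The affine function of that edge is positive at
  \<open>c\<close> and nonnegative at \<open>x\<close>, so it can vanish only at \<open>x\<close>,
  which would then lie in \<open>P\<close>.\<close>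

lemma eq_halfplanes: "P = {x. \<forall>v\<in>V. 0 \<le> cross2 (nxt v - v) (x - v)}"
proof
  show "P \<subseteq> {x. \<forall>v\<in>V. 0 \<le> cross2 (nxt v - v) (x - v)}" using nxt_left by blast
  show "{x. \<forall>v\<in>V. 0 \<le> cross2 (nxt v - v) (x - v)} \<subseteq> P"
  proof (rule subsetI, rule ccontr)
    fix x assume "x \<in> {x. \<forall>v\<in>V. 0 \<le> cross2 (nxt v - v) (x - v)}" and x2: "x \<notin> P"
    then have x: "\<forall>v\<in>V. 0 \<le> cross2 (nxt v - v) (x - v)" "x \<notin> P" by blast+
    obtain c where c: "c \<in> interior P" using interior_nonempty by blast
    have "c \<in> P" using c interior_subset by blast
    then obtain d where d: "0 < d" "c + d *\<^sub>R (x - c) \<in> frontier P"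
      "\<And>e. 0 \<le> e \<Longrightarrow> e < d \<Longrightarrow> c + e *\<^sub>R (x - c) \<in> interior P"
      using ray_to_frontier[OF bounded c, of "x - c"] x(2) by auto
    have d1: "d \<le> 1"
    proof (rule ccontr)
      assume "\<not> d \<le> 1"
      then have "c + 1 *\<^sub>R (x - c) \<in> interior P" by (intro d(3)) auto
      then show False using x(2) interior_subset by auto
    qed
    obtain v where v: "v \<in> V" "c + d *\<^sub>R (x - c) \<in> edge v" using d(2) frontier_eq by blast
    have "cross2 (nxt v - v) (c + d *\<^sub>R (x - c) - v) = 0" using v edge_eq by blast
    moreover have "c + d *\<^sub>R (x - c) - v = (1 - d) *\<^sub>R (c - v) + d *\<^sub>R (x - v)" by (simp add: algebra_simps)
    ultimately have "(1 - d) * cross2 (nxt v - v) (c - v) + d * cross2 (nxt v - v) (x - v) = 0"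
      by (simp only: cross2_simps(2,8))
    moreover have "0 < cross2 (nxt v - v) (c - v)" using interior_left v c by blast
    moreover have "0 \<le> cross2 (nxt v - v) (x - v)" using x v by blast
    ultimately have "(1 - d) * cross2 (nxt v - v) (c - v) = 0"
      using d d1 by (smt (verit) mult_nonneg_nonneg)
    then have "d = 1" using \<open>0 < cross2 (nxt v - v) (c - v)\<close> by (simp del: cross2_simps)
    then show False using d(2) frontier_subset x(2) by auto
  qed
qed

text \<open>The affine function that vanishes on \<open>edge v\<close> is nonnegative at both ends
  of \<open>edge w\<close> and positive at one of them, so a common point is the other end.\<close>

lemma edge_Int_edge:
  assumes "v \<in> V" "w \<in> V" "v \<noteq> w" "x \<in> edge v" "x \<in> edge w" shows "x \<in> V"
proof -
  obtain t where t: "0 \<le> t" "t \<le> 1" "x = (1 - t) *\<^sub>R w + t *\<^sub>R nxt w"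
    using assms(5) by (auto simp: closed_segment_def)
  have z: "cross2 (nxt v - v) (x - v) = 0" using edge_eq assms by blast
  have nw: "nxt w \<in> V" using nxt_in assms by blast
  have "x - v = (1 - t) *\<^sub>R (w - v) + t *\<^sub>R (nxt w - v)" using t by (simp add: algebra_simps)
  then have eq: "(1 - t) * cross2 (nxt v - v) (w - v) + t * cross2 (nxt v - v) (nxt w - v) = 0"
    using z by (simp only: cross2_simps(2,8))
  have nn: "0 \<le> cross2 (nxt v - v) (w - v)" "0 \<le> cross2 (nxt v - v) (nxt w - v)"
    using nxt_left assms nw V_subset by blast+
  have "w \<noteq> nxt v \<or> nxt w \<noteq> v" using nxt_nxt_neq assms by blast
  then have "0 < cross2 (nxt v - v) (w - v) \<or> 0 < cross2 (nxt v - v) (nxt w - v)"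
  proof
    assume "w \<noteq> nxt v" then show ?thesis using nxt_left_strict[of v w] assms by blast
  next
    assume "nxt w \<noteq> v"
    moreover have "nxt w \<noteq> nxt v" using inj_nxt assms by (auto dest: inj_onD)
    ultimately show ?thesis using nxt_left_strict[of v "nxt w"] assms nw by blast
  qed
  then have "t = 1 \<or> t = 0"
  proof -
    have "0 \<le> (1 - t) * cross2 (nxt v - v) (w - v)" "0 \<le> t * cross2 (nxt v - v) (nxt w - v)"
      using nn t by (simp_all only: mult_nonneg_nonneg diff_ge_0_iff_ge)
    then have "(1 - t) * cross2 (nxt v - v) (w - v) = 0" "t * cross2 (nxt v - v) (nxt w - v) = 0"
      using eq by linarith+
    then have "1 - t = 0 \<or> cross2 (nxt v - v) (w - v) = 0" "t = 0 \<or> cross2 (nxt v - v) (nxt w - v) = 0"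
      by (simp_all only: mult_eq_0_iff)
    then show ?thesis using \<open>0 < cross2 (nxt v - v) (w - v) \<or> _\<close> by linarith
  qed
  then show ?thesis using t(3) assms nw by auto
qed

lemma vertex_in_edge:
  assumes "x \<in> V" "v \<in> V" "x \<in> edge v" shows "x = v \<or> x = nxt v"
proof -
  have "cross2 (nxt v - v) (x - v) = 0" using edge_eq assms by blast
  then show ?thesis using nxt_left_strict[of v x] assms by force
qed

text \<open>Edges that miss \<open>x\<close> give strict inequalities, and finitely many of these
  persist on a small disc.\<close>

lemma local_halfplanes:
  assumes "x \<in> P"
  obtains \<delta> where "0 < \<delta>" "\<And>y. dist x y < \<delta> \<Longrightarrow> y \<in> P \<longleftrightarrow> (\<forall>v\<in>V. x \<in> edge v \<longrightarrow> 0 \<le> cross2 (nxt v - v) (y - x))"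
proof -
  let ?W = "{v\<in>V. x \<notin> edge v}"
  have "open (\<Inter>v\<in>?W. {y. 0 < cross2 (nxt v - v) (y - v)})"
    using finite_V by (intro open_INT ballI open_cross2_halfspace) auto
  moreover have "x \<in> (\<Inter>v\<in>?W. {y. 0 < cross2 (nxt v - v) (y - v)})"
  proof (intro INT_I CollectI)
    fix v assume "v \<in> ?W"
    then have v: "v \<in> V" "x \<notin> edge v" by auto
    then have "cross2 (nxt v - v) (x - v) \<noteq> 0" using edge_eq[OF v(1)] assms by blast
    then show "0 < cross2 (nxt v - v) (x - v)" using nxt_left[OF v(1) assms] by linarith
  qed
  ultimately obtain \<delta> where \<delta>: "0 < \<delta>" "ball x \<delta> \<subseteq> (\<Inter>v\<in>?W. {y. 0 < cross2 (nxt v - v) (y - v)})"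
    using open_contains_ball by meson
  show ?thesis
  proof (rule that[OF \<delta>(1)])
    fix y assume y: "dist x y < \<delta>"
    have tight: "cross2 (nxt v - v) (y - v) = cross2 (nxt v - v) (y - x)" if "v \<in> V" "x \<in> edge v" for v
    proof -
      have "cross2 (nxt v - v) (x - v) = 0" using edge_eq that by blast
      then show ?thesis by simp
    qed
    have loose: "0 \<le> cross2 (nxt v - v) (y - v)" if "v \<in> V" "x \<notin> edge v" for v
    proof -
      have "y \<in> (\<Inter>v\<in>?W. {y. 0 < cross2 (nxt v - v) (y - v)})" using y \<delta>(2) by auto
      then show ?thesis using that by (auto intro: less_imp_le simp del: cross2_simps)
    qed
    show "y \<in> P \<longleftrightarrow> (\<forall>v\<in>V. x \<in> edge v \<longrightarrow> 0 \<le> cross2 (nxt v - v) (y - x))"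
    proof
      assume "y \<in> P"
      then show "\<forall>v\<in>V. x \<in> edge v \<longrightarrow> 0 \<le> cross2 (nxt v - v) (y - x)"
        using nxt_left[of _ y] tight by metis
    next
      assume "\<forall>v\<in>V. x \<in> edge v \<longrightarrow> 0 \<le> cross2 (nxt v - v) (y - x)"
      then have "\<forall>v\<in>V. 0 \<le> cross2 (nxt v - v) (y - v)" using tight loose by metis
      then show "y \<in> P" by (subst eq_halfplanes) simp
    qed
  qed
qed

lemma angle_edge:
  assumes "x \<in> frontier P" "x \<notin> V" shows "has_angle P x pi"
proof -
  obtain v where v: "v \<in> V" "x \<in> edge v" using assms frontier_eq by blast
  have uniq: "w = v" if "w \<in> V" "x \<in> edge w" for w using edge_Int_edge v that assms by blast
  obtain \<delta> where \<delta>: "0 < \<delta>" "\<And>y. dist x y < \<delta> \<Longrightarrow> y \<in> P \<longleftrightarrow> (\<forall>v\<in>V. x \<in> edge v \<longrightarrow> 0 \<le> cross2 (nxt v - v) (y - x))"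
    using local_halfplanes assms frontier_subset by blast
  obtain \<psi> where \<psi>: "nxt v - v = norm (nxt v - v) *\<^sub>R dir \<psi>" by (rule polar_real2)
  have n0: "0 < norm (nxt v - v)" using nxt_neq v by simp
  have c: "0 \<le> cross2 (nxt v - v) (y - x) \<longleftrightarrow> 0 \<le> cross2 (dir \<psi>) (y - x)" for y
    by (subst \<psi>) (use n0 in \<open>simp only: cross2_simps(7) zero_le_mult_iff, auto\<close>)
  show ?thesis
  proof (rule has_angle_cone[OF pi_gt_zero order_refl \<delta>(1), where \<psi> = \<psi>])
    fix y assume "dist x y < \<delta>"
    then have "y \<in> P \<longleftrightarrow> 0 \<le> cross2 (nxt v - v) (y - x)" using \<delta>(2) v uniq by blast
    then show "y \<in> P \<longleftrightarrow> 0 \<le> cross2 (dir \<psi>) (y - x) \<and> 0 \<le> cross2 (y - x) (dir (\<psi> + pi))"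
      using c cross2_commute[of "y - x" "dir \<psi>"] by (simp only: dir_add_2pi cross2_simps(6)) simp
  qed
qed

text \<open>\<phi> is the exterior angle. Near the corner the polygon is the wedge from the outgoing
  direction \<open>\<psi> + \<phi>\<close> to the reversed incoming direction
  \<open>\<psi> + pi\<close>.\<close>

lemma angle_vertex:
  assumes v: "v \<in> V" and L: "nxt v - v = L *\<^sub>R dir \<psi>" "0 < L"
    and L': "nxt (nxt v) - nxt v = L' *\<^sub>R dir (\<psi> + \<phi>)" "0 < L'" and \<phi>: "0 < \<phi>" "\<phi> < pi"
  shows "has_angle P (nxt v) (pi - \<phi>)"
proof -
  let ?x = "nxt v"
  have x: "?x \<in> V" using v nxt_in by blast
  obtain \<delta> where \<delta>: "0 < \<delta>" "\<And>y. dist ?x y < \<delta> \<Longrightarrow> y \<in> P \<longleftrightarrow> (\<forall>v\<in>V. ?x \<in> edge v \<longrightarrow> 0 \<le> cross2 (nxt v - v) (y - ?x))"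
    using local_halfplanes x V_subset by blast
  have inc: "?x \<in> edge w \<longleftrightarrow> w = v \<or> w = ?x" if "w \<in> V" for w
  proof
    assume "?x \<in> edge w"
    then have "?x = w \<or> ?x = nxt w" by (rule vertex_in_edge[OF x that])
    then show "w = v \<or> w = ?x" using inj_onD[OF inj_nxt _ v that] by metis
  qed auto
  show ?thesis
  proof (rule has_angle_cone[OF _ _ \<delta>(1), where \<psi> = "\<psi> + \<phi>"])
    fix y assume "dist ?x y < \<delta>"
    then have "y \<in> P \<longleftrightarrow> 0 \<le> cross2 (nxt v - v) (y - ?x) \<and> 0 \<le> cross2 (nxt ?x - ?x) (y - ?x)"
      using \<delta>(2) inc v x by blast
    also have "\<dots> \<longleftrightarrow> 0 \<le> cross2 (dir \<psi>) (y - ?x) \<and> 0 \<le> cross2 (dir (\<psi> + \<phi>)) (y - ?x)"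
      unfolding L(1) L'(1) using L(2) L'(2) by (simp only: cross2_simps(7) zero_le_mult_iff) auto
    also have "\<dots> \<longleftrightarrow> 0 \<le> cross2 (dir (\<psi> + \<phi>)) (y - ?x) \<and> 0 \<le> cross2 (y - ?x) (dir (\<psi> + \<phi> + (pi - \<phi>)))"
    proof -
      have "dir (\<psi> + \<phi> + (pi - \<phi>)) = - dir \<psi>" using dir_add_2pi(2)[of \<psi>] by (simp add: algebra_simps)
      then show ?thesis using cross2_commute[of "y - ?x" "dir \<psi>"] by (simp only: cross2_simps(6)) auto
    qed
    finally show "y \<in> P \<longleftrightarrow> 0 \<le> cross2 (dir (\<psi> + \<phi>)) (y - ?x) \<and> 0 \<le> cross2 (y - ?x) (dir (\<psi> + \<phi> + (pi - \<phi>)))" .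
  qed (use \<phi> in auto)
qed

end

section \<open>L'Huilier's inequality\<close>

text \<open>A polygon is encoded by its turning: each pair holds the length of a side and the
  exterior angle at its end.\<close>

fun edge_vectors :: "real \<Rightarrow> (real \<times> real) list \<Rightarrow> (real^2) list" where
  "edge_vectors \<psi> [] = []"
| "edge_vectors \<psi> ((l, \<phi>) # xs) = (l *\<^sub>R dir \<psi>) # edge_vectors (\<psi> + \<phi>) xs"

text \<open>Twice the area enclosed by the closed polygonal line with the given edge vectors.\<close>

fun area2 :: "(real^2) list \<Rightarrow> real" where
  "area2 [] = 0"
| "area2 (e # es) = cross2 e (sum_list es) + area2 es"

definition closed_turn :: "real \<Rightarrow> (real \<times> real) list \<Rightarrow> bool" where
  "closed_turn \<psi> xs \<longleftrightarrow> (\<forall>(l, \<phi>)\<in>set xs. 0 \<le> l \<and> 0 < \<phi> \<and> \<phi> < pi) \<and>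
     sum_list (map snd xs) = 2*pi \<and> sum_list (edge_vectors \<psi> xs) = 0"

text \<open>The sum of tangents is the area of the polygon with the same side directions
  circumscribed about the unit circle. The factor is 2 and not 4 because \<open>area2\<close> is
  already doubled.\<close>

definition lhuilier_ineq :: "real \<Rightarrow> (real \<times> real) list \<Rightarrow> bool" where
  "lhuilier_ineq \<psi> xs \<longleftrightarrow>
     2 * area2 (edge_vectors \<psi> xs) * (\<Sum>\<phi>\<leftarrow>map snd xs. tan (\<phi>/2)) \<le> (sum_list (map fst xs))\<^sup>2"

lemma edge_vectors_append:
  "edge_vectors \<psi> (xs @ ys) = edge_vectors \<psi> xs @ edge_vectors (\<psi> + sum_list (map snd xs)) ys"
  by (induction xs arbitrary: \<psi>) (auto simp: algebra_simps)

lemma area2_append: "area2 (xs @ ys) = area2 xs + area2 ys + cross2 (sum_list xs) (sum_list ys)"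
  by (induction xs) (auto simp: algebra_simps)

lemma edge_vectors_rotate:
  assumes "closed_turn \<psi> (x # xs)"
  shows "edge_vectors (\<psi> + snd x) (xs @ [x]) = tl (edge_vectors \<psi> (x # xs)) @ [hd (edge_vectors \<psi> (x # xs))]"
proof -
  obtain l \<phi> where x: "x = (l, \<phi>)" by fastforce
  have t: "\<psi> + \<phi> + sum_list (map snd xs) = \<psi> + 2*pi" using assms by (simp add: closed_turn_def x)
  have "edge_vectors (\<psi> + snd x) (xs @ [x]) = edge_vectors (\<psi> + \<phi>) xs @ [l *\<^sub>R dir (\<psi> + \<phi> + sum_list (map snd xs))]"
    by (simp add: x edge_vectors_append)
  then show ?thesis unfolding t by (simp add: x)
qed

lemma closed_turn_rotate:
  assumes "closed_turn \<psi> (x # xs)" shows "closed_turn (\<psi> + snd x) (xs @ [x])"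
  using assms edge_vectors_rotate[OF assms] unfolding closed_turn_def
  by (cases x) (auto simp: add.commute)

text \<open>\<open>lhuilier_cut\<close> acts at the head of the list; rotation makes it available at
  every corner.\<close>

lemma lhuilier_rotate:
  assumes c: "closed_turn \<psi> (x # xs)" and l: "lhuilier_ineq (\<psi> + snd x) (xs @ [x])"
  shows "lhuilier_ineq \<psi> (x # xs)"
proof -
  obtain e es where e: "edge_vectors \<psi> (x # xs) = e # es" by (cases x) auto
  have "e + sum_list es = 0" using c e by (simp add: closed_turn_def)
  then have "sum_list es = - e" by (simp add: eq_neg_iff_add_eq_0 add.commute)
  then have "area2 (es @ [e]) = area2 (e # es)"
    using cross2_commute[of e "sum_list es"] by (simp add: area2_append)
  moreover have "edge_vectors (\<psi> + snd x) (xs @ [x]) = es @ [e]" using edge_vectors_rotate[OF c] e by simp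
  ultimately show ?thesis using l e by (simp add: lhuilier_ineq_def add.commute)
qed

text \<open>Cutting off a corner changes perimeter, area and tangent sum in a way that preserves the
  inequality: this is the reversed Cauchy--Schwarz step.\<close>

lemma isoperimetric_cut:
  fixes p A S \<sigma> \<tau> x :: real
  assumes "4 * A * S \<le> p\<^sup>2" "0 \<le> p" "0 < \<tau>" "0 \<le> x" "0 \<le> \<sigma>" "0 \<le> S - \<sigma>\<^sup>2 / (4*\<tau>)"
  shows "4 * (A - \<tau> * x\<^sup>2) * (S - \<sigma>\<^sup>2 / (4*\<tau>)) \<le> (p - \<sigma> * x)\<^sup>2"
proof (cases "A \<le> \<tau> * x\<^sup>2")
  case True
  then have "(A - \<tau> * x\<^sup>2) * (S - \<sigma>\<^sup>2 / (4*\<tau>)) \<le> 0" using assms(6) by (simp add: mult_nonpos_nonneg)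
  then show ?thesis using zero_le_power2[of "p - \<sigma> * x"] by linarith
next
  case False
  have tx: "0 \<le> \<tau> * x\<^sup>2" using assms by simp
  have A0: "0 \<le> A" using False tx by linarith
  have S0: "0 \<le> S" using assms(3,6) by (smt (verit) divide_nonneg_pos zero_le_power2)
  \<comment> \<open>\<open>2 * q\<close> is the smallest \<open>p\<close> that the hypothesis
    permits, so it suffices to treat that value. The bound on \<open>\<sigma> * x / 2\<close> keeps
    \<open>2 * q - \<sigma> * x\<close> nonnegative, so that squares may be compared.\<close>
  define q where "q = sqrt (A * S)"
  have q2: "q\<^sup>2 = A * S" "0 \<le> q" using A0 S0 by (auto simp: q_def)
  have pq: "2 * q \<le> p"
    by (rule power2_le_imp_le) (use assms q2 in \<open>simp_all add: power_mult_distrib\<close>)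
  have "(\<sigma> * x / 2)\<^sup>2 = (\<tau> * x\<^sup>2) * (\<sigma>\<^sup>2 / (4*\<tau>))" using assms(3) by (simp add: power2_eq_square)
  also have "\<dots> \<le> A * S" using False assms(3,6) tx A0 by (intro mult_mono) auto
  finally have "(\<sigma> * x / 2)\<^sup>2 \<le> q\<^sup>2" unfolding q2(1) .
  then have "\<sigma> * x / 2 \<le> q" by (rule power2_le_imp_le) (rule q2(2))
  then have "(2*q - \<sigma>*x)\<^sup>2 \<le> (p - \<sigma>*x)\<^sup>2" using pq by (intro power_mono) auto
  moreover have "4 * (A - \<tau> * x\<^sup>2) * (S - \<sigma>\<^sup>2 / (4*\<tau>)) \<le> (2*q - \<sigma>*x)\<^sup>2"
  proof -
    define a where "a = sqrt A" define s where "s = sqrt S" define t where "t = sqrt \<tau>"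
    have as: "A = a\<^sup>2" "S = s\<^sup>2" "\<tau> = t\<^sup>2" "q = a * s" "t \<noteq> 0"
      using A0 S0 assms(3) by (auto simp: a_def s_def t_def q_def real_sqrt_mult)
    have "(2*q - \<sigma>*x)\<^sup>2 - 4 * (A - \<tau> * x\<^sup>2) * (S - \<sigma>\<^sup>2 / (4*\<tau>)) = (\<sigma> * a / t - 2 * x * t * s)\<^sup>2"
      unfolding as using as(5) by (simp add: field_simps power2_eq_square)
    then show ?thesis using zero_le_power2[of "\<sigma> * a / t - 2 * x * t * s"] by linarith
  qed
  ultimately show ?thesis by linarith
qed

lemma sin_half_tan:
  fixes \<phi> :: real assumes "cos (\<phi>/2) \<noteq> 0"
  shows "sin \<phi> = 2 * tan (\<phi>/2) / (1 + (tan (\<phi>/2))\<^sup>2)" "cos \<phi> = (1 - (tan (\<phi>/2))\<^sup>2) / (1 + (tan (\<phi>/2))\<^sup>2)"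
proof -
  have 1: "1 + (tan (\<phi>/2))\<^sup>2 = 1 / (cos (\<phi>/2))\<^sup>2"
    using assms by (simp add: tan_sec inverse_eq_divide power_divide)
  have "sin \<phi> = 2 * sin (\<phi>/2) * cos (\<phi>/2)" using sin_double[of "\<phi>/2"] by simp
  then show "sin \<phi> = 2 * tan (\<phi>/2) / (1 + (tan (\<phi>/2))\<^sup>2)"
    unfolding 1 using assms by (simp add: tan_def power2_eq_square)
  have "cos \<phi> = (cos (\<phi>/2))\<^sup>2 - (sin (\<phi>/2))\<^sup>2" using cos_double[of "\<phi>/2"] by simp
  then show "cos \<phi> = (1 - (tan (\<phi>/2))\<^sup>2) / (1 + (tan (\<phi>/2))\<^sup>2)"
    unfolding 1 using assms by (simp add: tan_def power2_eq_square algebra_simps)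
qed

text \<open>A triangle on a base \<open>x\<close> with base angles \<alpha> and \<beta> has area
  \<open>\<tau> * x\<^sup>2\<close>, and its other two sides together exceed the base by
  \<open>\<sigma> * x\<close>. The last identity says that the change of the tangent sum is exactly
  the one \<open>isoperimetric_cut\<close> allows. Half-angle tangents make everything
  rational.\<close>

lemma cut_trig:
  assumes "0 < \<alpha>" "0 < \<beta>" "\<alpha> + \<beta> < pi"
  defines "\<tau> \<equiv> sin \<alpha> * sin \<beta> / (2 * sin (\<alpha> + \<beta>))" and "\<sigma> \<equiv> (sin \<alpha> + sin \<beta>) / sin (\<alpha> + \<beta>) - 1"
  shows "0 < \<tau>" "0 \<le> \<sigma>" "tan ((\<alpha> + \<beta>)/2) - \<sigma>\<^sup>2 / (4*\<tau>) = tan (\<alpha>/2) + tan (\<beta>/2)"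
proof -
  define u where "u = tan (\<alpha>/2)" define w where "w = tan (\<beta>/2)"
  have uw: "0 < u" "0 < w" using assms by (auto simp: u_def w_def intro!: tan_gt_zero)
  have c: "cos (\<alpha>/2) \<noteq> 0" "cos (\<beta>/2) \<noteq> 0" "cos (\<alpha>/2 + \<beta>/2) \<noteq> 0" "cos ((\<alpha>+\<beta>)/2) \<noteq> 0"
    using assms by (auto intro!: less_imp_neq[THEN not_sym] cos_gt_zero simp: add_divide_distrib)
  have ta: "tan ((\<alpha> + \<beta>)/2) = (u + w) / (1 - u * w)"
    using tan_add[OF c(1-3)] by (simp add: u_def w_def add_divide_distrib)
  have "0 < tan ((\<alpha> + \<beta>)/2)" using assms by (intro tan_gt_zero) auto
  then have uw1: "u * w < 1" unfolding ta using uw by (simp add: zero_less_divide_iff)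
  have s: "sin \<alpha> = 2 * u / (1 + u\<^sup>2)" "sin \<beta> = 2 * w / (1 + w\<^sup>2)"
    "cos \<alpha> = (1 - u\<^sup>2) / (1 + u\<^sup>2)" "cos \<beta> = (1 - w\<^sup>2) / (1 + w\<^sup>2)"
    unfolding u_def w_def by (rule sin_half_tan c)+
  have nz: "1 + u\<^sup>2 \<noteq> 0" "1 + w\<^sup>2 \<noteq> 0" "1 - u * w \<noteq> 0" "u + w \<noteq> 0"
    using uw uw1 by (auto simp: add_nonneg_eq_0_iff)
  have ss: "sin (\<alpha> + \<beta>) = 2 * (u + w) * (1 - u * w) / ((1 + u\<^sup>2) * (1 + w\<^sup>2))"
  proof -
    have "2 * u * (1 - w\<^sup>2) + (1 - u\<^sup>2) * (2 * w) = 2 * (u + w) * (1 - u * w)" by algebra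
    then show ?thesis unfolding sin_add s by (simp flip: add_divide_distrib)
  qed
  have tau: "\<tau> = u * w / ((u + w) * (1 - u * w))"
  proof -
    have "(2 * u / M) * (2 * w / N) / (2 * (2 * a * b / (M * N))) = u * w / (a * b)"
      if "M \<noteq> 0" "N \<noteq> 0" for M N a b :: real using that by simp
    then show ?thesis unfolding \<tau>_def ss s using nz(1,2) by blast
  qed
  have sg: "(sin \<alpha> + sin \<beta>) / sin (\<alpha> + \<beta>) = (1 + u * w) / (1 - u * w)"
  proof -
    have "sin \<alpha> + sin \<beta> = 2 * (u + w) * (1 + u * w) / ((1 + u\<^sup>2) * (1 + w\<^sup>2))"
      unfolding s using nz by (simp add: field_simps power2_eq_square)
    then show ?thesis unfolding ss using nz by simp
  qed
  have sig: "\<sigma> = 2 * u * w / (1 - u * w)"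
    unfolding \<sigma>_def sg using nz by (simp add: field_simps)
  show "0 < \<tau>" unfolding tau using uw uw1 by simp
  show "0 \<le> \<sigma>" unfolding sig using uw uw1 by simp
  have "\<sigma>\<^sup>2 / (4*\<tau>) = u * w * (u + w) / (1 - u * w)"
  proof -
    have aux: "(2 * x * y / b)\<^sup>2 / (4 * (x * y / (a * b))) = x * y * a / b"
      if "x \<noteq> 0" "y \<noteq> 0" "a \<noteq> 0" "b \<noteq> 0" for x y a b :: real
      using that by (simp add: field_simps power2_eq_square)
    show ?thesis unfolding sig tau by (rule aux) (use nz(3,4) uw in auto)
  qed
  then show "tan ((\<alpha> + \<beta>)/2) - \<sigma>\<^sup>2 / (4*\<tau>) = tan (\<alpha>/2) + tan (\<beta>/2)"
    unfolding ta u_def[symmetric] w_def[symmetric] using nz by (simp add: field_simps)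
qed

lemma sum_tan_nonneg:
  "(\<And>l \<phi>. (l, \<phi>) \<in> set xs \<Longrightarrow> 0 < \<phi> \<and> \<phi> < pi) \<Longrightarrow> 0 \<le> (\<Sum>\<phi>\<leftarrow>map snd xs. tan (\<phi>/2))"
  by (intro sum_list_nonneg) (auto intro!: less_imp_le[OF tan_gt_zero])

text \<open>Prolonging the first and third sides until they meet removes the second and merges the
  exterior angles at its ends, which requires their sum to stay below \<open>pi\<close>. The given
  polygon is the larger one minus a corner triangle with sides \<open>a\<close>, \<open>b\<close>
  and \<open>l1\<close>.\<close>

lemma lhuilier_cut:
  assumes c: "closed_turn \<psi> ((l0, \<phi>0) # (l1, \<phi>1) # (l2, \<phi>2) # xs)" and lt: "\<phi>0 + \<phi>1 < pi"
    and IH: "\<And>a b. closed_turn \<psi> ((a, \<phi>0 + \<phi>1) # (b, \<phi>2) # xs) \<Longrightarrow>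
      lhuilier_ineq \<psi> ((a, \<phi>0 + \<phi>1) # (b, \<phi>2) # xs)"
  shows "lhuilier_ineq \<psi> ((l0, \<phi>0) # (l1, \<phi>1) # (l2, \<phi>2) # xs)"
proof -
  have pos: "0 \<le> l0" "0 \<le> l1" "0 \<le> l2" "0 < \<phi>0" "0 < \<phi>1" using c by (auto simp: closed_turn_def)
  have s0: "0 < sin (\<phi>0 + \<phi>1)" "0 < sin \<phi>0" "0 < sin \<phi>1" using pos lt by (auto intro!: sin_gt_zero)
  define a where "a = l1 * sin \<phi>1 / sin (\<phi>0 + \<phi>1)"
  define b where "b = l1 * sin \<phi>0 / sin (\<phi>0 + \<phi>1)"
  have ab: "0 \<le> a" "0 \<le> b" using pos s0 by (auto simp: a_def b_def)
  let ?d0 = "dir \<psi>" and ?d1 = "dir (\<psi> + \<phi>0)" and ?d2 = "dir (\<psi> + \<phi>0 + \<phi>1)"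
  have split: "l1 *\<^sub>R ?d1 = a *\<^sub>R ?d0 + b *\<^sub>R ?d2"
  proof -
    have pyth: "sin t * sin t + cos t * cos t = 1" for t :: real using sin_cos_squared_add3[of t] by linarith
    have "sin (\<phi>0 + \<phi>1) * cos (\<psi> + \<phi>0) = sin \<phi>1 * cos \<psi> + sin \<phi>0 * cos (\<psi> + \<phi>0 + \<phi>1)"
      "sin (\<phi>0 + \<phi>1) * sin (\<psi> + \<phi>0) = sin \<phi>1 * sin \<psi> + sin \<phi>0 * sin (\<psi> + \<phi>0 + \<phi>1)"
      unfolding sin_add cos_add using pyth[of \<phi>0] by algebra+
    then have "sin (\<phi>0 + \<phi>1) *\<^sub>R ?d1 = sin \<phi>1 *\<^sub>R ?d0 + sin \<phi>0 *\<^sub>R ?d2" by (simp add: real2_eq_iff)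
    then have "(l1 / sin (\<phi>0 + \<phi>1)) *\<^sub>R (sin (\<phi>0 + \<phi>1) *\<^sub>R ?d1) = (l1 / sin (\<phi>0 + \<phi>1)) *\<^sub>R (sin \<phi>1 *\<^sub>R ?d0 + sin \<phi>0 *\<^sub>R ?d2)" by simp
    then show ?thesis using s0 by (simp add: a_def b_def scaleR_add_right)
  qed
  let ?xs = "(l0, \<phi>0) # (l1, \<phi>1) # (l2, \<phi>2) # xs" and ?ys = "(l0 + a, \<phi>0 + \<phi>1) # (l2 + b, \<phi>2) # xs"
  let ?zs = "edge_vectors (\<psi> + \<phi>0 + \<phi>1 + \<phi>2) xs"
  have ex: "edge_vectors \<psi> ?xs = (l0 *\<^sub>R ?d0) # (l1 *\<^sub>R ?d1) # (l2 *\<^sub>R ?d2) # ?zs"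
    and ey: "edge_vectors \<psi> ?ys = ((l0 + a) *\<^sub>R ?d0) # ((l2 + b) *\<^sub>R ?d2) # ?zs"
    by (simp_all add: add.assoc)
  have "closed_turn \<psi> ?ys"
  proof -
    have "sum_list (edge_vectors \<psi> ?ys) = sum_list (edge_vectors \<psi> ?xs)"
      unfolding ex ey sum_list.Cons split scaleR_add_left by (simp add: ac_simps)
    then show ?thesis using c pos ab lt unfolding closed_turn_def by auto
  qed
  then have "lhuilier_ineq \<psi> ?ys" by (rule IH)
  moreover have area: "area2 (edge_vectors \<psi> ?ys) = area2 (edge_vectors \<psi> ?xs) + a * b * sin (\<phi>0 + \<phi>1)"
  proof -
    have "cross2 ?d0 ?d2 = sin (\<phi>0 + \<phi>1)" by (simp add: cross2_dir add.assoc)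
    then show ?thesis unfolding ex ey area2.simps split by (simp add: algebra_simps)
  qed
  define \<tau> where "\<tau> = sin \<phi>0 * sin \<phi>1 / (2 * sin (\<phi>0 + \<phi>1))"
  define \<sigma> where "\<sigma> = (sin \<phi>0 + sin \<phi>1) / sin (\<phi>0 + \<phi>1) - 1"
  note ct = cut_trig[OF pos(4,5) lt, folded \<tau>_def \<sigma>_def]
  have ab\<tau>: "a * b * sin (\<phi>0 + \<phi>1) = 2 * (\<tau> * l1\<^sup>2)"
    using s0 by (simp add: a_def b_def \<tau>_def power2_eq_square)
  have ab\<sigma>: "a + b - l1 = \<sigma> * l1"
    using s0 by (simp add: a_def b_def \<sigma>_def field_simps)
  define A p S T where "A = area2 (edge_vectors \<psi> ?ys) / 2" and "p = sum_list (map fst ?ys)"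
    and "S = (\<Sum>\<phi>\<leftarrow>map snd ?ys. tan (\<phi>/2))" and "T = (\<Sum>\<phi>\<leftarrow>map snd ?xs. tan (\<phi>/2))"
  have T0: "0 \<le> T" unfolding T_def using c by (intro sum_tan_nonneg) (auto simp: closed_turn_def)
  have ST: "S - \<sigma>\<^sup>2 / (4*\<tau>) = T" unfolding S_def T_def using ct(3) by simp
  have p0: "0 \<le> p" unfolding p_def using \<open>closed_turn \<psi> ?ys\<close> by (intro sum_list_nonneg) (auto simp: closed_turn_def)
  have "4 * (A - \<tau> * l1\<^sup>2) * (S - \<sigma>\<^sup>2 / (4*\<tau>)) \<le> (p - \<sigma> * l1)\<^sup>2"
  proof (rule isoperimetric_cut)
    show "4 * A * S \<le> p\<^sup>2" using \<open>lhuilier_ineq \<psi> ?ys\<close>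
      unfolding lhuilier_ineq_def S_def[symmetric] p_def[symmetric] by (simp add: A_def del: edge_vectors.simps area2.simps)
  qed (use ct pos p0 ST T0 in auto)
  moreover have "A - \<tau> * l1\<^sup>2 = area2 (edge_vectors \<psi> ?xs) / 2"
    unfolding A_def area ab\<tau> by (simp add: add_divide_distrib del: edge_vectors.simps area2.simps)
  moreover have "p - \<sigma> * l1 = sum_list (map fst ?xs)"
    unfolding p_def using ab\<sigma> by simp
  ultimately have "4 * (area2 (edge_vectors \<psi> ?xs) / 2) * T \<le> (sum_list (map fst ?xs))\<^sup>2"
    by (simp only: ST)
  then show ?thesis unfolding lhuilier_ineq_def T_def by (simp del: edge_vectors.simps area2.simps)
qed

text \<open>Equality holds, since every triangle has an incircle. The sides come from the law of
  sines; the half exterior angles add up to \<open>pi\<close>, so the sum of their tangents equals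
  the product.\<close>

lemma lhuilier3:
  assumes c: "closed_turn \<psi> [(l0, \<phi>0), (l1, \<phi>1), (l2, \<phi>2)]"
  shows "lhuilier_ineq \<psi> [(l0, \<phi>0), (l1, \<phi>1), (l2, \<phi>2)]"
proof -
  have \<phi>: "0 < \<phi>0" "\<phi>0 < pi" "0 < \<phi>1" "\<phi>1 < pi" "0 < \<phi>2" "\<phi>2 < pi" "\<phi>2 = 2*pi - (\<phi>0 + \<phi>1)"
    using c by (auto simp: closed_turn_def)
  have z: "l0 *\<^sub>R dir \<psi> + (l1 *\<^sub>R dir (\<psi> + \<phi>0) + l2 *\<^sub>R dir (\<psi> + \<phi>0 + \<phi>1)) = 0" (is "?z = 0")
    using c by (simp add: closed_turn_def)
  have s2: "sin \<phi>2 = - sin (\<phi>0 + \<phi>1)" "cos \<phi>2 = cos (\<phi>0 + \<phi>1)"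
    unfolding \<phi>(7) by (simp_all add: sin_diff cos_diff)
  have "cross2 (dir \<psi>) ?z = 0" "cross2 (dir (\<psi> + \<phi>0)) ?z = 0" unfolding z by simp_all
  then have r: "l1 * sin \<phi>0 = l2 * sin \<phi>2" "l0 * sin \<phi>0 = l2 * sin \<phi>1"
    by (simp_all add: cross2_dir s2 add.assoc)
  have s0: "0 < sin \<phi>0" "0 < sin \<phi>1" "0 < sin \<phi>2" using \<phi>(1-6) by (auto intro!: sin_gt_zero)
  define k where "k = l2 / sin \<phi>0"
  have l: "l0 = k * sin \<phi>1" "l1 = k * sin \<phi>2" "l2 = k * sin \<phi>0" using r s0 by (simp_all add: k_def field_simps)
  have ar: "area2 (edge_vectors \<psi> [(l0, \<phi>0), (l1, \<phi>1), (l2, \<phi>2)]) = k\<^sup>2 * sin \<phi>0 * sin \<phi>1 * sin \<phi>2"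
  proof -
    have "area2 (edge_vectors \<psi> [(l0, \<phi>0), (l1, \<phi>1), (l2, \<phi>2)]) =
      l0 * l1 * sin \<phi>0 + l0 * l2 * sin (\<phi>0 + \<phi>1) + l1 * l2 * sin \<phi>1"
      by (simp add: cross2_dir add.assoc algebra_simps)
    also have "\<dots> = k\<^sup>2 * sin \<phi>0 * sin \<phi>1 * sin \<phi>2"
      using s2(1) unfolding l by (simp add: power2_eq_square algebra_simps)
    finally show ?thesis .
  qed
  define u w t where "u = tan (\<phi>0/2)" and "w = tan (\<phi>1/2)" and "t = tan (\<phi>2/2)"
  have uw: "0 < u" "0 < w" "0 < t" using \<phi>(1-6) by (auto simp: u_def w_def t_def intro!: tan_gt_zero)
  have cz: "cos (\<phi>0/2) \<noteq> 0" "cos (\<phi>1/2) \<noteq> 0" "cos (\<phi>2/2) \<noteq> 0"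
    using \<phi>(1-6) by (auto intro!: less_imp_neq[THEN not_sym] cos_gt_zero)
  have s: "sin \<phi>0 = 2 * u / (1 + u\<^sup>2)" "sin \<phi>1 = 2 * w / (1 + w\<^sup>2)" "sin \<phi>2 = 2 * t / (1 + t\<^sup>2)"
    unfolding u_def w_def t_def by (rule sin_half_tan cz)+
  have sumt: "u + w + t = u * w * t"
  proof -
    have h: "\<phi>2/2 = pi - (\<phi>0/2 + \<phi>1/2)" using \<phi>(7) by simp
    have tt: "t = - tan (\<phi>0/2 + \<phi>1/2)" unfolding t_def h by (simp add: tan_def)
    have c3: "cos (\<phi>0/2 + \<phi>1/2) \<noteq> 0" using cz(3) unfolding h by (simp add: cos_diff)
    have "tan (\<phi>0/2 + \<phi>1/2) = (u + w) / (1 - u * w)"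
      unfolding u_def w_def by (rule tan_add[OF cz(1,2) c3])
    moreover have "1 - u * w \<noteq> 0"
    proof
      assume "1 - u * w = 0"
      then have "t = 0" using tt calculation by simp
      then show False using uw by simp
    qed
    ultimately show ?thesis using tt by (simp add: field_simps)
  qed
  have nz: "1 + u\<^sup>2 \<noteq> 0" "1 + w\<^sup>2 \<noteq> 0" "1 + t\<^sup>2 \<noteq> 0" by (simp_all add: add_nonneg_eq_0_iff)
  have key: "(sin \<phi>0 + sin \<phi>1 + sin \<phi>2)\<^sup>2 = 2 * sin \<phi>0 * sin \<phi>1 * sin \<phi>2 * (u + w + t)"
  proof -
    define a b c where "a = sin \<phi>0" and "b = sin \<phi>1" and "c = sin \<phi>2"
    define q where "q = u * w + w * t + u * t"
    define D where "D = (1 + u\<^sup>2) * (1 + w\<^sup>2) * (1 + t\<^sup>2)"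
    have abc: "(1 + u\<^sup>2) * a = 2 * u" "(1 + w\<^sup>2) * b = 2 * w" "(1 + t\<^sup>2) * c = 2 * t"
      unfolding a_def b_def c_def s using nz by simp_all
    have D0: "D \<noteq> 0" unfolding D_def using nz by simp
    \<comment> \<open>\<open>D\<close> is the squared modulus of
      \<open>(1 + i u)(1 + i w)(1 + i t)\<close>. The imaginary part
      \<open>u + w + t - u w t\<close> vanishes and the real part is \<open>1 - q\<close>.\<close>
    have Dq: "D = (q - 1)\<^sup>2" unfolding D_def q_def using sumt by algebra
    have "D * (a + b + c) = 2 * (u * (1 + w\<^sup>2) * (1 + t\<^sup>2) + w * (1 + u\<^sup>2) * (1 + t\<^sup>2) + t * (1 + u\<^sup>2) * (1 + w\<^sup>2))"
      unfolding D_def using abc by algebra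
    also have "\<dots> = 4 * (u * w * t) * (q - 1)" unfolding q_def using sumt by algebra
    finally have "D * (D * (a + b + c)\<^sup>2) = D * (16 * (u * w * t)\<^sup>2)" using Dq by algebra
    then have 1: "D * (a + b + c)\<^sup>2 = 16 * (u * w * t)\<^sup>2" using D0 by simp
    have "D * (2 * a * b * c * (u + w + t)) = 16 * (u * w * t) * (u + w + t)"
      unfolding D_def using abc by algebra
    then have "D * (2 * a * b * c * (u + w + t)) = D * (a + b + c)\<^sup>2"
      unfolding 1 sumt by (simp add: power2_eq_square)
    then show ?thesis using D0 unfolding a_def b_def c_def by simp
  qed
  have "2 * (k\<^sup>2 * sin \<phi>0 * sin \<phi>1 * sin \<phi>2) * (u + w + t) = (k * (sin \<phi>0 + sin \<phi>1 + sin \<phi>2))\<^sup>2"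
    unfolding power_mult_distrib key by simp
  then show ?thesis unfolding lhuilier_ineq_def ar by (simp add: u_def w_def t_def l algebra_simps)
qed

text \<open>The two sums over complementary pairs of adjacent exterior angles add up to
  \<open>2 * pi\<close>. So either some adjacent pair stays below \<open>pi\<close> and can be cut,
  or all adjacent pairs equal \<open>pi\<close>: a parallelogram, where the claim is the inequality
  between arithmetic and geometric mean.\<close>

lemma lhuilier4:
  assumes c: "closed_turn \<psi> xs" "length xs = 4"
  shows "lhuilier_ineq \<psi> xs"
proof -
  have cut: "lhuilier_ineq \<psi> [(l0, \<phi>0), (l1, \<phi>1), (l2, \<phi>2), (l3, \<phi>3)]"
    if "closed_turn \<psi> [(l0, \<phi>0), (l1, \<phi>1), (l2, \<phi>2), (l3, \<phi>3)]" "\<phi>0 + \<phi>1 < pi" for \<psi> l0 l1 l2 l3 \<phi>0 \<phi>1 \<phi>2 \<phi>3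
    using that by (intro lhuilier_cut lhuilier3)
  obtain l0 \<phi>0 l1 \<phi>1 l2 \<phi>2 l3 \<phi>3 where xs: "xs = [(l0, \<phi>0), (l1, \<phi>1), (l2, \<phi>2), (l3, \<phi>3)]"
    using c(2) by (auto simp: eval_nat_numeral length_Suc_conv)
  note c0 = c(1)[unfolded xs]
  note c1 = closed_turn_rotate[OF c0, simplified]
  note c2 = closed_turn_rotate[OF c1, simplified]
  note c3 = closed_turn_rotate[OF c2, simplified]
  have sum: "\<phi>0 + \<phi>1 + \<phi>2 + \<phi>3 = 2*pi" and \<phi>: "0 < \<phi>0" "\<phi>0 < pi" using c0 by (auto simp: closed_turn_def)
  consider "\<phi>0 + \<phi>1 < pi" | "\<phi>1 + \<phi>2 < pi" | "\<phi>2 + \<phi>3 < pi" | "\<phi>3 + \<phi>0 < pi" | "\<phi>0 + \<phi>1 = pi" "\<phi>1 + \<phi>2 = pi"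
    using sum by linarith
  then show ?thesis
  proof cases
    case 1 then show ?thesis unfolding xs by (intro cut c0)
  next
    case 2 then show ?thesis unfolding xs by (intro lhuilier_rotate[OF c0]) (use cut[OF c1] in simp)
  next
    case 3
    then have "lhuilier_ineq (\<psi> + \<phi>0) [(l1, \<phi>1), (l2, \<phi>2), (l3, \<phi>3), (l0, \<phi>0)]"
      by (intro lhuilier_rotate[OF c1]) (use cut[OF c2] in simp)
    then show ?thesis unfolding xs by (intro lhuilier_rotate[OF c0]) simp
  next
    case 4
    then have "lhuilier_ineq (\<psi> + \<phi>0 + \<phi>1) [(l2, \<phi>2), (l3, \<phi>3), (l0, \<phi>0), (l1, \<phi>1)]"
      by (intro lhuilier_rotate[OF c2]) (use cut[OF c3] in simp)
    then have "lhuilier_ineq (\<psi> + \<phi>0) [(l1, \<phi>1), (l2, \<phi>2), (l3, \<phi>3), (l0, \<phi>0)]"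
      by (intro lhuilier_rotate[OF c1]) simp
    then show ?thesis unfolding xs by (intro lhuilier_rotate[OF c0]) simp
  next
    case 5
    then have p: "\<phi>1 = pi - \<phi>0" "\<phi>2 = \<phi>0" "\<phi>3 = pi - \<phi>0" using sum by linarith+
    have d: "dir (\<psi> + pi + \<phi>0) = - dir (\<psi> + \<phi>0)"
      using dir_add_2pi(2)[of "\<psi> + \<phi>0"] by (simp add: ac_simps del: dir_add_2pi)
    have s0: "0 < sin \<phi>0" using \<phi> by (intro sin_gt_zero)
    have z: "l0 *\<^sub>R dir \<psi> + (l1 *\<^sub>R dir (\<psi> + \<phi>0) + (l2 *\<^sub>R - dir \<psi> + l3 *\<^sub>R - dir (\<psi> + \<phi>0))) = 0" (is "?z = 0")
      using c0 unfolding p closed_turn_def by (simp add: d)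
    have "cross2 (dir \<psi>) ?z = 0" "cross2 (dir (\<psi> + \<phi>0)) ?z = 0" unfolding z by simp_all
    then have "(l1 - l3) * sin \<phi>0 = 0" "(l0 - l2) * sin \<phi>0 = 0" by (auto simp: cross2_dir algebra_simps)
    then have l: "l3 = l1" "l2 = l0" using s0 by simp_all
    have ar: "area2 (edge_vectors \<psi> xs) = 2 * l0 * l1 * sin \<phi>0"
      unfolding xs p l by (simp add: d cross2_dir algebra_simps)
    define u where "u = tan (\<phi>0/2)"
    have u0: "0 < u" unfolding u_def using \<phi> by (intro tan_gt_zero) auto
    have cz: "cos (\<phi>0/2) \<noteq> 0" using \<phi> by (auto intro!: less_imp_neq[THEN not_sym] cos_gt_zero)
    have tc: "tan ((pi - \<phi>0)/2) = 1 / u"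
      using tan_cot[of "\<phi>0/2"] by (simp add: u_def diff_divide_distrib inverse_eq_divide)
    have "sin \<phi>0 = 2 * u / (1 + u\<^sup>2)" unfolding u_def by (rule sin_half_tan[OF cz])
    then have s1: "sin \<phi>0 * (u + 1 / u) = 2"
      using u0 by (simp add: field_simps power2_eq_square add_nonneg_eq_0_iff)
    have s2: "(\<Sum>\<phi>\<leftarrow>map snd xs. tan (\<phi>/2)) = 2 * (u + 1 / u)"
      unfolding xs p by (simp add: tc u_def[symmetric])
    have s3: "2 * (2 * l0 * l1 * sin \<phi>0) * (2 * r) = 8 * (l0 * l1) * (sin \<phi>0 * r)" for r by simp
    have e1: "2 * area2 (edge_vectors \<psi> xs) * (\<Sum>\<phi>\<leftarrow>map snd xs. tan (\<phi>/2)) = 16 * (l0 * l1)"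
      unfolding ar s2 s3 s1 by simp
    have e2: "(sum_list (map fst xs))\<^sup>2 = 16 * (l0 * l1) + (2 * l0 - 2 * l1)\<^sup>2"
      unfolding xs l by (simp add: power2_eq_square algebra_simps)
    show ?thesis unfolding lhuilier_ineq_def e1 e2 by simp
  qed
qed

text \<open>The five sums of adjacent exterior angles total \<open>4 * pi\<close>, so one of them is
  below \<open>pi\<close> and a cut leads to a quadrilateral.\<close>

lemma lhuilier5:
  assumes c: "closed_turn \<psi> xs" "length xs = 5"
  shows "lhuilier_ineq \<psi> xs"
proof -
  have cut: "lhuilier_ineq \<psi> [(l0, \<phi>0), (l1, \<phi>1), (l2, \<phi>2), (l3, \<phi>3), (l4, \<phi>4)]"
    if "closed_turn \<psi> [(l0, \<phi>0), (l1, \<phi>1), (l2, \<phi>2), (l3, \<phi>3), (l4, \<phi>4)]" "\<phi>0 + \<phi>1 < pi"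
    for \<psi> l0 l1 l2 l3 l4 \<phi>0 \<phi>1 \<phi>2 \<phi>3 \<phi>4
    using that by (intro lhuilier_cut lhuilier4) auto
  obtain l0 \<phi>0 l1 \<phi>1 l2 \<phi>2 l3 \<phi>3 l4 \<phi>4 where xs: "xs = [(l0, \<phi>0), (l1, \<phi>1), (l2, \<phi>2), (l3, \<phi>3), (l4, \<phi>4)]"
    using c(2) by (auto simp: eval_nat_numeral length_Suc_conv)
  note c0 = c(1)[unfolded xs]
  note c1 = closed_turn_rotate[OF c0, simplified]
  note c2 = closed_turn_rotate[OF c1, simplified]
  note c3 = closed_turn_rotate[OF c2, simplified]
  note c4 = closed_turn_rotate[OF c3, simplified]
  note r0 = lhuilier_rotate[OF c0, simplified] and r1 = lhuilier_rotate[OF c1, simplified]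
    and r2 = lhuilier_rotate[OF c2, simplified] and r3 = lhuilier_rotate[OF c3, simplified]
  have sum: "\<phi>0 + \<phi>1 + \<phi>2 + \<phi>3 + \<phi>4 = 2*pi" using c0 by (auto simp: closed_turn_def)
  consider "\<phi>0 + \<phi>1 < pi" | "\<phi>1 + \<phi>2 < pi" | "\<phi>2 + \<phi>3 < pi" | "\<phi>3 + \<phi>4 < pi" | "\<phi>4 + \<phi>0 < pi"
    using sum pi_gt_zero by linarith
  then show ?thesis
  proof cases
    case 1 show ?thesis unfolding xs by (rule cut[OF c0 1])
  next
    case 2 show ?thesis unfolding xs by (rule r0[OF cut[OF c1 2]])
  next
    case 3 show ?thesis unfolding xs by (rule r0[OF r1[OF cut[OF c2 3]]])
  next
    case 4 show ?thesis unfolding xs by (rule r0[OF r1[OF r2[OF cut[OF c3 4]]]])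
  next
    case 5 show ?thesis unfolding xs by (rule r0[OF r1[OF r2[OF r3[OF cut[OF c4 5]]]]])
  qed
qed

section \<open>Perimeter, area and angles of a convex polygon\<close>

definition perimeter :: "(real^2) set \<Rightarrow> real" where
  "perimeter P = (\<Sum>v\<in>vertices P. dist v (next_vertex P v))"

text \<open>Serves to compare the angles of an inscribed triangle with those of a pentagon.\<close>

lemma has_angle_mono:
  assumes "has_angle Q x a" "has_angle P x b" "Q \<subseteq> P" "compact P" "compact Q"
  shows "a \<le> b"
proof -
  have "\<forall>\<^sub>F \<epsilon> in at_right 0. a / 2 * \<epsilon>\<^sup>2 \<le> b / 2 * \<epsilon>\<^sup>2 \<and> \<epsilon> > (0::real)"
    using assms(1,2) eventually_at_right_less[of "0::real"] unfolding has_angle_def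
  proof eventually_elim
    case (elim \<epsilon>)
    have "measure lebesgue (Q \<inter> cball x \<epsilon>) \<le> measure lebesgue (P \<inter> cball x \<epsilon>)"
      using assms by (intro measure_mono_fmeasurable) (auto simp: lmeasurable_compact compact_Int fmeasurableD)
    then show ?case using elim by simp
  qed
  then have "\<exists>\<epsilon>. a / 2 * \<epsilon>\<^sup>2 \<le> b / 2 * \<epsilon>\<^sup>2 \<and> \<epsilon> > (0::real)"
    by (rule eventually_happens'[OF trivial_limit_at_right_real])
  then show ?thesis by auto
qed

lemma measure_triangle:
  "measure lebesgue (convex hull {c, a, b}) = \<bar>cross2 (a - c) (b - c)\<bar> / 2"
proof -
  have "measure lebesgue (convex hull {c, a, b}) = measure lborel (convex hull {c, a, b})"
    by (intro measure_completion) (simp add: borel_closed compact_imp_closed finite_imp_compact_convex_hull)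
  also have "\<dots> = \<bar>cross2 (a - c) (b - c)\<bar> / 2"
    unfolding content_triangle by (simp add: cross2_def abs_minus_commute algebra_simps)
  finally show ?thesis .
qed

context polygon begin

lemma card_ge3: "3 \<le> card V"
proof -
  obtain v where v: "v \<in> V"
  proof (cases "V = {}")
    case True
    then have "P = {}" using hull_V by simp
    then show ?thesis using interior_nonempty by simp
  qed blast
  have "{v, nxt v, nxt (nxt v)} \<subseteq> V" using v nxt_in by blast
  moreover have "card {v, nxt v, nxt (nxt v)} = 3"
    using nxt_neq[OF v] nxt_neq[OF nxt_in[OF v]] nxt_nxt_neq[OF v] by auto
  ultimately show ?thesis using card_mono[OF finite_V] by metis
qed

lemma sum_nxt: "(\<Sum>v\<in>V. f (nxt v)) = (\<Sum>v\<in>V. f v)"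
  using sum.reindex[OF inj_nxt, of f] nxt_image by simp

lemma ray_unique:
  assumes c: "c \<in> interior P" and x: "x \<noteq> c" and y: "y \<in> frontier P" "x = (1 - s) *\<^sub>R c + s *\<^sub>R y" "0 \<le> s"
    and y': "y' \<in> frontier P" "x = (1 - s') *\<^sub>R c + s' *\<^sub>R y'" "0 \<le> s'"
  shows "y = y'"
proof -
  have aux: "\<not> s < s'" if y: "y \<in> frontier P" "x = (1 - s) *\<^sub>R c + s *\<^sub>R y" "0 \<le> s"
    and y': "y' \<in> frontier P" "x = (1 - s') *\<^sub>R c + s' *\<^sub>R y'" "0 \<le> s'" for y y' s s'
  proof
    assume ss: "s < s'"
    have s0: "0 < s" using y x by (cases "s = 0") auto
    have "y' \<in> open_segment c y"
    proof -
      have "s *\<^sub>R (y - c) = s' *\<^sub>R (y' - c)" using y(2) y'(2) by (simp add: algebra_simps)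
      then have "(1 / s') *\<^sub>R (s *\<^sub>R (y - c)) = (1 / s') *\<^sub>R (s' *\<^sub>R (y' - c))" by simp
      then have e: "y' = (1 - s / s') *\<^sub>R c + (s / s') *\<^sub>R y" using ss s0 by (simp add: algebra_simps)
      have "y \<noteq> c" using x y(2) by (auto simp: algebra_simps simp flip: scaleR_add_left)
      then show ?thesis using e ss s0 by (auto simp: in_segment intro!: exI[of _ "s / s'"])
    qed
    moreover have "y \<in> closure P" using y(1) by (simp add: frontier_def)
    ultimately have "y' \<in> interior P" using in_interior_closure_convex_segment[OF convex c] by blast
    then show False using y'(1) by (simp add: frontier_def)
  qed
  then have "s = s'" using assms by (metis linorder_neqE_linordered_idom)
  moreover have "s \<noteq> 0" using y x by auto
  ultimately show ?thesis using y(2) y'(2) by simp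
qed

text \<open>The triangles from \<open>c\<close> over the edges fill \<open>P\<close>. Since each ray
  from \<open>c\<close> meets the frontier once, a point common to two triangles lies on a ray
  through a common point of two edges, hence through a vertex; these rays have measure zero.\<close>

lemma measure_fan:
  assumes c: "c \<in> interior P"
  shows "measure lebesgue P = (\<Sum>v\<in>V. cross2 (v - c) (nxt v - c) / 2)"
proof -
  let ?T = "\<lambda>v. convex hull {c, v, nxt v}"
  have cP: "c \<in> P" using c interior_subset by blast
  have Tseg: "\<exists>y\<in>edge v. \<exists>s. 0 \<le> s \<and> s \<le> 1 \<and> x = (1 - s) *\<^sub>R c + s *\<^sub>R y" if x: "x \<in> ?T v" for x v
  proof -
    have "?T v = {(1 - s) *\<^sub>R c + s *\<^sub>R y | s y. 0 \<le> s \<and> s \<le> 1 \<and> y \<in> convex hull {v, nxt v}}"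
      by (subst convex_hull_insert_alt) (auto simp: insert_commute)
    then show ?thesis using x by (auto simp: segment_convex_hull)
  qed
  have Tsub: "?T v \<subseteq> P" if "v \<in> V" for v
    using cP V_subset nxt_in[OF that] that by (intro hull_minimal convex) auto
  have "P \<subseteq> (\<Union>v\<in>V. ?T v)"
  proof
    fix x assume x: "x \<in> P"
    show "x \<in> (\<Union>v\<in>V. ?T v)"
    proof (cases "x = c")
      case True
      have "V \<noteq> {}" using card_ge3 by auto
      then show ?thesis using True hull_inc[of c "{c, _, _}" convex] by auto
    next
      case False
      then obtain d where d: "0 < d" "c + d *\<^sub>R (x - c) \<in> frontier P"
        "\<And>e. 0 \<le> e \<Longrightarrow> e < d \<Longrightarrow> c + e *\<^sub>R (x - c) \<in> interior P"
        using ray_to_frontier[OF bounded c, of "x - c"] by auto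
      let ?y = "c + d *\<^sub>R (x - c)"
      have d1: "1 \<le> d"
      proof (rule ccontr)
        assume "\<not> 1 \<le> d"
        then have "?y \<in> open_segment c x"
          using d(1) False by (auto simp: in_segment algebra_simps intro!: exI[of _ d])
        then have "?y \<in> interior P"
          using in_interior_closure_convex_segment[OF convex c, of x] x closure_subset by blast
        then show False using d(2) by (simp add: frontier_def)
      qed
      obtain v where v: "v \<in> V" "?y \<in> edge v" using d(2) frontier_eq by blast
      have "?y \<in> ?T v" using v(2) hull_mono[of "{v, nxt v}" "{c, v, nxt v}" convex] by (auto simp: segment_convex_hull)
      moreover have "c \<in> ?T v" by (simp add: hull_inc)
      moreover have "x = (1 - 1/d) *\<^sub>R c + (1/d) *\<^sub>R ?y" using d(1) by (simp add: algebra_simps)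
      moreover have "0 \<le> 1 - 1/d" "0 \<le> 1/d" "(1 - 1/d) + 1/d = 1" using d1 by auto
      ultimately have "x \<in> ?T v" using convexD[OF convex_convex_hull, of c "{c, v, nxt v}" ?y "1 - 1/d" "1/d"] by metis
      then show ?thesis using v by blast
    qed
  qed
  then have U: "P = (\<Union>v\<in>V. ?T v)" using Tsub by blast
  have neg: "negligible (?T v \<inter> ?T w)" if vw: "v \<in> V" "w \<in> V" "v \<noteq> w" for v w
  proof (rule negligible_subset)
    show "negligible (\<Union>u\<in>V. {x. cross2 (u - c) (x - c) = 0})"
    proof (rule negligible_Union)
      fix t assume "t \<in> (\<lambda>u. {x. cross2 (u - c) (x - c) = 0}) ` V"
      then obtain u where "u \<in> V" and t: "t = {x. cross2 (u - c) (x - c) = 0}" by blast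
      then have "u - c \<noteq> 0" using edge_frontier[of u] c by (auto simp: frontier_def)
      then have "negligible ((+) c ` {x. cross2 (u - c) x = 0})" by (intro negligible_translation negligible_line_through_0)
      moreover have "(+) c ` {x. cross2 (u - c) x = 0} = {x. cross2 (u - c) (x - c) = 0}"
        by (auto simp del: cross2_simps intro!: image_eqI[of _ "(+) c" "_ - c"])
      ultimately show "negligible t" by (simp add: t)
    qed (use finite_V in simp)
    show "?T v \<inter> ?T w \<subseteq> (\<Union>u\<in>V. {x. cross2 (u - c) (x - c) = 0})"
    proof
      fix x assume x: "x \<in> ?T v \<inter> ?T w"
      show "x \<in> (\<Union>u\<in>V. {x. cross2 (u - c) (x - c) = 0})"
      proof (cases "x = c")
        case True
        then show ?thesis using vw by auto
      next
        case False
        obtain y s where y: "y \<in> edge v" "0 \<le> s" "x = (1 - s) *\<^sub>R c + s *\<^sub>R y" using Tseg x by blast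
        obtain y' s' where y': "y' \<in> edge w" "0 \<le> s'" "x = (1 - s') *\<^sub>R c + s' *\<^sub>R y'" using Tseg x by blast
        have "y = y'"
          using ray_unique[OF c False _ y(3,2) _ y'(3,2)] y(1) y'(1) vw edge_frontier by blast
        then have "y \<in> V" using edge_Int_edge vw y(1) y'(1) by blast
        moreover have "x - c = s *\<^sub>R (y - c)" using y(3) by (simp add: algebra_simps)
        then have "cross2 (y - c) (x - c) = 0" by (simp only: cross2_simps(8,9) mult_zero_right)
        ultimately show ?thesis by blast
      qed
    qed
  qed
  have "measure lebesgue P = measure lebesgue (\<Union>(?T ` V))" using U by simp
  also have "\<dots> = (\<Sum>v\<in>V. measure lebesgue (?T v))"
    using neg by (intro measure_negligible_finite_Union_image finite_V)
      (auto simp: pairwise_def lmeasurable_compact finite_imp_compact_convex_hull)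
  also have "\<dots> = (\<Sum>v\<in>V. cross2 (v - c) (nxt v - c) / 2)"
  proof (rule sum.cong[OF refl])
    fix v assume "v \<in> V"
    have "cross2 (v - c) (nxt v - c) = cross2 (nxt v - v) (c - v)" by (simp add: cross2_def algebra_simps)
    then have "0 < cross2 (v - c) (nxt v - c)" using interior_left[OF \<open>v \<in> V\<close> c] by simp
    then show "measure lebesgue (?T v) = cross2 (v - c) (nxt v - c) / 2" by (simp add: measure_triangle del: cross2_simps)
  qed
  finally show ?thesis .
qed

text \<open>The shoelace formula. The terms containing \<open>c\<close> cancel because
  \<open>nxt\<close> permutes the vertices.\<close>

lemma measure_eq: "measure lebesgue P = (\<Sum>v\<in>V. cross2 v (nxt v)) / 2"
proof -
  obtain c where c: "c \<in> interior P" using interior_nonempty by blast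
  have "(\<Sum>v\<in>V. cross2 (v - c) (nxt v - c) / 2) = (\<Sum>v\<in>V. cross2 v (nxt v) / 2 - cross2 v c / 2 + cross2 (nxt v) c / 2)"
    by (rule sum.cong) (auto simp: cross2_def field_simps)
  also have "\<dots> = (\<Sum>v\<in>V. cross2 v (nxt v) / 2) - (\<Sum>v\<in>V. cross2 v c / 2) + (\<Sum>v\<in>V. cross2 (nxt v) c / 2)"
    by (simp only: sum.distrib sum_subtractf)
  also have "\<dots> = (\<Sum>v\<in>V. cross2 v (nxt v) / 2)" using sum_nxt[of "\<lambda>v. cross2 v c / 2"] by simp
  finally show ?thesis using measure_fan[OF c] by (simp add: sum_divide_distrib)
qed

lemma hausdorff_frontier: "hausdorff_length (frontier P) = ennreal (perimeter P)"
proof (rule antisym)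
  have sub: "hausdorff_length (\<Union>v\<in>A. edge v) \<le> (\<Sum>v\<in>A. hausdorff_length (edge v))" if "finite A" for A
    using that
  proof (induction A rule: finite_induct)
    case (insert v A)
    then show ?case using hausdorff_length_Un_le[of "edge v" "\<Union>v\<in>A. edge v"]
      by (simp add: order.trans[OF _ add_left_mono])
  qed simp
  have "hausdorff_length (frontier P) \<le> (\<Sum>v\<in>V. ennreal (dist v (nxt v)))"
    unfolding frontier_eq by (rule order.trans[OF sub[OF finite_V] sum_mono]) (rule hausdorff_length_closed_segment_le)
  then show "hausdorff_length (frontier P) \<le> ennreal (perimeter P)"
    by (simp add: perimeter_def sum_ennreal)
  have "(\<Sum>v\<in>V. hausdorff_length (edge v)) \<le> of_nat 1 * hausdorff_length (frontier P)"
  proof (rule sum_hausdorff_length_le[OF finite_V _ finite_V])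
    fix x assume x: "x \<notin> V"
    have "card {v \<in> V. x \<in> edge v} \<le> card {SOME v. v \<in> V \<and> x \<in> edge v}"
    proof (rule card_mono)
      show "{v \<in> V. x \<in> edge v} \<subseteq> {SOME v. v \<in> V \<and> x \<in> edge v}"
      proof
        fix w assume w: "w \<in> {v \<in> V. x \<in> edge v}"
        then have "(SOME v. v \<in> V \<and> x \<in> edge v) \<in> V \<and> x \<in> edge (SOME v. v \<in> V \<and> x \<in> edge v)"
          by (intro someI[of "\<lambda>v. v \<in> V \<and> x \<in> edge v" w]) simp
        then show "w \<in> {SOME v. v \<in> V \<and> x \<in> edge v}" using edge_Int_edge w x by blast
      qed
    qed simp
    then show "card {v \<in> V. x \<in> edge v} \<le> 1" by simp
  qed (auto simp: frontier_eq)
  moreover have "(\<Sum>v\<in>V. ennreal (dist v (nxt v))) \<le> (\<Sum>v\<in>V. hausdorff_length (edge v))"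
    by (intro sum_mono hausdorff_length_closed_segment_ge order_refl)
  ultimately show "ennreal (perimeter P) \<le> hausdorff_length (frontier P)"
    by (simp add: perimeter_def sum_ennreal)
qed

text \<open>Links angles measured by area to directions: passing from one side to the next turns by
  the exterior angle. Convexity puts this turn strictly between 0 and \<open>pi\<close>.\<close>

lemma turn:
  assumes v: "v \<in> V" and L: "nxt v - v = dist v (nxt v) *\<^sub>R dir \<psi>"
  defines "\<phi> \<equiv> pi - angle_at P (nxt v)"
  shows "0 < \<phi>" "\<phi> < pi" "has_angle P (nxt v) (pi - \<phi>)"
    "nxt (nxt v) - nxt v = dist (nxt v) (nxt (nxt v)) *\<^sub>R dir (\<psi> + \<phi>)"
proof -
  let ?w = "nxt v" and ?u = "nxt (nxt v)"
  have w: "?w \<in> V" and u: "?u \<in> V" using v nxt_in by blast+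
  obtain \<eta> where \<eta>: "\<psi> \<le> \<eta>" "\<eta> < \<psi> + 2*pi" "?u - ?w = norm (?u - ?w) *\<^sub>R dir \<eta>" by (rule polar_real2)
  have L0: "0 < dist v ?w" and L1: "0 < norm (?u - ?w)" using nxt_neq[OF v] nxt_neq[OF w] by auto
  have "0 < cross2 (?w - v) (?u - v)" using nxt_left_strict[OF v u] nxt_nxt_neq[OF v] nxt_neq[OF w] by blast
  moreover have "?u - v = (?u - ?w) + (?w - v)" by simp
  ultimately have "0 < cross2 (?w - v) (?u - ?w)" by (simp only: cross2_simps(2,9) add_0_right)
  then have "0 < cross2 (dist v ?w *\<^sub>R dir \<psi>) (norm (?u - ?w) *\<^sub>R dir \<eta>)" using L \<eta>(3) by simp
  then have s: "0 < sin (\<eta> - \<psi>)" using L0 L1 by (simp add: cross2_dir zero_less_mult_iff)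
  have "0 < \<eta> - \<psi>" using s \<eta>(1) by (cases "\<eta> = \<psi>") auto
  have "\<eta> - \<psi> < pi"
  proof (rule ccontr)
    assume "\<not> \<eta> - \<psi> < pi"
    then have "0 \<le> sin (\<eta> - \<psi> - pi)" using \<eta> by (intro sin_ge_zero) auto
    then show False using s by (simp add: sin_diff)
  qed
  have "has_angle P ?w (pi - (\<eta> - \<psi>))"
    using L0 L1 L \<eta>(3) \<open>0 < \<eta> - \<psi>\<close> \<open>\<eta> - \<psi> < pi\<close>
    by (intro angle_vertex[OF v L, of "norm (?u - ?w)"]) simp_all
  then have \<phi>: "\<phi> = \<eta> - \<psi>" unfolding \<phi>_def by (simp add: has_angle_eq)
  show "0 < \<phi>" "\<phi> < pi" "has_angle P ?w (pi - \<phi>)"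
    unfolding \<phi> by fact+
  show "?u - ?w = dist ?w ?u *\<^sub>R dir (\<psi> + \<phi>)"
    using \<eta>(3) by (simp add: \<phi> dist_norm norm_minus_commute)
qed

lemma vertex_angle:
  assumes "w \<in> V"
  shows "has_angle P w (angle_at P w)" "0 < angle_at P w" "angle_at P w < pi"
proof -
  obtain v where v: "v \<in> V" "w = nxt v" using assms nxt_image by blast
  obtain \<psi> where "nxt v - v = norm (nxt v - v) *\<^sub>R dir \<psi>" by (rule polar_real2)
  then have "nxt v - v = dist v (nxt v) *\<^sub>R dir \<psi>" by (simp add: dist_norm norm_minus_commute)
  from turn[OF v(1) this] show "has_angle P w (angle_at P w)" "0 < angle_at P w" "angle_at P w < pi"
    by (simp_all add: v(2))
qed

text \<open>Neither one step nor two steps of \<open>nxt\<close> return to the start, so every orbit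
  has at least three elements. Two orbits would need six vertices; with at most five, the orbit of
  any vertex is all of \<open>V\<close>.\<close>

lemma cycle:
  assumes n5: "card V \<le> 5"
  obtains v where "\<And>i. v i \<in> V" "\<And>i. v (Suc i) = nxt (v i)" "v (card V) = v 0"
    "V = v ` {..<card V}" "inj_on v {..<card V}"
proof -
  have Vne: "V \<noteq> {}" using card_ge3 by auto
  then obtain v0 where v0: "v0 \<in> V" by blast
  define v where "v i = (nxt ^^ i) v0" for i
  have vS: "v (Suc i) = nxt (v i)" for i by (simp add: v_def)
  have vV: "v i \<in> V" for i by (induction i) (auto simp: v_def v0 nxt_in)
  have shift: "v j = v 0" if "v (i + j) = v i" for i j
    using that by (induction i) (auto simp: vS dest!: inj_onD[OF inj_nxt _ vV vV])
  have "\<not> inj_on v {..card V}"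
  proof
    assume "inj_on v {..card V}"
    then have "card (v ` {..card V}) = Suc (card V)" by (simp add: card_image)
    moreover have "card (v ` {..card V}) \<le> card V" using vV by (intro card_mono finite_V) auto
    ultimately show False by simp
  qed
  then obtain a b where ab: "v a = v b" "a < b" unfolding inj_on_def by (metis linorder_neqE_nat)
  then have "\<exists>j>0. v j = v 0" using shift[of a "b - a"] by (intro exI[of _ "b - a"]) auto
  then obtain n where n: "0 < n" "v n = v 0" and least: "\<And>j. 0 < j \<Longrightarrow> j < n \<Longrightarrow> v j \<noteq> v 0"
    using exists_least_iff[of "\<lambda>j. 0 < j \<and> v j = v 0"] by auto
  have inj: "inj_on v {..<n}"
  proof (rule inj_onI)
    have "\<not> (v a = v b \<and> a < b \<and> b < n)" for a b
      using shift[of a "b - a"] least[of "b - a"] by auto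
    then show "a = b" if "a \<in> {..<n}" "b \<in> {..<n}" "v a = v b" for a b
      using that by (metis lessThan_iff linorder_neqE_nat)
  qed
  let ?O = "v ` {..<n}"
  have Oclosed: "nxt x \<in> ?O" if x: "x \<in> ?O" for x
  proof -
    obtain i where i: "i < n" "x = v i" using x by auto
    show ?thesis
    proof (cases "Suc i = n")
      case True
      then show ?thesis using n i vS[of i] by (auto intro!: image_eqI[of _ _ 0])
    next
      case False
      then show ?thesis using i vS[of i] by (auto intro!: image_eqI[of _ _ "Suc i"])
    qed
  qed
  have Oimg: "nxt ` ?O = ?O"
    using Oclosed vV inj_nxt by (intro endo_inj_surj) (auto intro: inj_on_subset)
  have three: "3 \<le> card A" if A: "A \<subseteq> V" "x \<in> A" "\<And>y. y \<in> A \<Longrightarrow> nxt y \<in> A" for A x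
  proof -
    have x: "x \<in> V" using A by blast
    have "{x, nxt x, nxt (nxt x)} \<subseteq> A" using A by blast
    moreover have "card {x, nxt x, nxt (nxt x)} = 3"
      using nxt_neq[OF x] nxt_neq[OF nxt_in[OF x]] nxt_nxt_neq[OF x] by auto
    ultimately show ?thesis using card_mono[OF finite_subset[OF A(1) finite_V]] by metis
  qed
  have OV: "?O \<subseteq> V" using vV by auto
  have "V \<subseteq> ?O"
  proof (rule ccontr)
    assume "\<not> V \<subseteq> ?O"
    then obtain x where x: "x \<in> V - ?O" by blast
    have "3 \<le> card (V - ?O)"
    proof (rule three[OF _ x])
      fix y assume y: "y \<in> V - ?O"
      show "nxt y \<in> V - ?O"
      proof
        show "nxt y \<in> V" using y nxt_in by blast
        show "nxt y \<notin> ?O"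
        proof
          assume "nxt y \<in> ?O"
          then obtain z where "z \<in> ?O" "nxt z = nxt y" using Oimg by (metis imageE)
          then show False using y OV inj_onD[OF inj_nxt] by blast
        qed
      qed
    qed auto
    moreover have "3 \<le> card ?O" using n(1) by (intro three[OF OV _ Oclosed, of "v 0"]) auto
    moreover have "card V = card ?O + card (V - ?O)"
      using card_Diff_subset[OF finite_subset[OF OV finite_V] OV] card_mono[OF finite_V OV] by simp
    ultimately show False using n5 by simp
  qed
  then have VO: "V = ?O" using OV by blast
  then have "card V = n" using inj by (simp add: card_image)
  then show ?thesis using that[of v] vV vS n VO inj by metis
qed

end

lemma edge_vectors_map:
  assumes "\<And>i. \<psi> (Suc i) = \<psi> i + \<phi> i"
  shows "edge_vectors (\<psi> 0) (map (\<lambda>i. (l i, \<phi> i)) [0..<n]) = map (\<lambda>i. l i *\<^sub>R dir (\<psi> i)) [0..<n]"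
    and "\<psi> n = \<psi> 0 + sum_list (map \<phi> [0..<n])"
proof -
  have "edge_vectors (\<psi> 0) (map (\<lambda>i. (l i, \<phi> i)) [0..<n]) = map (\<lambda>i. l i *\<^sub>R dir (\<psi> i)) [0..<n]
    \<and> \<psi> n = \<psi> 0 + sum_list (map \<phi> [0..<n])"
    by (induction n) (auto simp: edge_vectors_append assms comp_def)
  then show "edge_vectors (\<psi> 0) (map (\<lambda>i. (l i, \<phi> i)) [0..<n]) = map (\<lambda>i. l i *\<^sub>R dir (\<psi> i)) [0..<n]"
    "\<psi> n = \<psi> 0 + sum_list (map \<phi> [0..<n])" by auto
qed

lemma area2_differences:
  "sum_list (map (\<lambda>i. v (Suc i) - v i) [0..<n]) = v n - v 0"
  "area2 (map (\<lambda>i. v (Suc i) - v i) [0..<n]) = (\<Sum>i<n. cross2 (v i) (v (Suc i))) - cross2 (v 0) (v n)"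
proof -
  show *: "sum_list (map (\<lambda>i. v (Suc i) - v i) [0..<n]) = v n - v 0" for n by (induction n) auto
  show "area2 (map (\<lambda>i. v (Suc i) - v i) [0..<n]) = (\<Sum>i<n. cross2 (v i) (v (Suc i))) - cross2 (v 0) (v n)"
    by (induction n) (auto simp: area2_append *)
qed

context polygon begin

text \<open>After one round the direction of the first side recurs, so the exterior angles add up to
  some multiple of \<open>2 * pi\<close>; which multiple is settled in
  \<open>angle_sum\<close>.\<close>

lemma polygon_list:
  assumes n5: "card V \<le> 5"
  obtains \<psi> xs k where "length xs = card V" "\<And>f :: real \<Rightarrow> real. (\<Sum>\<phi>\<leftarrow>map snd xs. f \<phi>) = (\<Sum>v\<in>V. f (pi - angle_at P v))"
    "sum_list (map fst xs) = perimeter P" "area2 (edge_vectors \<psi> xs) = 2 * measure lebesgue P"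
    "sum_list (edge_vectors \<psi> xs) = 0"
    "\<And>l \<phi>. (l, \<phi>) \<in> set xs \<Longrightarrow> 0 \<le> l \<and> 0 < \<phi> \<and> \<phi> < pi" "sum_list (map snd xs) = 2 * pi * real_of_int k"
proof -
  obtain v where v: "\<And>i. v i \<in> V" "\<And>i. v (Suc i) = nxt (v i)" "v (card V) = v 0"
    "V = v ` {..<card V}" "inj_on v {..<card V}" using cycle[OF n5] by blast
  define n where "n = card V"
  define l where "l i = dist (v i) (v (Suc i))" for i
  define \<phi> where "\<phi> i = pi - angle_at P (v (Suc i))" for i
  obtain \<psi>0 where \<psi>0: "v 1 - v 0 = norm (v 1 - v 0) *\<^sub>R dir \<psi>0" by (rule polar_real2)
  define \<psi> where "\<psi> i = \<psi>0 + (\<Sum>j<i. \<phi> j)" for i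
  have \<psi>S: "\<psi> (Suc i) = \<psi> i + \<phi> i" for i by (simp add: \<psi>_def)
  have e: "v (Suc i) - v i = l i *\<^sub>R dir (\<psi> i)" for i
  proof (induction i)
    case 0
    show ?case using \<psi>0 by (simp add: \<psi>_def l_def dist_norm norm_minus_commute)
  next
    case (Suc i)
    show ?case using turn(4)[of "v i" "\<psi> i"] Suc v(1)[of i] by (simp add: v(2) l_def \<phi>_def \<psi>S)
  qed
  have \<phi>: "0 < \<phi> i" "\<phi> i < pi" for i using vertex_angle[OF v(1)[of "Suc i"]] by (auto simp: \<phi>_def)
  have sumV: "(\<Sum>i<n. f (v i)) = (\<Sum>w\<in>V. f w)" for f :: "real^2 \<Rightarrow> real"
    using sum.reindex[OF v(5), of f] v(4) by (simp add: n_def)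
  define xs where "xs = map (\<lambda>i. (l i, \<phi> i)) [0..<n]"
  have ev: "edge_vectors (\<psi> 0) xs = map (\<lambda>i. v (Suc i) - v i) [0..<n]"
    unfolding xs_def e by (rule edge_vectors_map) (rule \<psi>S)
  have snd_xs: "(\<Sum>x\<leftarrow>map snd xs. f x) = (\<Sum>w\<in>V. f (pi - angle_at P w))" for f :: "real \<Rightarrow> real"
  proof -
    have "(\<Sum>x\<leftarrow>map snd xs. f x) = (\<Sum>i<n. f (pi - angle_at P (nxt (v i))))"
      by (simp add: xs_def comp_def \<phi>_def v(2) interv_sum_list_conv_sum_set_nat atLeast0LessThan)
    also have "\<dots> = (\<Sum>w\<in>V. f (pi - angle_at P (nxt w)))" by (rule sumV)
    also have "\<dots> = (\<Sum>w\<in>V. f (pi - angle_at P w))" by (rule sum_nxt)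
    finally show ?thesis .
  qed
  have n0: "0 < n" using card_ge3 by (simp add: n_def)
  have "dir (\<psi> n) = dir (\<psi> 0)"
  proof -
    have "v (Suc n) = v (Suc 0)" using v(2)[of n] v(2)[of 0] v(3) by (simp add: n_def)
    then have "l n *\<^sub>R dir (\<psi> n) = l 0 *\<^sub>R dir (\<psi> 0)" "l n = l 0"
      using e[of n] e[of 0] v(3) by (auto simp: l_def n_def)
    moreover have "l 0 \<noteq> 0" using nxt_neq[OF v(1)[of 0]] v(2)[of 0] by (simp add: l_def)
    ultimately show ?thesis by simp
  qed
  then have "cos (\<psi> n - \<psi> 0) = 1" using inner_dir[of "\<psi> 0" "\<psi> n"] by (simp add: dot_square_norm)
  then obtain k :: int where k: "\<psi> n - \<psi> 0 = 2 * pi * k" by (auto simp: cos_one_2pi_int)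
  show ?thesis
  proof (rule that[of xs "\<psi> 0" k])
    show "length xs = card V" by (simp add: xs_def n_def)
    show "(\<Sum>x\<leftarrow>map snd xs. f x) = (\<Sum>w\<in>V. f (pi - angle_at P w))" for f :: "real \<Rightarrow> real" by (rule snd_xs)
    have "sum_list (map fst xs) = (\<Sum>i<n. dist (v i) (nxt (v i)))"
      by (simp add: xs_def comp_def l_def v(2) interv_sum_list_conv_sum_set_nat atLeast0LessThan)
    then show "sum_list (map fst xs) = perimeter P"
      unfolding perimeter_def using sumV[of "\<lambda>w. dist w (nxt w)"] by simp
    have "area2 (edge_vectors (\<psi> 0) xs) = (\<Sum>i<n. cross2 (v i) (nxt (v i)))"
      unfolding ev area2_differences using v(3) by (simp add: n_def v(2))
    then show "area2 (edge_vectors (\<psi> 0) xs) = 2 * measure lebesgue P"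
      using sumV[of "\<lambda>w. cross2 w (nxt w)"] measure_eq by simp
    show "sum_list (edge_vectors (\<psi> 0) xs) = 0"
      unfolding ev area2_differences using v(3) by (simp add: n_def)
    show "0 \<le> a \<and> 0 < b \<and> b < pi" if "(a, b) \<in> set xs" for a b
      using that \<phi> by (auto simp: xs_def l_def)
    show "sum_list (map snd xs) = 2 * pi * real_of_int k"
      using edge_vectors_map(2)[of \<psi> \<phi> n] \<psi>S k by (simp add: xs_def comp_def)
  qed
qed

text \<open>Exterior angles lie strictly between 0 and \<open>pi\<close>, which confines
  \<open>k\<close>. Up to four vertices this leaves only \<open>k = 1\<close>, for five also
  \<open>k = 2\<close>.\<close>

lemma angle_sum_cong:
  assumes "card V \<le> 5"
  obtains k :: int where "(\<Sum>v\<in>V. pi - angle_at P v) = 2 * pi * k" "1 \<le> k" "2 * k < card V"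
proof -
  obtain \<psi> xs k where xs: "length xs = card V" "\<And>f :: real \<Rightarrow> real. (\<Sum>\<phi>\<leftarrow>map snd xs. f \<phi>) = (\<Sum>v\<in>V. f (pi - angle_at P v))"
    "sum_list (map fst xs) = perimeter P" "area2 (edge_vectors \<psi> xs) = 2 * measure lebesgue P"
    "sum_list (edge_vectors \<psi> xs) = 0"
    "\<And>l \<phi>. (l, \<phi>) \<in> set xs \<Longrightarrow> 0 \<le> l \<and> 0 < \<phi> \<and> \<phi> < pi" "sum_list (map snd xs) = 2 * pi * real_of_int k"
    by (rule polygon_list[OF assms]) iprover
  have s: "(\<Sum>v\<in>V. pi - angle_at P v) = 2 * pi * k" using xs(2)[of "\<lambda>x. x"] xs(7) by simp
  have Vne: "V \<noteq> {}" using card_ge3 by auto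
  have "0 < (\<Sum>v\<in>V. pi - angle_at P v)" using vertex_angle finite_V Vne by (intro sum_pos) auto
  then have "0 < k" unfolding s by (simp add: zero_less_mult_iff)
  have "(\<Sum>v\<in>V. pi - angle_at P v) < (\<Sum>v\<in>V. pi)"
    using vertex_angle finite_V Vne by (intro sum_strict_mono) auto
  then have "pi * (2 * real_of_int k) < pi * real (card V)" unfolding s by (simp add: mult_ac)
  then have "2 * real_of_int k < real (card V)" by (simp only: mult_less_cancel_left_pos[OF pi_gt_zero])
  then have "2 * k < card V" by linarith
  then show ?thesis using that s \<open>0 < k\<close> by force
qed

end

lemma angle_sum_triangle:
  assumes "polygon Q" "card (vertices Q) \<le> 4"
  shows "(\<Sum>v\<in>vertices Q. pi - angle_at Q v) = 2*pi"
proof -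
  have "card (vertices Q) \<le> 5" using assms by simp
  then obtain k :: int where k: "(\<Sum>v\<in>vertices Q. pi - angle_at Q v) = 2 * pi * k" "1 \<le> k" "2 * k < card (vertices Q)"
    by (rule polygon.angle_sum_cong[OF assms(1)])
  then have "k = 1" using assms(2) by linarith
  then show ?thesis using k(1) by simp
qed

context polygon begin

lemma angle_sum:
  assumes n5: "card V \<le> 5"
  shows "(\<Sum>v\<in>V. pi - angle_at P v) = 2*pi"
proof (cases "card V \<le> 4")
  case True
  then show ?thesis using angle_sum_triangle polygon_axioms by blast
next
  case False
  then have n: "card V = 5" using n5 by simp
  obtain k :: int where k: "(\<Sum>v\<in>V. pi - angle_at P v) = 2 * pi * k" "1 \<le> k" "2 * k < card V"
    using angle_sum_cong[OF n5] by blast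
  obtain v where v: "\<And>i. v i \<in> V" "\<And>i. v (Suc i) = nxt (v i)" "v (card V) = v 0"
    "V = v ` {..<card V}" "inj_on v {..<card V}" using cycle[OF n5] by blast
  have ne: "v i \<noteq> v j" if "i < 5" "j < 5" "i \<noteq> j" for i j using v(5) that by (auto simp: n inj_on_def)
  \<comment> \<open>an inscribed triangle already accounts for an angle \<open>pi\<close>, which excludes the pentagram value \<open>k = 2\<close>\<close>
  let ?W = "{v 0, v 1, v 3}"
  define Q where "Q = convex hull ?W"
  have QP: "Q \<subseteq> P" unfolding Q_def using v(1) V_subset by (intro hull_minimal convex) auto
  have "0 < cross2 (v 1 - v 0) (v 3 - v 0)"
    using nxt_left_strict[OF v(1)[of 0] v(1)[of 3]] v(2)[of 0] ne[of 3 0] ne[of 3 1] by (simp del: cross2_simps)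
  then have "0 < measure lebesgue Q" unfolding Q_def by (simp add: measure_triangle del: cross2_simps)
  then have "\<not> negligible Q" by (auto dest: negligible_imp_measure0)
  then have "interior Q \<noteq> {}" using negligible_convex_interior[of Q] by (simp add: Q_def)
  then have Q: "polygon Q" by unfold_locales (simp add: convex_polygon_def Q_def polytope_convex_hull)
  have sub: "vertices Q \<subseteq> ?W" unfolding vertices_def Q_def by (rule extreme_points_of_convex_hull)
  have "card ?W = 3" using ne by simp
  then have VQ: "vertices Q = ?W" using polygon.card_ge3[OF Q] sub by (intro card_seteq) auto
  have "(\<Sum>w\<in>?W. pi - angle_at Q w) = 2*pi" using angle_sum_triangle[OF Q] VQ \<open>card ?W = 3\<close> by simp
  moreover have "(\<Sum>w\<in>?W. pi - angle_at Q w) = (pi - angle_at Q (v 0)) + (pi - angle_at Q (v 1)) + (pi - angle_at Q (v 3))"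
    using ne by simp
  ultimately have sumQ: "angle_at Q (v 0) + angle_at Q (v 1) + angle_at Q (v 3) = pi" by simp
  have le: "angle_at Q w \<le> angle_at P w" if "w \<in> ?W" for w
    using has_angle_mono[OF polygon.vertex_angle(1)[OF Q] vertex_angle(1) QP compact polygon.compact[OF Q]] that v(1) VQ by blast
  have "pi \<le> angle_at P (v 0) + angle_at P (v 1) + angle_at P (v 3)"
    using le[of "v 0"] le[of "v 1"] le[of "v 3"] sumQ by simp
  moreover have "0 < angle_at P (v 2)" "0 < angle_at P (v 4)" using vertex_angle v(1) by auto
  moreover have "(\<Sum>w\<in>V. pi - angle_at P w) = (\<Sum>i<5. pi - angle_at P (v i))"
    using sum.reindex[OF v(5), of "\<lambda>w. pi - angle_at P w"] v(4) by (simp add: n)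
  ultimately have "2 * pi * k < 4 * pi" unfolding k(1) by (simp add: eval_nat_numeral)
  then have "k = 1" using k(2) by simp
  then show ?thesis using k(1) by simp
qed

lemma isoperimetric:
  assumes n5: "card V \<le> 5"
  shows "4 * measure lebesgue P * (\<Sum>v\<in>V. tan ((pi - angle_at P v) / 2)) \<le> (perimeter P)\<^sup>2"
proof -
  obtain \<psi> xs k where xs: "length xs = card V" "\<And>f :: real \<Rightarrow> real. (\<Sum>\<phi>\<leftarrow>map snd xs. f \<phi>) = (\<Sum>v\<in>V. f (pi - angle_at P v))"
    "sum_list (map fst xs) = perimeter P" "area2 (edge_vectors \<psi> xs) = 2 * measure lebesgue P"
    "sum_list (edge_vectors \<psi> xs) = 0"
    "\<And>l \<phi>. (l, \<phi>) \<in> set xs \<Longrightarrow> 0 \<le> l \<and> 0 < \<phi> \<and> \<phi> < pi" "sum_list (map snd xs) = 2 * pi * real_of_int k"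
    by (rule polygon_list[OF n5]) iprover
  have "sum_list (map snd xs) = 2*pi" using xs(2)[of "\<lambda>x. x"] angle_sum[OF n5] by simp
  then have ct: "closed_turn \<psi> xs" using xs by (auto simp: closed_turn_def)
  have "lhuilier_ineq \<psi> xs"
  proof -
    consider "length xs = 3" | "length xs = 4" | "length xs = 5" using card_ge3 n5 xs(1) by linarith
    then show ?thesis
    proof cases
      case 1
      then obtain l0 \<phi>0 l1 \<phi>1 l2 \<phi>2 where "xs = [(l0, \<phi>0), (l1, \<phi>1), (l2, \<phi>2)]"
        by (auto simp: eval_nat_numeral length_Suc_conv)
      then show ?thesis using lhuilier3 ct by simp
    qed (use lhuilier4 lhuilier5 ct in auto)
  qed
  then show ?thesis unfolding lhuilier_ineq_def xs(2-4) by simp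
qed

end

section \<open>The lower bound for a single tile\<close>

lemma tan_diff_ge:
  fixes x y :: real
  assumes "0 \<le> x" "x \<le> y" "y < pi/2" shows "y - x \<le> tan y - tan x"
proof -
  have "tan x - x \<le> tan y - y"
  proof (rule DERIV_nonneg_imp_nondecreasing[OF assms(2)])
    fix t assume t: "x \<le> t" "t \<le> y"
    have c: "cos t \<noteq> 0" using t assms by (auto intro!: less_imp_neq[THEN not_sym] cos_gt_zero_pi)
    have "((\<lambda>x. tan x - x) has_real_derivative inverse ((cos t)\<^sup>2) - 1) (at t)"
      using c by (auto intro!: derivative_eq_intros simp: field_simps power2_eq_square)
    moreover have "inverse ((cos t)\<^sup>2) = 1 + (tan t)\<^sup>2" using tan_sec[OF c] by (simp flip: power_inverse)
    then have "0 \<le> inverse ((cos t)\<^sup>2) - 1" by simp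
    ultimately show "\<exists>d. ((\<lambda>x. tan x - x) has_real_derivative d) (at t) \<and> 0 \<le> d" by blast
  qed
  then show ?thesis by simp
qed

text \<open>Once the minorant is subtracted, the derivative is
  \<open>(tan y)\<^sup>2 - (tan c)\<^sup>2 - (y - c) / 5\<close>. The tangent grows at least as fast
  as its argument and \<open>tan y + tan c\<close> is at least \<open>1/2\<close>, so this has the
  sign of \<open>y - c\<close> and the minimum is at \<open>c\<close>.\<close>

lemma tan_quadratic_minorant:
  fixes x c :: real
  assumes x: "0 \<le> x" "x < pi/2" and c: "0 \<le> c" "c < pi/2" and t: "1/2 \<le> tan c"
  shows "tan c + (1 + (tan c)\<^sup>2) * (x - c) + (x - c)\<^sup>2 / 10 \<le> tan x"
proof -
  let ?f = "\<lambda>x. tan x - (1 + (tan c)\<^sup>2) * (x - c) - (x - c)\<^sup>2 / 10"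
  have d: "(?f has_real_derivative (tan y)\<^sup>2 - (tan c)\<^sup>2 - (y - c) / 5) (at y)" if y: "0 \<le> y" "y < pi/2" for y
  proof -
    have cy: "cos y \<noteq> 0" using y by (auto intro!: less_imp_neq[THEN not_sym] cos_gt_zero_pi)
    have "inverse ((cos y)\<^sup>2) = 1 + (tan y)\<^sup>2" using tan_sec[OF cy] by (simp flip: power_inverse)
    moreover have "(?f has_real_derivative inverse ((cos y)\<^sup>2) - (1 + (tan c)\<^sup>2) - 2 * (y - c) / 10) (at y)"
      using cy by (auto intro!: derivative_eq_intros simp: field_simps)
    ultimately have "inverse ((cos y)\<^sup>2) - (1 + (tan c)\<^sup>2) - 2 * (y - c) / 10 = (tan y)\<^sup>2 - (tan c)\<^sup>2 - (y - c) / 5"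
      and "(?f has_real_derivative inverse ((cos y)\<^sup>2) - (1 + (tan c)\<^sup>2) - 2 * (y - c) / 10) (at y)"
      by simp_all
    then show ?thesis by metis
  qed
  have "?f c \<le> ?f x"
  proof (cases "c \<le> x")
    case True
    show ?thesis
    proof (rule DERIV_nonneg_imp_nondecreasing[OF True])
      fix y assume y: "c \<le> y" "y \<le> x"
      have "(y - c) * 1 \<le> (tan y - tan c) * (tan y + tan c)"
        using tan_diff_ge[of c y] y x c t by (intro mult_mono) auto
      then have "y - c \<le> (tan y)\<^sup>2 - (tan c)\<^sup>2"
        by (simp add: power2_eq_square algebra_simps)
      then have "0 \<le> (tan y)\<^sup>2 - (tan c)\<^sup>2 - (y - c) / 5" using y by simp
      then show "\<exists>d. (?f has_real_derivative d) (at y) \<and> 0 \<le> d" using d[OF _ , of y] y c x by (meson order.trans order.strict_trans1)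
    qed
  next
    case False
    show ?thesis
    proof (rule DERIV_nonpos_imp_nonincreasing[of x c])
      fix y assume y: "x \<le> y" "y \<le> c"
      have ty: "0 \<le> tan y" using y x c by (cases "y = 0") (auto intro!: less_imp_le[OF tan_gt_zero])
      have "(c - y) * (1/2) \<le> (tan c - tan y) * (tan c + tan y)"
        using tan_diff_ge[of y c] y x c t ty by (intro mult_mono) auto
      then have "(c - y) / 2 \<le> (tan c)\<^sup>2 - (tan y)\<^sup>2"
        by (simp add: power2_eq_square algebra_simps)
      then have "(tan y)\<^sup>2 - (tan c)\<^sup>2 - (y - c) / 5 \<le> 0" using y by simp
      then show "\<exists>d. (?f has_real_derivative d) (at y) \<and> d \<le> 0" using d[OF _ , of y] y c x by (meson order.trans order.strict_trans1)
    qed (use False in simp)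
  qed
  then show ?thesis by simp
qed

definition c0 :: real where "c0 = sqrt (2 + sqrt 3)"

text \<open>Minus the slope of the chord of \<open>cot (\<alpha> / 2)\<close> between
  \<open>pi / 2\<close> and \<open>2 * pi / 3\<close>. The chord itself is
  \<open>4 - sqrt 3 - slope * \<alpha>\<close>.\<close>

definition slope :: real where "slope = (6 - 2 * sqrt 3) / pi"

text \<open>The contribution of a corner of angle \<open>\<alpha>\<close>; the flag tells whether it lies at a point where
  exactly three tiles meet, each with a corner there.  The slopes are those for which the
  contributions at a vertex of the tiling add up to a nonnegative number.\<close>

definition corner_weight :: "bool \<Rightarrow> real \<Rightarrow> real" where
  "corner_weight b \<alpha> = (if b then (slope - 2/3) * (\<alpha> - 2*pi/3) else (slope - 1) * (\<alpha> - pi/2))"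

lemma sqrt3_bounds: "173/100 \<le> sqrt 3" "sqrt 3 \<le> 2"
  by (rule real_le_rsqrt real_le_lsqrt; simp add: power2_eq_square)+

lemma c0_props: "0 < c0" "c0\<^sup>2 = 2 + sqrt 3"
  using sqrt3_bounds by (auto simp: c0_def)

text \<open>With these bounds \<open>slope\<close> lies strictly between \<open>2/3\<close> and 1,
  the negated slopes of the two tangents, and differs from either by at most \<open>27/100\<close>.
  Comparing \<open>pi / 6\<close> with its sine and its tangent supplies the bounds on
  \<open>pi\<close>.\<close>

lemma slope_bounds: "73/100 \<le> slope" "slope \<le> 85/100"
proof -
  have sp: "slope * pi = 6 - 2 * sqrt 3" by (simp add: slope_def)
  have pi_low: "3 \<le> pi" using sin_x_le_x[of "pi/6"] by (simp add: sin_30)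
  have "pi/6 \<le> 1 / sqrt 3" using tan_diff_ge[of 0 "pi/6"] by (simp add: tan_30)
  moreover have "1 / sqrt 3 = sqrt 3 / 3" using real_sqrt_mult_self[of 3] by (simp add: field_simps)
  ultimately have pi_up: "pi \<le> 2 * sqrt 3" by simp
  show "73/100 \<le> slope"
  proof (rule ccontr)
    assume "\<not> 73/100 \<le> slope"
    then have "slope * pi < 73/100 * pi" by simp
    also have "\<dots> \<le> 73/100 * (2 * sqrt 3)" using pi_up by simp
    finally have "6 < 346/100 * sqrt 3" using sp by simp
    then have "(600/346)\<^sup>2 < (sqrt 3)\<^sup>2" by (intro power_strict_mono) auto
    then show False by (simp add: power2_eq_square)
  qed
  show "slope \<le> 85/100"
  proof (rule ccontr)
    assume "\<not> slope \<le> 85/100"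
    then have "85/100 * pi < slope * pi" by (intro mult_strict_right_mono) auto
    then show False using sp sqrt3_bounds pi_low by simp
  qed
qed

text \<open>Chord plus corner weight is the tangent at the chosen angle. A deviation
  \<open>z\<close> of \<alpha> is a deviation \<open>z / 2\<close> of the argument of
  \<open>tan\<close>, which turns the gain of \<open>1/10\<close> into \<open>1/40\<close>; and
  \<open>73/1000\<close> is just above the square of \<open>27/100\<close>.\<close>

lemma corner_minorant:
  fixes b :: bool
  assumes "0 < \<alpha>" "\<alpha> < pi"
  defines "z \<equiv> \<alpha> - (if b then 2*pi/3 else pi/2)"
  shows "4 - sqrt 3 - slope * \<alpha> + corner_weight b \<alpha> + z\<^sup>2 / 40 \<le> tan ((pi - \<alpha>) / 2)"
    and "(corner_weight b \<alpha>)\<^sup>2 \<le> 73/1000 * z\<^sup>2"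
proof -
  have sp: "slope * pi = 6 - 2 * sqrt 3" by (simp add: slope_def)
  have x: "0 \<le> (pi - \<alpha>)/2" "(pi - \<alpha>)/2 < pi/2" using assms by auto
  show "4 - sqrt 3 - slope * \<alpha> + corner_weight b \<alpha> + z\<^sup>2 / 40 \<le> tan ((pi - \<alpha>) / 2)"
  proof (cases b)
    case True
    have s3: "tan (pi/6) = sqrt 3 / 3" "(sqrt 3 / 3)\<^sup>2 = 1/3"
      using real_sqrt_mult_self[of 3] by (simp_all add: tan_30 field_simps power2_eq_square)
    have "sqrt 3 / 3 + (1 + 1/3) * ((pi - \<alpha>)/2 - pi/6) + ((pi - \<alpha>)/2 - pi/6)\<^sup>2 / 10 \<le> tan ((pi - \<alpha>)/2)"
      using tan_quadratic_minorant[OF x, of "pi/6"] sqrt3_bounds unfolding s3 by simp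
    moreover have "((pi - \<alpha>)/2 - pi/6)\<^sup>2 / 10 = z\<^sup>2 / 40" by (simp add: z_def True power2_eq_square field_simps)
    moreover have "4 - sqrt 3 - slope * \<alpha> + corner_weight b \<alpha> = sqrt 3 / 3 + (1 + 1/3) * ((pi - \<alpha>)/2 - pi/6)"
      using sp by (simp add: corner_weight_def True field_simps)
    ultimately show ?thesis by linarith
  next
    case False
    have "1 + (1 + 1\<^sup>2) * ((pi - \<alpha>)/2 - pi/4) + ((pi - \<alpha>)/2 - pi/4)\<^sup>2 / 10 \<le> tan ((pi - \<alpha>)/2)"
      using tan_quadratic_minorant[OF x, of "pi/4"] by (simp add: tan_45)
    moreover have "((pi - \<alpha>)/2 - pi/4)\<^sup>2 / 10 = z\<^sup>2 / 40" by (simp add: z_def False power2_eq_square field_simps)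
    moreover have "4 - sqrt 3 - slope * \<alpha> + corner_weight b \<alpha> = 1 + 2 * ((pi - \<alpha>)/2 - pi/4)"
      using sp by (simp add: corner_weight_def False field_simps)
    ultimately show ?thesis by simp
  qed
  have "\<bar>slope - 2/3\<bar> \<le> 27/100" "\<bar>slope - 1\<bar> \<le> 27/100" using slope_bounds by auto
  then have "(slope - 2/3)\<^sup>2 \<le> 73/1000" "(slope - 1)\<^sup>2 \<le> 73/1000"
    using abs_le_square_iff[of "slope - 2/3" "27/100"] abs_le_square_iff[of "slope - 1" "27/100"] by (auto simp: power2_eq_square)
  then show "(corner_weight b \<alpha>)\<^sup>2 \<le> 73/1000 * z\<^sup>2"
    using mult_right_mono[of _ "73/1000" "z\<^sup>2"]
    by (auto simp: corner_weight_def z_def power_mult_distrib)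
qed

text \<open>The cotangent sum is at least \<open>c0\<^sup>2 + G + Z / 40\<close>. Completing the
  square in \<open>c0 + G / (2 * c0)\<close> needs an extra
  \<open>G\<^sup>2 / (4 * c0\<^sup>2)\<close>, and Cauchy-Schwarz over at most five corners shows
  that \<open>Z / 40\<close> covers it.\<close>

lemma (in polygon) perimeter_ge:
  fixes b :: "real^2 \<Rightarrow> bool"
  assumes n5: "card V \<le> 5" and area: "measure lebesgue P = 1"
  defines "G \<equiv> (\<Sum>v\<in>V. corner_weight (b v) (angle_at P v))"
  shows "2 * c0 + G / c0 \<le> perimeter P"
proof -
  define z where "z v = angle_at P v - (if b v then 2*pi/3 else pi/2)" for v
  define S where "S = (\<Sum>v\<in>V. tan ((pi - angle_at P v) / 2))"
  define Z where "Z = (\<Sum>v\<in>V. (z v)\<^sup>2)"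
  note ang = vertex_angle(2,3)
  have "(\<Sum>v\<in>V. 4 - sqrt 3 - slope * angle_at P v + corner_weight (b v) (angle_at P v) + (z v)\<^sup>2 / 40) \<le> S"
    unfolding S_def z_def using ang by (intro sum_mono corner_minorant(1))
  then have "card V * (4 - sqrt 3) - slope * (\<Sum>v\<in>V. angle_at P v) + G + Z / 40 \<le> S"
    by (simp add: sum.distrib sum_subtractf sum_distrib_left sum_divide_distrib G_def Z_def)
  moreover have "(\<Sum>v\<in>V. angle_at P v) = card V * pi - 2 * pi"
    using angle_sum[OF n5] by (simp add: sum_subtractf)
  moreover have "slope * (card V * pi - 2 * pi) = (real (card V) - 2) * (6 - 2 * sqrt 3)"
    by (simp add: slope_def field_simps)
  \<comment> \<open>Equality for five vertices; each vertex contributes \<open>sqrt 3 - 2\<close>,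
    which is negative, so fewer vertices only help.\<close>
  moreover have "2 + sqrt 3 \<le> card V * (4 - sqrt 3) - (real (card V) - 2) * (6 - 2 * sqrt 3)"
  proof -
    have "real (card V) * (2 - sqrt 3) \<le> 5 * (2 - sqrt 3)"
      using n5 sqrt3_bounds by (intro mult_right_mono) auto
    then show ?thesis by (simp add: algebra_simps)
  qed
  ultimately have S: "2 + sqrt 3 + G + Z / 40 \<le> S" by simp
  have G: "G\<^sup>2 \<le> 365/1000 * Z"
  proof -
    have "G\<^sup>2 \<le> (\<Sum>v\<in>V. (corner_weight (b v) (angle_at P v))\<^sup>2) * card V"
      unfolding G_def by (rule sum_squared_le_sum_of_squares)
    also have "\<dots> \<le> (\<Sum>v\<in>V. 73/1000 * (z v)\<^sup>2) * 5"
    proof (rule mult_mono)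
      show "(\<Sum>v\<in>V. (corner_weight (b v) (angle_at P v))\<^sup>2) \<le> (\<Sum>v\<in>V. 73/1000 * (z v)\<^sup>2)"
        unfolding z_def using ang by (intro sum_mono corner_minorant(2))
    qed (use n5 in \<open>auto intro!: sum_nonneg\<close>)
    also have "\<dots> = 365/1000 * Z" unfolding Z_def sum_distrib_left[symmetric] by simp
    finally show ?thesis .
  qed
  have "(c0 + G / (2 * c0))\<^sup>2 = c0\<^sup>2 + G + G\<^sup>2 / (4 * c0\<^sup>2)"
    using c0_props(1) by (simp add: field_simps power2_eq_square)
  also have "\<dots> \<le> 2 + sqrt 3 + G + Z / 40"
  proof -
    have "0 \<le> Z" by (simp add: Z_def sum_nonneg)
    \<comment> \<open>The numerical margin:
      \<open>10 * 365/1000 < 37/10 < 2 + sqrt 3\<close>.\<close>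
    then have "37 / 10 * Z \<le> (2 + sqrt 3) * Z" using sqrt3_bounds by (intro mult_right_mono) auto
    then have "G\<^sup>2 * 10 \<le> (2 + sqrt 3) * Z" using G \<open>0 \<le> Z\<close> by linarith
    then have "G\<^sup>2 / (4 * (2 + sqrt 3)) \<le> Z / 40" using sqrt3_bounds by (simp add: field_simps)
    then show ?thesis unfolding c0_props(2) by simp
  qed
  also have "\<dots> \<le> S" by (rule S)
  finally have "(2 * (c0 + G / (2 * c0)))\<^sup>2 \<le> 4 * S"
    unfolding power_mult_distrib by simp
  also have "\<dots> \<le> (perimeter P)\<^sup>2" using isoperimetric[OF n5] by (simp add: area S_def)
  finally have "2 * (c0 + G / (2 * c0)) \<le> perimeter P"
    by (rule power2_le_imp_le) (simp add: perimeter_def sum_nonneg)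
  then show ?thesis by (simp add: distrib_left)
qed

section \<open>Tilings by convex polygons of unit area\<close>

locale unit_tiling =
  fixes T :: "(real^2) set set"
  assumes tiling: "tiling T" and tile: "P \<in> T \<Longrightarrow> convex_polygon P \<and> measure lebesgue P = 1"
begin

lemma polygon: "P \<in> T \<Longrightarrow> polygon P"
  using tile by unfold_locales blast

lemma area: "P \<in> T \<Longrightarrow> measure lebesgue P = 1"
  using tile by blast

lemma cover: "\<Union>T = UNIV"
  using tiling by (simp add: tiling_def)

lemma Int_frontier: "P \<in> T \<Longrightarrow> Q \<in> T \<Longrightarrow> P \<noteq> Q \<Longrightarrow> P \<inter> Q \<subseteq> frontier P"
  using tiling by (auto simp: tiling_def)

lemma negligible_Int: "P \<in> T \<Longrightarrow> Q \<in> T \<Longrightarrow> P \<noteq> Q \<Longrightarrow> negligible (P \<inter> Q)"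
  using negligible_subset[OF negligible_convex_frontier[OF polygon.convex[OF polygon]] Int_frontier] .

lemma measure_tiles_cball:
  assumes F: "finite F" "F \<subseteq> T"
  shows "(\<Sum>P\<in>F. measure lebesgue (P \<inter> cball x \<epsilon>)) = measure lebesgue (\<Union>F \<inter> cball x \<epsilon>)"
proof -
  have "measure lebesgue (\<Union>P\<in>F. P \<inter> cball x \<epsilon>) = (\<Sum>P\<in>F. measure lebesgue (P \<inter> cball x \<epsilon>))"
  proof (rule measure_negligible_finite_Union_image[OF F(1)])
    show "P \<inter> cball x \<epsilon> \<in> lmeasurable" if "P \<in> F" for P
      using that F polygon.compact[OF polygon] by (intro lmeasurable_compact compact_Int) auto
    show "pairwise (\<lambda>P Q. negligible (P \<inter> cball x \<epsilon> \<inter> (Q \<inter> cball x \<epsilon>))) F"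
      using F negligible_Int by (intro pairwiseI) (meson inf_le1 inf_mono negligible_subset subsetD)
  qed
  then show ?thesis by (simp add: Int_UN_distrib2)
qed

lemma lmeasurable_tiles_cball:
  assumes "finite F" "F \<subseteq> T" shows "\<Union>F \<inter> cball x \<epsilon> \<in> lmeasurable"
  using assms polygon.compact[OF polygon] by (intro lmeasurable_compact compact_Int compact_Union) auto

lemma has_angle_sum:
  assumes F: "finite F" and a: "\<And>P. P \<in> F \<Longrightarrow> has_angle P x (a P)"
  shows "\<forall>\<^sub>F \<epsilon> in at_right 0. (\<Sum>P\<in>F. measure lebesgue (P \<inter> cball x \<epsilon>)) = (\<Sum>P\<in>F. a P) / 2 * \<epsilon>\<^sup>2"
proof -
  have "\<forall>\<^sub>F \<epsilon> in at_right 0. \<forall>P\<in>F. measure lebesgue (P \<inter> cball x \<epsilon>) = a P / 2 * \<epsilon>\<^sup>2"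
    using a unfolding has_angle_def by (intro eventually_ball_finite F) auto
  then show ?thesis
  proof eventually_elim
    case (elim \<epsilon>)
    then have "(\<Sum>P\<in>F. measure lebesgue (P \<inter> cball x \<epsilon>)) = (\<Sum>P\<in>F. a P / 2 * \<epsilon>\<^sup>2)"
      by (intro sum.cong) auto
    then show ?case by (simp only: sum_distrib_right sum_divide_distrib)
  qed
qed

section \<open>Angles around a point and multiplicity of the boundary\<close>

lemma angle_sum_le:
  assumes F: "finite F" "F \<subseteq> T" and a: "\<And>P. P \<in> F \<Longrightarrow> has_angle P x (a P)"
  shows "(\<Sum>P\<in>F. a P) \<le> 2*pi"
proof -
  have sums: "\<forall>\<^sub>F \<epsilon> in at_right 0. (\<Sum>P\<in>F. measure lebesgue (P \<inter> cball x \<epsilon>)) = (\<Sum>P\<in>F. a P) / 2 * \<epsilon>\<^sup>2"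
    by (rule has_angle_sum[OF F(1)]) (rule a)
  have "\<forall>\<^sub>F \<epsilon> in at_right 0. (\<Sum>P\<in>F. a P) / 2 * \<epsilon>\<^sup>2 \<le> pi * \<epsilon>\<^sup>2 \<and> \<epsilon> > (0::real)"
    using sums eventually_at_right_less[of "0::real"]
  proof eventually_elim
    case (elim \<epsilon>)
    have "measure lebesgue (\<Union>F \<inter> cball x \<epsilon>) \<le> measure lebesgue (cball x \<epsilon>)"
      using lmeasurable_tiles_cball[OF F] by (intro measure_mono_fmeasurable) (auto simp: fmeasurableD)
    moreover have "measure lebesgue (cball x \<epsilon>) = pi * \<epsilon>\<^sup>2" using elim by (simp add: content_cball unit_ball_vol_2)
    ultimately show ?case using elim measure_tiles_cball[OF F, of x \<epsilon>] by linarith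
  qed
  then have "\<exists>\<epsilon>. (\<Sum>P\<in>F. a P) / 2 * \<epsilon>\<^sup>2 \<le> pi * \<epsilon>\<^sup>2 \<and> \<epsilon> > (0::real)"
    by (rule eventually_happens'[OF trivial_limit_at_right_real])
  then show ?thesis by auto
qed

text \<open>By local finiteness the tiles that miss \<open>x\<close> keep away from it, so those
  containing \<open>x\<close> fill a small disc completely.\<close>

lemma angle_sum_eq:
  assumes fin: "finite {P\<in>T. P \<inter> cball x \<delta> \<noteq> {}}" "0 < \<delta>"
    and a: "\<And>P. P \<in> T \<Longrightarrow> x \<in> P \<Longrightarrow> has_angle P x (a P)"
  shows "(\<Sum>P\<in>{P\<in>T. x \<in> P}. a P) = 2*pi"
proof -
  let ?M = "{P\<in>T. P \<inter> cball x \<delta> \<noteq> {}}" and ?F = "{P\<in>T. x \<in> P}"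
  have sub: "?F \<subseteq> ?M" using fin(2) by force
  have F: "finite ?F" "?F \<subseteq> T" using finite_subset[OF sub fin(1)] by auto
  have "closed (\<Union>(?M - ?F))" using fin(1) polygon.closed[OF polygon] by (intro closed_Union) auto
  then have "open (- \<Union>(?M - ?F))" "x \<in> - \<Union>(?M - ?F)" by auto
  then obtain \<eta> where \<eta>: "0 < \<eta>" "ball x \<eta> \<subseteq> - \<Union>(?M - ?F)" by (meson open_contains_ball)
  have cov: "cball x \<epsilon> \<subseteq> \<Union>?F" if "\<epsilon> < \<eta>" "\<epsilon> < \<delta>" for \<epsilon>
  proof
    fix y assume y: "y \<in> cball x \<epsilon>"
    obtain P where P: "P \<in> T" "y \<in> P" using cover by blast
    have "P \<in> ?M" using P y that by force
    moreover have "y \<in> ball x \<eta>" using y that by simp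
    ultimately have "P \<in> ?F" using \<eta>(2) P by blast
    then show "y \<in> \<Union>?F" using P by blast
  qed
  have near: "\<forall>\<^sub>F \<epsilon> in at_right 0. \<epsilon> \<in> {0<..<min \<eta> \<delta>}" using \<eta>(1) fin(2) by (intro eventually_at_right_real) auto
  have sums: "\<forall>\<^sub>F \<epsilon> in at_right 0. (\<Sum>P\<in>?F. measure lebesgue (P \<inter> cball x \<epsilon>)) = (\<Sum>P\<in>?F. a P) / 2 * \<epsilon>\<^sup>2"
    by (rule has_angle_sum[OF F(1)]) (use a in blast)
  have "\<forall>\<^sub>F \<epsilon> in at_right 0. (\<Sum>P\<in>?F. a P) / 2 * \<epsilon>\<^sup>2 = pi * \<epsilon>\<^sup>2 \<and> \<epsilon> > (0::real)"
    using sums near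
  proof eventually_elim
    case (elim \<epsilon>)
    then have "\<Union>?F \<inter> cball x \<epsilon> = cball x \<epsilon>" using cov[of \<epsilon>] by auto
    then show ?case using elim measure_tiles_cball[OF F, of x \<epsilon>] by (simp add: content_cball unit_ball_vol_2)
  qed
  then have "\<exists>\<epsilon>. (\<Sum>P\<in>?F. a P) / 2 * \<epsilon>\<^sup>2 = pi * \<epsilon>\<^sup>2 \<and> \<epsilon> > (0::real)"
    by (rule eventually_happens'[OF trivial_limit_at_right_real])
  then show ?thesis by auto
qed

text \<open>Away from vertices each tile with \<open>x\<close> on its frontier takes up an angle
  \<open>pi\<close>. Only finite subfamilies are involved, so this can be used to prove local
  finiteness.\<close>

lemma card_frontier_le_2:
  assumes F: "finite F" "F \<subseteq> T" and x: "x \<notin> (\<Union>P\<in>F. vertices P)"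
  shows "card {P\<in>F. x \<in> frontier P} \<le> 2"
proof -
  let ?G = "{P\<in>F. x \<in> frontier P}"
  have "(\<Sum>P\<in>?G. pi) \<le> 2*pi"
    using F x by (intro angle_sum_le polygon.angle_edge polygon) auto
  then have "real (card ?G) * pi \<le> 2 * pi" by simp
  then show ?thesis by (simp only: mult_le_cancel_right) (use pi_gt_zero in simp)
qed

definition boundary :: "(real^2) set" where "boundary = (\<Union>P\<in>T. frontier P)"

lemma sum_frontier_le:
  assumes F: "finite F" "F \<subseteq> T" and B: "B \<in> sets borel"
  shows "(\<Sum>P\<in>F. hausdorff_length (frontier P \<inter> B)) \<le> 2 * hausdorff_length (boundary \<inter> B)"
proof -
  have "(\<Sum>P\<in>F. hausdorff_length (frontier P \<inter> B)) \<le> of_nat 2 * hausdorff_length (boundary \<inter> B)"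
  proof (rule sum_hausdorff_length_le[OF F(1)])
    show "finite (\<Union>P\<in>F. vertices P)" using F polygon.finite_V[OF polygon] by auto
    show "card {P \<in> F. x \<in> frontier P \<inter> B} \<le> 2" if "x \<notin> (\<Union>P\<in>F. vertices P)" for x
      by (rule order.trans[OF card_mono card_frontier_le_2[OF F that]]) (use F in auto)
    show "(\<Union>P\<in>F. frontier P \<inter> B) \<subseteq> boundary \<inter> B" using F by (auto simp: boundary_def)
  qed (use B in auto)
  then show ?thesis by simp
qed

section \<open>Boundary length that a single tile must have in a disc or annulus\<close>

lemma not_subset_small_cball:
  assumes P: "P \<in> T" and r: "0 \<le> r" "pi * r\<^sup>2 < 1" shows "\<not> P \<subseteq> cball x r"
proof
  assume "P \<subseteq> cball x r"
  then have "measure lebesgue P \<le> measure lebesgue (cball x r)"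
    using polygon.compact[OF polygon[OF P]] by (intro measure_mono_fmeasurable) (auto simp: lmeasurable_compact fmeasurableD)
  then show False using area[OF P] r by (simp add: content_cball unit_ball_vol_2)
qed

text \<open>The circle of radius \<rho> is connected and meets the tile. It is not contained in it,
  for then by convexity the whole disc, of area more than 1, would be; so it meets the
  frontier.\<close>

lemma frontier_norm:
  assumes P: "P \<in> T" and x: "x \<in> P" "norm x \<le> \<rho>" and y: "y \<in> P" "\<rho> \<le> norm y" and \<rho>: "1 \<le> \<rho>"
  shows "\<exists>z\<in>frontier P. norm z = \<rho>"
proof -
  have "connected (norm ` P)"
    using polygon.convex[OF polygon[OF P]] by (intro connected_continuous_image continuous_intros convex_connected)
  then have "\<rho> \<in> norm ` P" using x y connected_contains_Icc[of "norm ` P" "norm x" "norm y"] by auto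
  then have "sphere 0 \<rho> \<inter> P \<noteq> {}" by auto
  moreover have "sphere 0 \<rho> - P \<noteq> {}"
  proof
    assume "sphere 0 \<rho> - P = {}"
    then have "convex hull (sphere 0 \<rho>) \<subseteq> P"
      using polygon.convex[OF polygon[OF P]] by (intro hull_minimal) auto
    moreover have "convex hull (sphere 0 \<rho>) = cball (0::real^2) \<rho>"
      using Krein_Milman_frontier[of "cball (0::real^2) \<rho>"] \<rho> by (simp add: frontier_cball)
    ultimately have "measure lebesgue (cball (0::real^2) \<rho>) \<le> measure lebesgue P"
      using polygon.compact[OF polygon[OF P]] by (intro measure_mono_fmeasurable) (auto simp: lmeasurable_compact fmeasurableD)
    then have "pi * \<rho>\<^sup>2 \<le> 1" using area[OF P] \<rho> by (simp add: content_cball unit_ball_vol_2)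
    moreover have "1 \<le> \<rho>\<^sup>2" using \<rho> by (simp add: one_le_power)
    then have "pi * 1 \<le> pi * \<rho>\<^sup>2" by (intro mult_left_mono) auto
    ultimately show False using pi_ge_two by simp
  qed
  moreover have "connected (sphere (0::real^2) \<rho>)" by (rule connected_sphere) simp
  ultimately have "sphere 0 \<rho> \<inter> frontier P \<noteq> {}" using connected_Int_frontier by blast
  then show ?thesis by auto
qed

lemma hausdorff_norm_ge:
  assumes P: "P \<in> T" and x: "x \<in> P" "norm x \<le> a" and y: "y \<in> P" "a + 1/2 \<le> norm y" and a: "1 \<le> a"
    and B: "\<And>z. a \<le> norm z \<Longrightarrow> norm z \<le> a + 1/2 \<Longrightarrow> z \<in> B"
  shows "ennreal (1/2) \<le> hausdorff_length (frontier P \<inter> B)"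
proof -
  have "ennreal (a + 1/2 - a) \<le> hausdorff_length (frontier P \<inter> B)"
  proof (rule hausdorff_length_ge_Lipschitz_image[where f = norm])
    show "\<bar>norm u - norm v\<bar> \<le> dist u v" for u v :: "real^2" by (simp add: dist_norm norm_triangle_ineq3)
    show "{a..a + 1/2} \<subseteq> norm ` (frontier P \<inter> B)"
    proof
      fix \<rho> assume "\<rho> \<in> {a..a + 1/2}"
      then show "\<rho> \<in> norm ` (frontier P \<inter> B)" using frontier_norm[OF P x(1) _ y(1), of \<rho>] x y a B by force
    qed
  qed simp
  then show ?thesis by simp
qed

text \<open>A disc of radius \<open>1/2\<close> has area below 1, so the tile contains points more
  than \<open>1/2\<close> apart. Project onto the line through them: each perpendicular line in
  between meets the tile but is unbounded, so it meets the frontier.\<close>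

lemma hausdorff_frontier_ge:
  assumes P: "P \<in> T" shows "ennreal (1/2) \<le> hausdorff_length (frontier P)"
proof -
  interpret polygon P by (rule polygon[OF P])
  obtain x where x: "x \<in> P" using interior_nonempty interior_subset by blast
  have "\<not> P \<subseteq> cball x (1/2)" using pi_less_4 by (intro not_subset_small_cball[OF P]) (auto simp: power2_eq_square)
  then obtain y where y: "y \<in> P" "1/2 < dist x y" by force
  define u where "u = (1 / norm (y - x)) *\<^sub>R (y - x)"
  have yx: "y \<noteq> x" using y by auto
  then have nu: "norm u = 1" by (simp add: u_def)
  let ?f = "\<lambda>z. u \<bullet> (z - x)"
  have fy: "?f y = dist x y"
    using yx by (simp add: u_def dist_norm norm_minus_commute dot_square_norm power2_eq_square)
  have "ennreal (1/2 - 0) \<le> hausdorff_length (frontier P)"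
  proof (rule hausdorff_length_ge_Lipschitz_image[where f = ?f])
    show "\<bar>?f a - ?f b\<bar> \<le> dist a b" for a b
      using Cauchy_Schwarz_ineq2[of u "a - b"] nu by (simp add: dist_norm inner_diff_right)
    show "{0..1/2} \<subseteq> ?f ` frontier P"
    proof
      fix t :: real assume t: "t \<in> {0..1/2}"
      let ?H = "{z. u \<bullet> z = t + u \<bullet> x}"
      have "connected (?f ` P)" using convex by (intro connected_continuous_image continuous_intros convex_connected)
      moreover have "0 \<in> ?f ` P" "dist x y \<in> ?f ` P" using x y fy by (force intro: image_eqI[of _ _ x], force)
      ultimately have "t \<in> ?f ` P" using t y connected_contains_Icc[of "?f ` P" 0 "dist x y"] by auto
      then have "?H \<inter> P \<noteq> {}" by (auto simp: inner_diff_right)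
      moreover have "?H - P \<noteq> {}"
      proof
        assume "?H - P = {}"
        then have "bounded ?H" using bounded_subset[OF bounded, of ?H] by blast
        then show False using nu bounded_hyperplane_eq_trivial[of u "t + u \<bullet> x"] by (auto split: if_splits)
      qed
      moreover have "connected ?H" by (intro convex_connected convex_hyperplane)
      ultimately have "?H \<inter> frontier P \<noteq> {}" using connected_Int_frontier by blast
      then show "t \<in> ?f ` frontier P" by (force simp: inner_diff_right)
    qed
  qed simp
  then show ?thesis by simp
qed

text \<open>A tile that leaves the annulus spans a radial interval of length \<open>1/2\<close>
  inside it; a tile that stays inside contributes its whole frontier.\<close>

lemma crossing_length:
  assumes P: "P \<in> T" and R: "2 \<le> R" and x: "x \<in> P" "norm x \<le> R" and y: "y \<in> P" "R < norm y"
  shows "ennreal (1/2) \<le> hausdorff_length (frontier P \<inter> (cball 0 (R + 1) - cball 0 (R - 1)))"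
proof -
  let ?B = "cball 0 (R + 1) - cball (0::real^2) (R - 1)"
  consider x' where "x' \<in> P" "norm x' \<le> R - 1" | y' where "y' \<in> P" "R + 1 < norm y'" | "P \<subseteq> ?B" by force
  then show ?thesis
  proof cases
    case 1
    \<comment> \<open>The radii from \<open>R - 1/2\<close> to \<open>R\<close> are used, since
      radius \<open>R - 1\<close> itself belongs to the removed closed disc.\<close>
    then show ?thesis using R y by (intro hausdorff_norm_ge[OF P 1(1) _ y(1), of "R - 1/2"]) auto
  next
    case 2
    then show ?thesis using R x by (intro hausdorff_norm_ge[OF P x(1) _ 2(1), of "R"]) auto
  next
    case 3
    then have "frontier P \<inter> ?B = frontier P" using polygon.frontier_subset[OF polygon[OF P]] by blast
    then show ?thesis using hausdorff_frontier_ge[OF P] by simp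
  qed
qed

lemma meeting_length:
  assumes P: "P \<in> T" and R: "1 \<le> R" and x: "x \<in> P" "norm x \<le> R"
  shows "ennreal (1/2) \<le> hausdorff_length (frontier P \<inter> cball 0 (R + 1))"
proof (cases "P \<subseteq> cball 0 (R + 1)")
  case True
  then have "frontier P \<inter> cball 0 (R + 1) = frontier P" using polygon.frontier_subset[OF polygon[OF P]] by blast
  then show ?thesis using hausdorff_frontier_ge[OF P] by simp
next
  case False
  then obtain y where y: "y \<in> P" "R + 1 < norm y" by force
  then show ?thesis using R by (intro hausdorff_norm_ge[OF P x y(1)]) auto
qed

text \<open>Each tile meeting the disc has boundary at least \<open>1/2\<close> in the larger disc,
  where almost every point is counted at most twice; so there are at most four times as many tiles
  as there is length.\<close>

lemma locally_finite:
  assumes fin: "hausdorff_length (boundary \<inter> cball 0 (R + 1)) < top" and R: "1 \<le> R"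
  shows "finite {P\<in>T. P \<inter> cball 0 R \<noteq> {}}"
proof (rule ccontr)
  let ?M = "{P\<in>T. P \<inter> cball 0 R \<noteq> {}}"
  assume inf: "infinite ?M"
  obtain c where c: "0 \<le> c" "hausdorff_length (boundary \<inter> cball 0 (R + 1)) = ennreal c"
    using fin by (cases "hausdorff_length (boundary \<inter> cball 0 (R + 1))") auto
  obtain m :: nat where m: "4 * c < real m" using reals_Archimedean2 by blast
  obtain F where F: "F \<subseteq> ?M" "finite F" "card F = m" using infinite_arbitrarily_large[OF inf, of m] by blast
  have "(\<Sum>P\<in>F. ennreal (1/2)) \<le> (\<Sum>P\<in>F. hausdorff_length (frontier P \<inter> cball 0 (R + 1)))"
  proof (rule sum_mono)
    fix P assume "P \<in> F"
    then have "P \<in> ?M" using F(1) by blast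
    then obtain x where "P \<in> T" "x \<in> P" "norm x \<le> R" by auto
    then show "ennreal (1/2) \<le> hausdorff_length (frontier P \<inter> cball 0 (R + 1))" using meeting_length R by blast
  qed
  also have "\<dots> \<le> 2 * hausdorff_length (boundary \<inter> cball 0 (R + 1))"
    using F by (intro sum_frontier_le) auto
  also have "(\<Sum>P\<in>F. ennreal (1/2)) = ennreal (\<Sum>P\<in>F. 1/2)" by (rule sum_ennreal) simp
  also have "\<dots> = ennreal (real m * (1/2))" using F(3) by simp
  also have "2 * hausdorff_length (boundary \<inter> cball 0 (R + 1)) = ennreal (2 * c)" using c by (simp add: ennreal_mult)
  finally have "ennreal (real m * (1/2)) \<le> ennreal (2 * c)" .
  then show False using m c by simp
qed

end

section \<open>Summing the corner weights over vertices of the tiling\<close>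

locale finite_length_tiling = unit_tiling +
  assumes fin_length: "hausdorff_length (boundary \<inter> cball 0 R) < top"
    and sides: "P \<in> T \<Longrightarrow> num_sides P \<le> 5"
begin

definition len :: "real \<Rightarrow> real" where "len R = enn2real (hausdorff_length (boundary \<inter> cball 0 R))"

lemma len: "hausdorff_length (boundary \<inter> cball 0 R) = ennreal (len R)"
  using fin_length[of R] by (simp add: len_def less_top)

lemma len_nonneg: "0 \<le> len R"
  by (simp add: len_def)

lemma meeting_finite: "finite {P\<in>T. P \<inter> cball x r \<noteq> {}}"
proof (rule finite_subset)
  let ?R = "max 1 (norm x + r)"
  show "finite {P\<in>T. P \<inter> cball 0 ?R \<noteq> {}}" by (rule locally_finite[OF fin_length]) simp
  have "cball x r \<subseteq> cball 0 ?R"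
  proof
    fix y assume "y \<in> cball x r"
    then show "y \<in> cball 0 ?R" using norm_triangle_sub[of y x] by (simp add: dist_norm norm_minus_commute)
  qed
  then show "{P\<in>T. P \<inter> cball x r \<noteq> {}} \<subseteq> {P\<in>T. P \<inter> cball 0 ?R \<noteq> {}}" by blast
qed

lemma card_V: "P \<in> T \<Longrightarrow> card (vertices P) \<le> 5"
  using sides polygon.num_sides_eq[OF polygon] by metis

text \<open>Selects the tangent point of the weights. At every other vertex the mean corner angle
  turns out to be at most \<open>pi / 2\<close>.\<close>

definition triple :: "real^2 \<Rightarrow> bool" where
  "triple v \<longleftrightarrow> card {P\<in>T. v \<in> P} = 3 \<and> (\<forall>P\<in>T. v \<in> P \<longrightarrow> v \<in> vertices P)"

abbreviation "weight v P \<equiv> corner_weight (triple v) (angle_at P v)"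

lemma tiles_at_finite: "finite {P\<in>T. v \<in> P}"
  by (rule finite_subset[OF _ meeting_finite[of v 1]]) auto

lemma vertex_facts:
  assumes v: "Q \<in> T" "v \<in> vertices Q"
  defines "K \<equiv> {P\<in>T. v \<in> P}" and "C \<equiv> {P\<in>T. v \<in> vertices P}"
  shows "C \<subseteq> K" "finite K" "(\<Sum>P\<in>C. angle_at P v) + pi * real (card (K - C)) = 2*pi"
    "\<And>P. P \<in> C \<Longrightarrow> 0 < angle_at P v \<and> angle_at P v < pi"
proof -
  show CK: "C \<subseteq> K" using polygon.V_subset[OF polygon] by (auto simp: C_def K_def)
  show K: "finite K" unfolding K_def by (rule tiles_at_finite)
  show ang: "0 < angle_at P v \<and> angle_at P v < pi" if "P \<in> C" for P
    using that polygon.vertex_angle[OF polygon] by (auto simp: C_def)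
  have flat: "has_angle P v pi" if P: "P \<in> K - C" for P
  proof -
    have PT: "P \<in> T" "v \<in> P" "v \<notin> vertices P" "P \<noteq> Q" using P v by (auto simp: K_def C_def)
    have "v \<in> Q" using polygon.V_subset[OF polygon] v by blast
    then have "v \<in> frontier P" using Int_frontier[OF PT(1) v(1) PT(4)] PT by blast
    then show ?thesis using polygon.angle_edge[OF polygon] PT by blast
  qed
  let ?a = "\<lambda>P. if P \<in> C then angle_at P v else pi"
  have "(\<Sum>P\<in>K. ?a P) = 2*pi"
    unfolding K_def
  proof (rule angle_sum_eq[OF meeting_finite zero_less_one])
    fix P assume "P \<in> T" "v \<in> P"
    then show "has_angle P v (?a P)" using flat[of P] polygon.vertex_angle(1)[OF polygon, of P v]
      by (auto simp: C_def K_def)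
  qed
  moreover have "(\<Sum>P\<in>K. ?a P) = (\<Sum>P\<in>C. ?a P) + (\<Sum>P\<in>K - C. ?a P)"
    using sum.subset_diff[OF CK K, of ?a] by (simp add: add.commute)
  ultimately show "(\<Sum>P\<in>C. angle_at P v) + pi * real (card (K - C)) = 2*pi"
    by (simp add: mult.commute)
qed

text \<open>At a triple point the three angles sum to \<open>2 * pi\<close> and the weights cancel.
  Elsewhere \<open>slope - 1\<close> is negative, so the mean corner must be at most
  \<open>pi / 2\<close>. If no side passes through \<open>v\<close>, angles below \<open>pi\<close>
  with sum \<open>2 * pi\<close> number at least three, and three is excluded; if one does, at least
  two corners share the angle \<open>pi\<close>.\<close>

lemma weight_vertex_nonneg:
  assumes v: "Q \<in> T" "v \<in> vertices Q"
  shows "0 \<le> (\<Sum>P\<in>{P\<in>T. v \<in> vertices P}. weight v P)"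
proof -
  let ?K = "{P\<in>T. v \<in> P}" and ?C = "{P\<in>T. v \<in> vertices P}"
  note vf = vertex_facts[OF v]
  have finC: "finite ?C" by (rule finite_subset[OF vf(1,2)])
  have Cne: "?C \<noteq> {}" using v by blast
  let ?s = "\<Sum>P\<in>?C. angle_at P v"
  have s0: "0 < ?s" using vf(4) by (intro sum_pos finC Cne) auto
  have "?s < (\<Sum>P\<in>?C. pi)" using vf(4) by (intro sum_strict_mono finC Cne) auto
  then have s1: "?s < real (card ?C) * pi" by simp
  show ?thesis
  proof (cases "triple v")
    case True
    then have CK: "?C = ?K" "card ?K = 3" using vf(1) by (auto simp: triple_def)
    then have "?s = 2*pi" using vf(3) by simp
    then show ?thesis using True CK by (simp add: corner_weight_def sum_subtractf flip: sum_distrib_left)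
  next
    case False
    have "?s \<le> real (card ?C) * (pi/2)"
    proof -
      \<comment> \<open>Two tiles with \<open>v\<close> inside a side would use up the full angle
        and leave nothing for the corner of \<open>Q\<close>.\<close>
      have "pi * real (card (?K - ?C)) < pi * 2" using vf(3) s0 by linarith
      then have "card (?K - ?C) < 2" by (simp only: mult_less_cancel_left_pos[OF pi_gt_zero] of_nat_less_numeral_iff)
      then consider "card (?K - ?C) = 0" | "card (?K - ?C) = 1" by linarith
      then show ?thesis
      proof cases
        case 1
        then have s: "?s = 2*pi" using vf(3) by simp
        have KC: "?C = ?K" using 1 vf(1,2) by auto
        have "2 * pi < real (card ?C) * pi" using s s1 by simp
        then have "2 < real (card ?C)" by (simp only: mult_less_cancel_right_pos[OF pi_gt_zero])
        moreover have "card ?C \<noteq> 3" using False KC by (auto simp: triple_def)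
        ultimately have "4 \<le> real (card ?C)" by linarith
        then have "4 * (pi/2) \<le> real (card ?C) * (pi/2)" by (intro mult_right_mono) auto
        then show ?thesis using s by simp
      next
        case 2
        then have s: "?s = pi" using vf(3) by simp
        have "1 * pi < real (card ?C) * pi" using s s1 by simp
        then have "1 < real (card ?C)" by (simp only: mult_less_cancel_right_pos[OF pi_gt_zero])
        then have "Suc 1 \<le> card ?C" by simp
        then have "2 \<le> real (card ?C)" by simp
        then have "2 * (pi/2) \<le> real (card ?C) * (pi/2)" by (intro mult_right_mono) auto
        then show ?thesis using s by simp
      qed
    qed
    then have "0 \<le> (slope - 1) * (?s - real (card ?C) * (pi/2))"
      using slope_bounds by (intro mult_nonpos_nonpos) auto
    then show ?thesis using False by (simp add: corner_weight_def sum_subtractf flip: sum_distrib_left)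
  qed
qed

text \<open>For vertices where only some of the tiles are counted. The deviation of the angle sum
  that can count negatively is at most \<open>2 * pi < 8\<close>, and
  \<open>8 * 27/100 < 3\<close>.\<close>

lemma weight_vertex_ge:
  assumes v: "Q \<in> T" "v \<in> vertices Q" and F: "F \<subseteq> {P\<in>T. v \<in> vertices P}"
  shows "-3 \<le> (\<Sum>P\<in>F. weight v P)"
proof -
  let ?K = "{P\<in>T. v \<in> P}" and ?C = "{P\<in>T. v \<in> vertices P}"
  note vf = vertex_facts[OF v]
  have finC: "finite ?C" by (rule finite_subset[OF vf(1,2)])
  have FK: "F \<subseteq> ?K" using F vf(1) by (rule order.trans)
  let ?s = "\<Sum>P\<in>F. angle_at P v"
  have s0: "0 \<le> ?s" using vf(4) F by (intro sum_nonneg) force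
  have "?s \<le> (\<Sum>P\<in>?C. angle_at P v)" using vf(4) F by (intro sum_mono2 finC) force+
  also have "\<dots> \<le> 2*pi" using vf(3) by (smt (verit) mult_nonneg_nonneg of_nat_0_le_iff pi_ge_zero)
  finally have s1: "?s \<le> 2*pi" .
  show ?thesis
  proof (cases "triple v")
    case True
    then have "card F \<le> 3" using card_mono[OF vf(2) FK] by (simp add: triple_def)
    then have "real (card F) * (2*pi/3) \<le> 3 * (2*pi/3)" by (intro mult_right_mono) auto
    then have "- 8 \<le> ?s - real (card F) * (2*pi/3)" using s0 pi_less_4 by linarith
    then have "(slope - 2/3) * (-8) \<le> (slope - 2/3) * (?s - real (card F) * (2*pi/3))"
      using slope_bounds by (intro mult_left_mono) auto
    then show ?thesis using True slope_bounds by (simp add: corner_weight_def sum_subtractf flip: sum_distrib_left)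
  next
    case False
    have "?s - real (card F) * (pi/2) \<le> 8" using s1 pi_less_4 by (smt (verit) divide_nonneg_nonneg mult_nonneg_nonneg of_nat_0_le_iff pi_ge_zero)
    then have "(slope - 1) * 8 \<le> (slope - 1) * (?s - real (card F) * (pi/2))"
      using slope_bounds by (intro mult_left_mono_neg) auto
    then show ?thesis using False slope_bounds by (simp add: corner_weight_def sum_subtractf flip: sum_distrib_left)
  qed
qed

text \<open>\<open>n\<close> counts the tiles that meet the disc without lying inside it. They are
  missing from the full tiles and affect at most \<open>5 * n\<close> vertices, each costing at most
  3. With \<open>1 \<le> c0 \<le> 2\<close> the loss in half perimeter is at most
  \<open>(2 + 15/2) * n\<close>.\<close>

lemma len_ge:
  assumes R: "2 \<le> R"
  obtains n where "0 \<le> n" "n \<le> 4 * (len (R + 1) - len (R - 1))" "c0 * pi * R\<^sup>2 - 10 * n \<le> len R"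
proof -
  define M where "M = {P\<in>T. P \<inter> cball 0 R \<noteq> {}}"
  define F where "F = {P\<in>M. P \<subseteq> cball 0 R}"
  define N where "N = M - F"
  have M: "finite M" "M \<subseteq> T" unfolding M_def by (rule meeting_finite) auto
  then have F: "finite F" "F \<subseteq> T" and N: "finite N" "N \<subseteq> T" by (auto simp: F_def N_def)
  define n where "n = real (card N)"
  have n_len: "n \<le> 4 * (len (R + 1) - len (R - 1))"
  proof -
    let ?B = "cball 0 (R + 1) - cball (0::real^2) (R - 1)"
    have "(\<Sum>P\<in>N. ennreal (1/2)) \<le> (\<Sum>P\<in>N. hausdorff_length (frontier P \<inter> ?B))"
    proof (rule sum_mono)
      fix P assume "P \<in> N"
      then have "P \<in> T" "P \<inter> cball 0 R \<noteq> {}" "\<not> P \<subseteq> cball 0 R" by (auto simp: N_def F_def M_def)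
      then obtain x y where "P \<in> T" "x \<in> P" "norm x \<le> R" "y \<in> P" "R < norm y" by force
      then show "ennreal (1/2) \<le> hausdorff_length (frontier P \<inter> ?B)" using crossing_length R by blast
    qed
    also have "\<dots> \<le> 2 * hausdorff_length (boundary \<inter> ?B)" by (intro sum_frontier_le N) auto
    also have "(\<Sum>P\<in>N. ennreal (1/2)) = ennreal (\<Sum>P\<in>N. 1/2)" by (rule sum_ennreal) simp
    also have "\<dots> = ennreal (n / 2)" by (simp add: n_def)
    finally have 1: "ennreal (n / 2) \<le> 2 * hausdorff_length (boundary \<inter> ?B)" .
    let ?E = "boundary \<inter> cball 0 (R + 1)"
    have "hausdorff_length (?E \<inter> cball 0 (R - 1)) + hausdorff_length (?E - cball 0 (R - 1)) \<le> hausdorff_length ?E"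
      by (rule caratheodory_closed) simp
    moreover have "?E \<inter> cball 0 (R - 1) = boundary \<inter> cball 0 (R - 1)" "?E - cball 0 (R - 1) = boundary \<inter> ?B"
      by auto
    ultimately have 2: "ennreal (len (R - 1)) + hausdorff_length (boundary \<inter> ?B) \<le> ennreal (len (R + 1))"
      by (simp add: len)
    then have "hausdorff_length (boundary \<inter> ?B) < top"
      by (metis add_top_right_ennreal ennreal_less_top less_top neq_top_trans top.not_eq_extremum)
    then obtain b where b: "0 \<le> b" "hausdorff_length (boundary \<inter> ?B) = ennreal b"
      by (cases "hausdorff_length (boundary \<inter> ?B)") auto
    have "len (R - 1) + b \<le> len (R + 1)"
      using 2 b len_nonneg by (simp add: b(2) flip: ennreal_plus)
    moreover have "ennreal (n / 2) \<le> ennreal (2 * b)" using 1 b by (simp add: ennreal_mult)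
    then have "n / 2 \<le> 2 * b" using b by simp
    ultimately show ?thesis by simp
  qed
  have areaF: "pi * R\<^sup>2 \<le> real (card F) + n"
  proof -
    have "cball 0 R \<subseteq> \<Union>M"
    proof
      fix x :: "real^2" assume x: "x \<in> cball 0 R"
      obtain P where "P \<in> T" "x \<in> P" using cover by blast
      then have "P \<in> M" using x unfolding M_def by blast
      then show "x \<in> \<Union>M" using \<open>x \<in> P\<close> by blast
    qed
    then have "\<Union>M \<inter> cball 0 R = cball 0 R" by (rule Int_absorb1)
    then have "pi * R\<^sup>2 = (\<Sum>P\<in>M. measure lebesgue (P \<inter> cball 0 R))"
      using measure_tiles_cball[OF M, of 0 R] R by (simp add: content_cball unit_ball_vol_2)
    also have "\<dots> \<le> (\<Sum>P\<in>M. 1)"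
    proof (rule sum_mono)
      fix P assume "P \<in> M"
      then have P: "P \<in> T" using M by blast
      have "measure lebesgue (P \<inter> cball 0 R) \<le> measure lebesgue P"
        using polygon.compact[OF polygon[OF P]]
        by (intro measure_mono_fmeasurable) (auto simp: lmeasurable_compact compact_Int fmeasurableD)
      then show "measure lebesgue (P \<inter> cball 0 R) \<le> 1" using area[OF P] by simp
    qed
    also have "\<dots> = real (card F) + n"
      using card_Diff_subset[OF F(1), of M] card_mono[OF M(1), of F] by (simp add: n_def N_def F_def)
    finally show ?thesis .
  qed
  have perF: "(\<Sum>P\<in>F. perimeter P) \<le> 2 * len R"
  proof -
    have "(\<Sum>P\<in>F. ennreal (perimeter P)) = (\<Sum>P\<in>F. hausdorff_length (frontier P \<inter> cball 0 R))"
    proof (rule sum.cong[OF refl])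
      fix P assume "P \<in> F"
      then have P: "P \<in> T" "P \<subseteq> cball 0 R" using F by (auto simp: F_def)
      then have "frontier P \<inter> cball 0 R = frontier P" using polygon.frontier_subset[OF polygon] by blast
      then show "ennreal (perimeter P) = hausdorff_length (frontier P \<inter> cball 0 R)"
        using polygon.hausdorff_frontier[OF polygon[OF P(1)]] by simp
    qed
    also have "\<dots> \<le> 2 * hausdorff_length (boundary \<inter> cball 0 R)" by (intro sum_frontier_le F) auto
    finally have "ennreal (\<Sum>P\<in>F. perimeter P) \<le> ennreal (2 * len R)"
      using len_nonneg by (simp add: len ennreal_mult sum_ennreal perimeter_def sum_nonneg)
    then show ?thesis using len_nonneg by simp
  qed
  define G where "G = (\<Sum>P\<in>F. \<Sum>v\<in>vertices P. weight v P)"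
  \<comment> \<open>Regrouped by vertex: where no crossing tile has a corner, all corners at the
    vertex belong to \<open>F\<close> and their weights are nonnegative in total; elsewhere the
    total is at least \<open>-3\<close>.\<close>
  have G: "- 15 * n \<le> G"
  proof -
    let ?W = "\<Union>P\<in>F. vertices P" and ?B = "\<Union>P\<in>N. vertices P"
    have finV: "finite (vertices P)" if "P \<in> T" for P using polygon.finite_V[OF polygon[OF that]] .
    have W: "finite ?W" "finite ?B" using F N finV by auto
    have "G = (\<Sum>P\<in>F. \<Sum>v\<in>{v\<in>?W. v \<in> vertices P}. weight v P)"
      unfolding G_def by (intro sum.cong) auto
    also have "\<dots> = (\<Sum>v\<in>?W. \<Sum>P\<in>{P\<in>F. v \<in> vertices P}. weight v P)"
      using sum.swap_restrict[OF F(1) W(1), of "\<lambda>P v. weight v P" "\<lambda>P v. v \<in> vertices P"] .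
    finally have Gv: "G = (\<Sum>v\<in>?W. \<Sum>P\<in>{P\<in>F. v \<in> vertices P}. weight v P)" .
    have "(\<Sum>v\<in>?W. if v \<in> ?B then -3 else 0) \<le> G"
      unfolding Gv
    proof (rule sum_mono)
      fix v assume "v \<in> ?W"
      then obtain Q where Q: "Q \<in> F" "v \<in> vertices Q" by blast
      show "(if v \<in> ?B then -3 else 0) \<le> (\<Sum>P\<in>{P\<in>F. v \<in> vertices P}. weight v P)"
      proof (cases "v \<in> ?B")
        case True
        then show ?thesis using Q F weight_vertex_ge[of Q v "{P\<in>F. v \<in> vertices P}"] by auto
      next
        case False
        have "Q \<in> T" "Q \<subseteq> cball 0 R" using Q(1) F(2) by (auto simp: F_def)
        then have vR: "v \<in> cball 0 R" using polygon.V_subset[OF polygon] Q(2) by blast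
        have "{P\<in>T. v \<in> vertices P} \<subseteq> M"
        proof
          fix P assume "P \<in> {P\<in>T. v \<in> vertices P}"
          then have "P \<in> T" "v \<in> P" using polygon.V_subset[OF polygon, of P] by auto
          then show "P \<in> M" unfolding M_def using vR by blast
        qed
        then have "{P\<in>T. v \<in> vertices P} = {P\<in>F. v \<in> vertices P}" using False F by (auto simp: N_def)
        then show ?thesis using False Q F weight_vertex_nonneg[of Q v] by auto
      qed
    qed
    moreover have "(\<Sum>v\<in>?W. if v \<in> ?B then -3 else 0) = -3 * real (card (?W \<inter> ?B))"
      unfolding sum.inter_restrict[OF W(1), symmetric] by simp
    moreover have "card (?W \<inter> ?B) \<le> card ?B" using W by (intro card_mono) auto
    moreover have "card ?B \<le> 5 * card N"
      using card_UN_le[OF N(1), of vertices] sum_bounded_above[of N "\<lambda>P. card (vertices P)" 5] card_V N by fastforce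
    ultimately show ?thesis unfolding n_def by linarith
  qed
  have c0: "1 \<le> c0" "c0 \<le> 2" using sqrt3_bounds by (auto simp: c0_def intro!: real_le_lsqrt)
  have "(\<Sum>P\<in>F. 2 * c0 + (\<Sum>v\<in>vertices P. weight v P) / c0) \<le> (\<Sum>P\<in>F. perimeter P)"
  proof (rule sum_mono)
    fix P assume "P \<in> F"
    then have "P \<in> T" using F by blast
    then show "2 * c0 + (\<Sum>v\<in>vertices P. weight v P) / c0 \<le> perimeter P"
      using polygon.perimeter_ge[OF polygon] card_V area by blast
  qed
  then have "2 * c0 * real (card F) + G / c0 \<le> 2 * len R"
    using perF by (simp add: sum.distrib G_def sum_divide_distrib mult.commute)
  moreover have "- 15 * n \<le> G / c0"
  proof -
    have n0: "0 \<le> n" by (simp add: n_def)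
    have "- 15 * n * c0 \<le> - 15 * n * 1" using n0 c0 by (intro mult_left_mono_neg) auto
    then show ?thesis using G c0 by (simp add: pos_le_divide_eq)
  qed
  moreover have "2 * c0 * (pi * R\<^sup>2 - n) \<le> 2 * c0 * real (card F)" using areaF c0 by (intro mult_left_mono) auto
  moreover have "c0 * n \<le> 2 * n" using c0 by (intro mult_right_mono) (auto simp: n_def)
  ultimately have "c0 * pi * R\<^sup>2 - 10 * n \<le> len R" by (simp add: algebra_simps n_def)
  then show ?thesis using that[of n] n_len by (simp add: n_def)
qed

end

text \<open>Increments of quadratic size over steps of length 2 accumulate to cubic growth. This
  replaces a selection of radii with few crossing tiles.\<close>

lemma no_cubic_growth:
  fixes f :: "real \<Rightarrow> real"
  assumes e: "0 < e" and R: "0 \<le> r" and f0: "\<And>x. 0 \<le> f x"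
    and up: "\<And>x. r \<le> x \<Longrightarrow> f x \<le> C * x\<^sup>2" and step: "\<And>x. r + 1 \<le> x \<Longrightarrow> e * x\<^sup>2 \<le> f (x + 1) - f (x - 1)"
  shows False
proof -
  have low: "e * real k ^ 3 \<le> f (r + 2 * real k)" for k
  proof (induction k)
    case (Suc k)
    let ?x = "r + 2 * real k + 1"
    have "e * (2 * real k + 1)\<^sup>2 \<le> e * ?x\<^sup>2" using e R by (intro mult_left_mono power_mono) auto
    also have "\<dots> \<le> f (?x + 1) - f (?x - 1)" by (rule step) simp
    finally have "e * (2 * real k + 1)\<^sup>2 + e * real k ^ 3 \<le> f (r + 2 * real (Suc k))" using Suc by (simp add: algebra_simps)
    moreover have "e * real (Suc k) ^ 3 \<le> e * ((2 * real k + 1)\<^sup>2 + real k ^ 3)"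
      using e by (intro mult_left_mono) (auto simp: power2_eq_square power3_eq_cube algebra_simps)
    ultimately show ?case by (simp add: algebra_simps)
  qed (simp add: f0)
  have C0: "0 \<le> C"
  proof -
    have "0 \<le> C * (r + 1)\<^sup>2" using up[of "r + 1"] f0[of "r + 1"] by simp
    then show ?thesis using R by (simp add: zero_le_mult_iff)
  qed
  obtain k :: nat where k: "r + 1 + 9 * C / e < real k" using reals_Archimedean2 by blast
  have "0 \<le> 9 * C / e" using C0 e by simp
  then have k0: "r \<le> real k" "0 < real k" "9 * C / e < real k" using k R by linarith+
  have "e * real k ^ 3 \<le> C * (r + 2 * real k)\<^sup>2" using low[of k] up[of "r + 2 * real k"] by simp
  also have "\<dots> \<le> C * (3 * real k)\<^sup>2" using C0 k0 R by (intro mult_left_mono power_mono) auto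
  finally have "(e * real k) * (real k)\<^sup>2 \<le> (9 * C) * (real k)\<^sup>2" by (simp add: power2_eq_square power3_eq_cube algebra_simps)
  then have "e * real k \<le> 9 * C" using k0 by simp
  then show False using k0(3) e by (simp add: field_simps)
qed

text \<open>If the ratio were below \<open>c1 < c0\<close>, lengths in discs would be finite and at
  most \<open>c1 * pi * R\<^sup>2\<close> for large \<open>R\<close>. Then \<open>len_ge\<close>
  forces quadratically many crossing tiles at every large radius, hence an increment of length of
  that order.\<close>

theorem perimeter_ratio_ge:
  assumes T: "tiling T" and tiles: "\<And>P. P \<in> T \<Longrightarrow> convex_polygon P \<and> measure lebesgue P = 1 \<and> num_sides P \<le> 5"
  shows "ennreal c0 \<le> perimeter_ratio T"
proof (rule ccontr)
  interpret unit_tiling T by unfold_locales (use T tiles in auto)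
  let ?L = "\<lambda>R. hausdorff_length (boundary \<inter> cball 0 R)"
  assume "\<not> ennreal c0 \<le> perimeter_ratio T"
  then have "perimeter_ratio T < ennreal c0" by simp
  then obtain c where c: "perimeter_ratio T < c" "c < ennreal c0" using dense by blast
  then obtain c1 where c1: "0 \<le> c1" "c = ennreal c1" by (cases c) auto
  have c10: "c1 < c0" using c c1 by (simp add: ennreal_less_iff)
  have "\<forall>\<^sub>F R in at_top. ?L R / ennreal (pi * R\<^sup>2) < c"
    using c(1) unfolding perimeter_ratio_def boundary_def by (rule Limsup_lessD)
  then obtain R0 where R0: "\<And>R. R0 \<le> R \<Longrightarrow> ?L R / ennreal (pi * R\<^sup>2) < ennreal c1"
    unfolding eventually_at_top_linorder c1 by blast
  define r where "r = max 1 R0"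
  have up: "?L R \<le> ennreal (c1 * (pi * R\<^sup>2))" if "r \<le> R" for R
  proof -
    have p: "0 < pi * R\<^sup>2" using that by (auto simp: r_def)
    have "?L R / ennreal (pi * R\<^sup>2) \<le> ennreal c1" using R0[of R] that by (simp add: r_def less_imp_le)
    then have "?L R / ennreal (pi * R\<^sup>2) * ennreal (pi * R\<^sup>2) \<le> ennreal c1 * ennreal (pi * R\<^sup>2)"
      by (rule mult_right_mono) simp
    moreover have "?L R / ennreal (pi * R\<^sup>2) * ennreal (pi * R\<^sup>2) = ?L R"
    proof -
      have "ennreal (pi * R\<^sup>2) / ennreal (pi * R\<^sup>2) = 1" by (rule ennreal_divide_self) (use p in auto)
      then show ?thesis by (simp only: ennreal_divide_times mult_1_right)
    qed
    ultimately show ?thesis using c1 by (simp add: ennreal_mult)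
  qed
  have fin: "?L R < top" for R
  proof -
    have "?L R \<le> ?L (max r R)" by (intro hausdorff_length_mono) auto
    also have "\<dots> < top" using up[of "max r R"] by (simp add: order.strict_trans1)
    finally show ?thesis .
  qed
  interpret finite_length_tiling T by unfold_locales (use fin tiles in auto)
  \<comment> \<open>The 40 is the loss factor 10 times the factor 4 between crossing tiles and
    length, both from \<open>len_ge\<close>.\<close>
  define e where "e = (c0 - c1) * pi / 40"
  show False
  proof (rule no_cubic_growth[of e "r + 1" len "c1 * pi"])
    show "0 < e" using c10 by (simp add: e_def)
    show "0 \<le> r + 1" by (simp add: r_def)
    show "0 \<le> len x" for x by (rule len_nonneg)
    have len_up: "len x \<le> c1 * pi * x\<^sup>2" if "r \<le> x" for x
      using up[OF that] c1 by (simp add: len mult.assoc)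
    then show "len x \<le> c1 * pi * x\<^sup>2" if "r + 1 \<le> x" for x using that by simp
    show "e * x\<^sup>2 \<le> len (x + 1) - len (x - 1)" if x: "r + 1 + 1 \<le> x" for x
    proof -
      have "2 \<le> x" using x by (simp add: r_def)
      then obtain n where n: "0 \<le> n" "n \<le> 4 * (len (x + 1) - len (x - 1))" "c0 * pi * x\<^sup>2 - 10 * n \<le> len x"
        using len_ge by blast
      have "c0 * pi * x\<^sup>2 - 10 * n \<le> c1 * pi * x\<^sup>2" using n(3) len_up[of x] x by simp
      then have "(c0 - c1) * pi * x\<^sup>2 \<le> 10 * n" by (simp add: algebra_simps)
      then show ?thesis using n(2) by (simp add: e_def)
    qed
  qed
qed

section \<open>A tiling by Prismatic pentagons\<close>

lemma ccw_pentagon: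
  assumes v: "\<And>i j. i < 5 \<Longrightarrow> j < 5 \<Longrightarrow> j \<noteq> i \<Longrightarrow> j \<noteq> Suc i mod 5 \<Longrightarrow>
      0 < cross2 (v (Suc i mod 5) - v i) (v j - v i)"
    and inj: "inj_on v {..<5::nat}"
  defines "P \<equiv> convex hull (v ` {..<5})"
  shows "polygon P" "vertices P = v ` {..<5}" "\<And>i. i < 5 \<Longrightarrow> next_vertex P (v i) = v (Suc i mod 5)"
proof -
  have "0 < cross2 (v (Suc 0 mod 5) - v 0) (v 2 - v 0)" by (rule v) auto
  then have pos: "0 < cross2 (v 1 - v 0) (v 2 - v 0)" by (simp del: cross2_simps)
  have "convex hull {v 0, v 1, v 2} \<subseteq> P" unfolding P_def by (rule hull_mono) auto
  moreover have "0 < measure lebesgue (convex hull {v 0, v 1, v 2})"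
    using pos by (simp add: measure_triangle del: cross2_simps)
  then have "interior (convex hull {v 0, v 1, v 2}) \<noteq> {}"
    using negligible_convex_interior[of "convex hull {v 0, v 1, v 2}"] by (auto dest: negligible_imp_measure0)
  ultimately have "interior P \<noteq> {}" using interior_mono by blast
  then show pP: "polygon P" by unfold_locales (simp add: convex_polygon_def P_def polytope_convex_hull)
  interpret polygon P by (rule pP)
  have left: "P \<subseteq> {x. 0 \<le> cross2 (v (Suc i mod 5) - v i) (x - v i)}" if i: "i < 5" for i
    unfolding P_def
  proof (intro hull_minimal convex_cross2_halfspace image_subsetI CollectI)
    fix j assume j: "j \<in> {..<5::nat}"
    consider "j = i" | "j = Suc i mod 5" | "j \<noteq> i" "j \<noteq> Suc i mod 5" by blast
    then show "0 \<le> cross2 (v (Suc i mod 5) - v i) (v j - v i)"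
    proof cases
      case 3
      then show ?thesis using v[OF i] j by (intro less_imp_le) auto
    qed simp_all
  qed
  have ext: "v i \<in> V" if i: "i < 5" for i
  proof -
    define k where "k = (i + 4) mod 5"
    have k: "k < 5" "Suc k mod 5 = i" using i unfolding k_def by (simp, presburger)
    have ki: "k \<noteq> Suc i mod 5" using i unfolding k_def by presburger
    have kk: "k \<noteq> i" using i unfolding k_def by presburger
    let ?W = "v ` ({..<5} - {i})"
    \<comment> \<open>The direction from the predecessor of \<open>v i\<close> to its successor: the
      line through \<open>v i\<close> in this direction has all other points strictly on its
      left.\<close>
    let ?a = "(v (Suc i mod 5) - v i) + (v i - v k)"
    have "v j \<in> {x. 0 < cross2 ?a (x - v i)}" if j: "j < 5" "j \<noteq> i" for j
    proof -
      have n1: "0 < cross2 (v (Suc i mod 5) - v i) (v j - v i)" if "j \<noteq> Suc i mod 5" by (rule v[OF i j that])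
      have n1': "0 \<le> cross2 (v (Suc i mod 5) - v i) (v j - v i)"
        by (cases "j = Suc i mod 5") (use n1 in \<open>simp_all del: cross2_simps(1-8)\<close>)
      have e: "cross2 (v i - v k) (v j - v i) = cross2 (v i - v k) (v j - v k)" by (simp add: cross2_def algebra_simps)
      have n2: "0 < cross2 (v i - v k) (v j - v i)" if "j \<noteq> k" using v[OF k(1) j(1) that] k(2) j(2) unfolding e by (simp del: cross2_simps)
      have n2': "0 \<le> cross2 (v i - v k) (v j - v i)"
        by (cases "j = k") (use n2 e in \<open>simp_all del: cross2_simps(1-8)\<close>)
      have "0 < cross2 (v (Suc i mod 5) - v i) (v j - v i) + cross2 (v i - v k) (v j - v i)"
        using n1 n1' n2 n2' ki by (cases "j = k") (auto simp del: cross2_simps)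
      then show ?thesis by (simp only: cross2_simps(1) mem_Collect_eq)
    qed
    then have "?W \<subseteq> {x. 0 < cross2 ?a (x - v i)}" by auto
    moreover have "convex {x. 0 < cross2 ?a (x - v i)}"
      by (simp only: cross2_eq_inner inner_diff_right diff_gt_0_iff_gt convex_halfspace_gt)
    ultimately have "convex hull ?W \<subseteq> {x. 0 < cross2 ?a (x - v i)}" by (rule hull_minimal)
    then have "v i \<notin> convex hull ?W" by auto
    then have "v i extreme_point_of convex hull (insert (v i) ?W)" by (intro extreme_point_of_convex_hull_insert) auto
    moreover have "insert (v i) ?W = v ` {..<5}" using i by auto
    ultimately show ?thesis by (simp add: vertices_def P_def)
  qed
  show VV: "V = v ` {..<5}"
  proof
    show "V \<subseteq> v ` {..<5}" unfolding vertices_def P_def by (rule extreme_points_of_convex_hull)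
  qed (use ext in auto)
  show "nxt (v i) = v (Suc i mod 5)" if i: "i < 5" for i
  proof (rule nxt_eqI)
    show "v i \<in> V" "v (Suc i mod 5) \<in> V" using ext i by simp_all
    have "Suc i mod 5 \<noteq> i" using i by presburger
    then show "v (Suc i mod 5) \<noteq> v i" using inj_on_eq_iff[OF inj, of "Suc i mod 5" i] i by simp
    show "0 \<le> cross2 (v (Suc i mod 5) - v i) (x - v i)" if "x \<in> P" for x using left[OF i] that by blast
  qed
qed

lemma all_less_5: "(\<forall>i<5. Q i) \<longleftrightarrow> Q 0 \<and> Q 1 \<and> Q 2 \<and> Q 3 \<and> Q (4::nat)"
  by (auto simp: eval_nat_numeral less_Suc_eq)

lemma lessThan_5: "{..<5} = {0, 1, 2, 3, 4::nat}"
  by (auto simp: eval_nat_numeral less_Suc_eq)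

lemma all_less_5_next:
  "(\<forall>i<5. Q i (Suc i mod 5)) \<longleftrightarrow> Q 0 1 \<and> Q 1 2 \<and> Q 2 3 \<and> Q 3 4 \<and> Q (4::nat) (0::nat)"
proof -
  have m: "Suc 0 mod 5 = 1" "Suc 1 mod 5 = 2" "Suc 2 mod 5 = 3" "Suc 3 mod 5 = 4" "Suc 4 mod 5 = (0::nat)"
    by simp_all
  show ?thesis unfolding all_less_5 m ..
qed

text \<open>This is \<open>cot (pi / 3)\<close>, the tangent length at a corner of angle
  \<open>2 * pi / 3\<close> for inradius 1, and also the steepness of the two roof sides.\<close>

definition kap :: real where "kap = 1 / sqrt 3"

text \<open>The Prismatic pentagon with inradius 1 and the midpoint of its base at the origin.\<close>

definition prism_vertex :: "nat \<Rightarrow> real^2" where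
  "prism_vertex i = (if i = 0 then vector [1, 1 + kap] else if i = 1 then vector [0, 1 + 2 * kap]
     else if i = 2 then vector [-1, 1 + kap] else if i = 3 then vector [-1, 0] else vector [1, 0])"

text \<open>A negative \<rho> turns the tile by half a turn and so keeps its orientation; upward and
  downward tiles share all lemmas.\<close>

definition tile_vertex :: "real \<Rightarrow> real^2 \<Rightarrow> nat \<Rightarrow> real^2" where
  "tile_vertex \<rho> a i = a + \<rho> *\<^sub>R prism_vertex i"

definition prism_tile :: "real \<Rightarrow> real^2 \<Rightarrow> (real^2) set" where
  "prism_tile \<rho> a = convex hull (tile_vertex \<rho> a ` {..<5})"

lemma kap: "0 < kap" "kap * kap = 1/3" "kap < 1" "sqrt 3 = 3 * kap"
proof -
  show "0 < kap" "kap * kap = 1/3" by (simp_all add: kap_def)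
  show "sqrt 3 = 3 * kap" using real_sqrt_mult_self[of 3] by (simp add: kap_def field_simps)
  show "kap < 1" by (simp add: kap_def)
qed

lemma prism_vertex_nth:
  "prism_vertex 0 $ 1 = 1" "prism_vertex 0 $ 2 = 1 + kap" "prism_vertex 1 $ 1 = 0" "prism_vertex 1 $ 2 = 1 + 2 * kap"
  "prism_vertex 2 $ 1 = -1" "prism_vertex 2 $ 2 = 1 + kap" "prism_vertex 3 $ 1 = -1" "prism_vertex 3 $ 2 = 0"
  "prism_vertex 4 $ 1 = 1" "prism_vertex 4 $ 2 = 0"
  by (simp_all add: prism_vertex_def)

lemma prism_cross:
  "cross2 (prism_vertex 1 - prism_vertex 0) (x - prism_vertex 0) = 1 + 2*kap - x$2 - kap * x$1"
  "cross2 (prism_vertex 2 - prism_vertex 1) (x - prism_vertex 1) = 1 + 2*kap - x$2 + kap * x$1"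
  "cross2 (prism_vertex 3 - prism_vertex 2) (x - prism_vertex 2) = (1 + kap) * (1 + x$1)"
  "cross2 (prism_vertex 4 - prism_vertex 3) (x - prism_vertex 3) = 2 * x$2"
  "cross2 (prism_vertex 0 - prism_vertex 4) (x - prism_vertex 4) = (1 + kap) * (1 - x$1)"
  by (simp_all add: prism_vertex_def cross2_def algebra_simps)

context
  fixes \<rho> :: real and a :: "real^2"
  assumes \<rho>: "\<rho> \<noteq> 0"
begin

lemma tile_cross:
  "cross2 (tile_vertex \<rho> a i - tile_vertex \<rho> a j) (a + \<rho> *\<^sub>R x - tile_vertex \<rho> a j) =
    \<rho>\<^sup>2 * cross2 (prism_vertex i - prism_vertex j) (x - prism_vertex j)"
  by (simp add: tile_vertex_def cross2_def power2_eq_square algebra_simps)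

lemma tile_inj: "inj_on (tile_vertex \<rho> a) {..<5}"
proof (rule inj_onI)
  fix i j assume ij: "i \<in> {..<5::nat}" "j \<in> {..<5}" "tile_vertex \<rho> a i = tile_vertex \<rho> a j"
  then have e: "prism_vertex i = prism_vertex j" using \<rho> by (simp add: tile_vertex_def)
  have "\<forall>i<5. \<forall>j<5. prism_vertex i = prism_vertex j \<longrightarrow> i = j"
    unfolding all_less_5 using kap(1) by (auto simp: real2_eq_iff prism_vertex_nth simp del: One_nat_def)
  then show "i = j" using ij e by auto
qed

lemma tile_ccw:
  assumes "i < 5" "j < 5" "j \<noteq> i" "j \<noteq> Suc i mod 5"
  shows "0 < cross2 (tile_vertex \<rho> a (Suc i mod 5) - tile_vertex \<rho> a i) (tile_vertex \<rho> a j - tile_vertex \<rho> a i)"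
proof -
  have "\<forall>i<5. \<forall>j<5. j \<noteq> i \<longrightarrow> j \<noteq> Suc i mod 5 \<longrightarrow> 0 < cross2 (prism_vertex (Suc i mod 5) - prism_vertex i) (prism_vertex j - prism_vertex i)"
    unfolding all_less_5_next[of "\<lambda>i i'. \<forall>j<5. j \<noteq> i \<longrightarrow> j \<noteq> i' \<longrightarrow> 0 < cross2 (prism_vertex i' - prism_vertex i) (prism_vertex j - prism_vertex i)"]
    unfolding all_less_5 prism_cross using kap(1)
    by (simp add: prism_vertex_nth del: cross2_simps One_nat_def)
  then have "0 < cross2 (prism_vertex (Suc i mod 5) - prism_vertex i) (prism_vertex j - prism_vertex i)"
    using assms by blast
  then show ?thesis using tile_cross[of "Suc i mod 5" i "prism_vertex j"] \<rho> by (simp add: tile_vertex_def del: cross2_simps)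
qed

lemma tile_polygon:
  "polygon (prism_tile \<rho> a)" "vertices (prism_tile \<rho> a) = tile_vertex \<rho> a ` {..<5}"
  "\<And>i. i < 5 \<Longrightarrow> next_vertex (prism_tile \<rho> a) (tile_vertex \<rho> a i) = tile_vertex \<rho> a (Suc i mod 5)"
  unfolding prism_tile_def
  by (rule ccw_pentagon(1), rule tile_ccw, assumption+, rule tile_inj)
    (rule ccw_pentagon(2), rule tile_ccw, assumption+, rule tile_inj,
     rule ccw_pentagon(3), rule tile_ccw, assumption+, rule tile_inj, assumption)

lemma tile_interior_left:
  assumes i: "i < 5" and x: "a + \<rho> *\<^sub>R x \<in> prism_tile \<rho> a"
  shows "0 \<le> cross2 (prism_vertex (Suc i mod 5) - prism_vertex i) (x - prism_vertex i)"
    and "a + \<rho> *\<^sub>R x \<in> interior (prism_tile \<rho> a) \<Longrightarrow>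
      0 < cross2 (prism_vertex (Suc i mod 5) - prism_vertex i) (x - prism_vertex i)"
proof -
  interpret polygon "prism_tile \<rho> a" by (rule tile_polygon(1))
  have vi: "tile_vertex \<rho> a i \<in> V" unfolding tile_polygon(2) using i by simp
  show "0 \<le> cross2 (prism_vertex (Suc i mod 5) - prism_vertex i) (x - prism_vertex i)"
    using nxt_left[OF vi x] \<rho> unfolding tile_polygon(3)[OF i] tile_cross by (simp add: zero_le_mult_iff del: cross2_simps)
  show "0 < cross2 (prism_vertex (Suc i mod 5) - prism_vertex i) (x - prism_vertex i)"
    if "a + \<rho> *\<^sub>R x \<in> interior (prism_tile \<rho> a)"
    using interior_left[OF vi that] \<rho> unfolding tile_polygon(3)[OF i] tile_cross by (simp add: zero_less_mult_iff del: cross2_simps)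
qed

lemma in_prism_tile:
  "a + \<rho> *\<^sub>R x \<in> prism_tile \<rho> a \<longleftrightarrow> \<bar>x$1\<bar> \<le> 1 \<and> 0 \<le> x$2 \<and> x$2 \<le> 1 + 2*kap - kap * \<bar>x$1\<bar>"
proof -
  interpret polygon "prism_tile \<rho> a" by (rule tile_polygon(1))
  have "a + \<rho> *\<^sub>R x \<in> prism_tile \<rho> a \<longleftrightarrow>
      (\<forall>i<5. 0 \<le> cross2 (prism_vertex (Suc i mod 5) - prism_vertex i) (x - prism_vertex i))"
  proof
    assume x: "a + \<rho> *\<^sub>R x \<in> prism_tile \<rho> a"
    show "\<forall>i<5. 0 \<le> cross2 (prism_vertex (Suc i mod 5) - prism_vertex i) (x - prism_vertex i)"
      by (intro allI impI tile_interior_left(1) x)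
  next
    assume h: "\<forall>i<5. 0 \<le> cross2 (prism_vertex (Suc i mod 5) - prism_vertex i) (x - prism_vertex i)"
    have "0 \<le> cross2 (nxt v - v) (a + \<rho> *\<^sub>R x - v)" if v: "v \<in> V" for v
    proof -
      obtain i where i: "i < 5" "v = tile_vertex \<rho> a i" using v unfolding tile_polygon(2) by blast
      have "0 \<le> cross2 (prism_vertex (Suc i mod 5) - prism_vertex i) (x - prism_vertex i)" using h i(1) by blast
      then show ?thesis unfolding i(2) tile_polygon(3)[OF i(1)] tile_cross by (intro mult_nonneg_nonneg zero_le_power2)
    qed
    then show "a + \<rho> *\<^sub>R x \<in> prism_tile \<rho> a" by (subst eq_halfplanes) (simp del: cross2_simps)
  qed
  also have "\<dots> \<longleftrightarrow> \<bar>x$1\<bar> \<le> 1 \<and> 0 \<le> x$2 \<and> x$2 \<le> 1 + 2*kap - kap * \<bar>x$1\<bar>"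
  proof -
    have "0 \<le> (1 + kap) * (1 + x$1) \<longleftrightarrow> -1 \<le> x$1" "0 \<le> (1 + kap) * (1 - x$1) \<longleftrightarrow> x$1 \<le> 1"
      using kap(1) by (auto simp: zero_le_mult_iff)
    moreover have "kap * \<bar>x$1\<bar> = \<bar>kap * x$1\<bar>" using kap(1) by (simp add: abs_mult)
    ultimately show ?thesis
      unfolding all_less_5_next[of "\<lambda>i i'. 0 \<le> cross2 (prism_vertex i' - prism_vertex i) (x - prism_vertex i)"] prism_cross
      by linarith
  qed
  finally show ?thesis .
qed

lemma interior_prism_tile:
  assumes x: "a + \<rho> *\<^sub>R x \<in> interior (prism_tile \<rho> a)"
  shows "\<bar>x$1\<bar> < 1 \<and> 0 < x$2 \<and> x$2 < 1 + 2*kap - kap * \<bar>x$1\<bar>"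
proof -
  have "a + \<rho> *\<^sub>R x \<in> prism_tile \<rho> a" using x interior_subset by blast
  then have "\<forall>i<5. 0 < cross2 (prism_vertex (Suc i mod 5) - prism_vertex i) (x - prism_vertex i)"
    by (intro allI impI tile_interior_left(2) x)
  then show ?thesis
    unfolding all_less_5_next[of "\<lambda>i i'. 0 < cross2 (prism_vertex i' - prism_vertex i) (x - prism_vertex i)"] prism_cross
    using kap(1) by (auto simp: zero_less_mult_iff abs_if)
qed

lemma tile_edge: "i < 5 \<Longrightarrow> side (tile_vertex \<rho> a) i edge_of prism_tile \<rho> a"
  using polygon.edge_edge_of[OF tile_polygon(1), of "tile_vertex \<rho> a i"]
  unfolding tile_polygon(2) side_def by (simp add: tile_polygon(3))

lemma measure_prism_tile: "measure lebesgue (prism_tile \<rho> a) = \<rho>\<^sup>2 * (2 + sqrt 3)"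
proof -
  interpret polygon "prism_tile \<rho> a" by (rule tile_polygon(1))
  have "(\<Sum>v\<in>V. cross2 v (nxt v)) = (\<Sum>i<5. cross2 (tile_vertex \<rho> a i) (nxt (tile_vertex \<rho> a i)))"
    unfolding tile_polygon(2) by (subst sum.reindex[OF tile_inj]) simp
  also have "\<dots> = (\<Sum>i<5. cross2 (tile_vertex \<rho> a i) (tile_vertex \<rho> a (Suc i mod 5)))"
    by (rule sum.cong) (simp_all add: tile_polygon(3))
  also have "\<dots> = cross2 (tile_vertex \<rho> a 0) (tile_vertex \<rho> a 1) + cross2 (tile_vertex \<rho> a 1) (tile_vertex \<rho> a 2)
    + cross2 (tile_vertex \<rho> a 2) (tile_vertex \<rho> a 3) + cross2 (tile_vertex \<rho> a 3) (tile_vertex \<rho> a 4)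
    + cross2 (tile_vertex \<rho> a 4) (tile_vertex \<rho> a 0)"
  proof -
    have m: "Suc 0 mod 5 = 1" "Suc 1 mod 5 = 2" "Suc 2 mod 5 = 3" "Suc 3 mod 5 = 4" "Suc 4 mod 5 = (0::nat)"
      by simp_all
    show ?thesis unfolding lessThan_5 by (simp add: m del: One_nat_def cross2_simps)
  qed
  also have "\<dots> = \<rho>\<^sup>2 * (4 + 6 * kap)"
    by (simp add: tile_vertex_def cross2_def prism_vertex_nth power2_eq_square algebra_simps del: One_nat_def)
  finally show ?thesis unfolding measure_eq kap(4) by (simp add: algebra_simps)
qed

lemma tile_corner:
  "corner_angle (tile_vertex \<rho> a i) (tile_vertex \<rho> a j) (tile_vertex \<rho> a k) =
    corner_angle (prism_vertex i) (prism_vertex j) (prism_vertex k)"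
proof -
  have d: "tile_vertex \<rho> a i - tile_vertex \<rho> a j = \<rho> *\<^sub>R (prism_vertex i - prism_vertex j)" for i j
    by (simp add: tile_vertex_def algebra_simps)
  have D: "(\<rho> *\<^sub>R x) \<bullet> (\<rho> *\<^sub>R y) = (\<rho> * \<rho>) * (x \<bullet> y)" "norm (\<rho> *\<^sub>R x) * norm (\<rho> *\<^sub>R y) = (\<rho> * \<rho>) * (norm x * norm y)" for x y :: "real^2"
    using abs_mult_self_eq[of \<rho>] by (simp_all add: mult_ac)
  have "\<rho> * \<rho> \<noteq> 0" using \<rho> by simp
  then show ?thesis unfolding corner_angle_def d D using mult_divide_mult_cancel_left by metis
qed

end

lemma prism_corner:
  "corner_angle (prism_vertex 4) (prism_vertex 0) (prism_vertex 1) = 2*pi/3"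
  "corner_angle (prism_vertex 0) (prism_vertex 1) (prism_vertex 2) = 2*pi/3"
  "corner_angle (prism_vertex 1) (prism_vertex 2) (prism_vertex 3) = 2*pi/3"
  "corner_angle (prism_vertex 2) (prism_vertex 3) (prism_vertex 4) = pi/2"
  "corner_angle (prism_vertex 3) (prism_vertex 4) (prism_vertex 0) = pi/2"
proof -
  have a: "arccos (-1/2) = 2*pi/3"
    using arccos_cos[of "2*pi/3"] by (simp add: cos_120)
  have s: "sqrt (1 + kap * kap) = 2 * kap"
    by (rule real_sqrt_unique) (use kap in \<open>auto simp: power2_eq_square\<close>)
  have k: "sqrt ((1 + kap) * (1 + kap)) = 1 + kap" using kap(1) by simp
  have k': "sqrt ((- 1 - kap) * (- 1 - kap)) = 1 + kap"
    by (rule real_sqrt_unique) (use kap(1) in \<open>auto simp: power2_eq_square algebra_simps\<close>)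
  have n: "1 + kap \<noteq> 0" "kap \<noteq> 0" using kap(1) by auto
  have q: "kap * kap * 3 = 1" using kap(2) by simp
  have nrm: "norm (prism_vertex 4 - prism_vertex 0) = 1 + kap" "norm (prism_vertex 1 - prism_vertex 0) = 2 * kap"
    "norm (prism_vertex 0 - prism_vertex 1) = 2 * kap" "norm (prism_vertex 2 - prism_vertex 1) = 2 * kap"
    "norm (prism_vertex 1 - prism_vertex 2) = 2 * kap" "norm (prism_vertex 3 - prism_vertex 2) = 1 + kap"
    using s k k' by (simp_all add: norm_real2 prism_vertex_nth power2_eq_square add.commute del: One_nat_def)
  have "((prism_vertex 4 - prism_vertex 0) \<bullet> (prism_vertex 1 - prism_vertex 0)) / ((1 + kap) * (2 * kap)) = -1/2"
    "((prism_vertex 0 - prism_vertex 1) \<bullet> (prism_vertex 2 - prism_vertex 1)) / ((2 * kap) * (2 * kap)) = -1/2"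
    "((prism_vertex 1 - prism_vertex 2) \<bullet> (prism_vertex 3 - prism_vertex 2)) / ((2 * kap) * (1 + kap)) = -1/2"
  proof -
    have i: "(prism_vertex 4 - prism_vertex 0) \<bullet> (prism_vertex 1 - prism_vertex 0) = (-1/2) * ((1 + kap) * (2 * kap))"
      "(prism_vertex 0 - prism_vertex 1) \<bullet> (prism_vertex 2 - prism_vertex 1) = (-1/2) * ((2 * kap) * (2 * kap))"
      "(prism_vertex 1 - prism_vertex 2) \<bullet> (prism_vertex 3 - prism_vertex 2) = (-1/2) * ((2 * kap) * (1 + kap))"
      using q by (simp_all add: inner_real2 prism_vertex_nth algebra_simps del: One_nat_def)
    have "(2 * kap) * (1 + kap) \<noteq> 0" "(1 + kap) * (2 * kap) \<noteq> 0" "(2 * kap) * (2 * kap) \<noteq> 0" using n by auto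
    then show "((prism_vertex 4 - prism_vertex 0) \<bullet> (prism_vertex 1 - prism_vertex 0)) / ((1 + kap) * (2 * kap)) = -1/2"
      "((prism_vertex 0 - prism_vertex 1) \<bullet> (prism_vertex 2 - prism_vertex 1)) / ((2 * kap) * (2 * kap)) = -1/2"
      "((prism_vertex 1 - prism_vertex 2) \<bullet> (prism_vertex 3 - prism_vertex 2)) / ((2 * kap) * (1 + kap)) = -1/2"
      unfolding i using nonzero_mult_div_cancel_right by blast+
  qed
  then show "corner_angle (prism_vertex 4) (prism_vertex 0) (prism_vertex 1) = 2*pi/3"
    "corner_angle (prism_vertex 0) (prism_vertex 1) (prism_vertex 2) = 2*pi/3"
    "corner_angle (prism_vertex 1) (prism_vertex 2) (prism_vertex 3) = 2*pi/3"
    unfolding corner_angle_def nrm using a by (simp_all del: One_nat_def)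
  have "(prism_vertex 2 - prism_vertex 3) \<bullet> (prism_vertex 4 - prism_vertex 3) = 0"
    "(prism_vertex 3 - prism_vertex 4) \<bullet> (prism_vertex 0 - prism_vertex 4) = 0"
    by (simp_all add: inner_real2 prism_vertex_nth)
  then show "corner_angle (prism_vertex 2) (prism_vertex 3) (prism_vertex 4) = pi/2"
    "corner_angle (prism_vertex 3) (prism_vertex 4) (prism_vertex 0) = pi/2"
    unfolding corner_angle_def by simp_all
qed

text \<open>A tile of inradius \<rho> has area \<open>(\<rho> * c0)\<^sup>2\<close>, so unit area
  forces this value.\<close>

definition inr :: real where "inr = 1 / c0"

lemma prismatic_prism_tile:
  assumes \<rho>: "\<rho> = inr \<or> \<rho> = - inr"
  shows "prismatic_pentagon (prism_tile \<rho> a)"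
proof -
  have r0: "0 < inr" using c0_props by (simp add: inr_def)
  have \<rho>0: "\<rho> \<noteq> 0" and ab: "\<bar>\<rho>\<bar> = inr" and sq: "\<rho>\<^sup>2 = inr\<^sup>2" using \<rho> r0 by auto
  let ?v = "tile_vertex \<rho> a"
  define c where "c = a + \<rho> *\<^sub>R (vector [0, 1] :: real^2)"
  have area: "measure lebesgue (prism_tile \<rho> a) = 1"
    unfolding measure_prism_tile[OF \<rho>0] sq c0_props(2)[symmetric] using c0_props(1) by (simp add: inr_def power_divide)
  have vert: "pentagon_vertices ?v (prism_tile \<rho> a)"
    unfolding pentagon_vertices_def using tile_inj[OF \<rho>0] tile_edge[OF \<rho>0] by (simp add: prism_tile_def)
  have ang: "\<forall>i<5. corner_angle (?v ((i + 4) mod 5)) (?v i) (?v (Suc i mod 5)) = [2*pi/3, 2*pi/3, 2*pi/3, pi/2, pi/2] ! i"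
  proof -
    have m: "(0 + 4) mod 5 = (4::nat)" "(1 + 4) mod 5 = (0::nat)" "(2 + 4) mod 5 = (1::nat)" "(3 + 4) mod 5 = (2::nat)"
      "(4 + 4) mod 5 = (3::nat)" "Suc 0 mod 5 = 1" "Suc 1 mod 5 = 2" "Suc 2 mod 5 = 3" "Suc 3 mod 5 = 4" "Suc 4 mod 5 = (0::nat)"
      by simp_all
    show ?thesis unfolding tile_corner[OF \<rho>0] all_less_5 m prism_corner by simp
  qed
  have sub: "sphere c inr \<subseteq> prism_tile \<rho> a"
  proof
    fix y assume y: "y \<in> sphere c inr"
    define n where "n = (1 / \<rho>) *\<^sub>R (y - c)"
    have yn: "y = a + \<rho> *\<^sub>R (vector [0, 1] + n)" using \<rho>0 by (simp add: n_def c_def scaleR_add_right)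
    have "norm n = 1" using y ab r0 by (simp add: n_def dist_norm norm_minus_commute)
    then have nn: "n$1 * n$1 + n$2 * n$2 = 1" by (simp add: norm_real2 power2_eq_square)
    have n1: "\<bar>n$1\<bar> \<le> 1" "\<bar>n$2\<bar> \<le> 1"
      using component_le_norm_cart[of n 1] component_le_norm_cart[of n 2] \<open>norm n = 1\<close> by simp_all
    \<comment> \<open>Cauchy-Schwarz against the roof normal \<open>(kap, 1)\<close>, whose length
      is \<open>2 * kap\<close>.\<close>
    have "n$2 + kap * \<bar>n$1\<bar> \<le> 2 * kap"
    proof (rule power2_le_imp_le)
      have "(n$2 + kap * \<bar>n$1\<bar>)\<^sup>2 + (kap * n$2 - \<bar>n$1\<bar>)\<^sup>2 = (1 + kap * kap) * (n$2 * n$2 + \<bar>n$1\<bar> * \<bar>n$1\<bar>)"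
        by (simp add: power2_eq_square algebra_simps)
      also have "\<dots> = (2 * kap)\<^sup>2" using nn kap(2) by (simp add: power2_eq_square add.commute)
      finally show "(n$2 + kap * \<bar>n$1\<bar>)\<^sup>2 \<le> (2 * kap)\<^sup>2"
        using zero_le_power2[of "kap * n$2 - \<bar>n$1\<bar>"] by linarith
    qed (use kap(1) in simp)
    then show "y \<in> prism_tile \<rho> a" unfolding yn in_prism_tile[OF \<rho>0] using n1 by simp
  qed
  have touch: "side ?v i \<inter> sphere c inr \<noteq> {}" if i: "i < 5" for i
  proof -
    have "\<exists>t\<ge>0. t \<le> 1 \<and> norm ((1 - t) *\<^sub>R prism_vertex i + t *\<^sub>R prism_vertex (Suc i mod 5) - vector [0, 1]) = 1"
    proof -
      have half: "norm ((1 - 1/2) *\<^sub>R prism_vertex 0 + (1/2) *\<^sub>R prism_vertex 1 - vector [0, 1]) = 1"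
        "norm ((1 - 1/2) *\<^sub>R prism_vertex 1 + (1/2) *\<^sub>R prism_vertex 2 - vector [0, 1]) = 1"
        "norm ((1 - 1/2) *\<^sub>R prism_vertex 3 + (1/2) *\<^sub>R prism_vertex 4 - vector [0, 1]) = 1"
        using kap(2) by (simp_all add: norm_real2 prism_vertex_nth power2_eq_square field_simps del: One_nat_def)
      \<comment> \<open>On the vertical sides the circle touches at the height 1 of its centre;
        \<open>?t\<close> is the fraction of the side above that point. The other three sides are
        touched at their midpoints.\<close>
      let ?t = "kap / (1 + kap)"
      have t: "0 \<le> ?t" "?t \<le> 1" "(1 - ?t) * (1 + kap) = 1" using kap(1) by (simp_all add: field_simps)
      have t': "0 \<le> 1 - ?t" "1 - ?t \<le> 1" "(1 - (1 - ?t)) = ?t" using t by auto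
      have "norm ((1 - ?t) *\<^sub>R prism_vertex 2 + ?t *\<^sub>R prism_vertex 3 - vector [0, 1]) = 1"
        "norm ((1 - (1 - ?t)) *\<^sub>R prism_vertex 4 + (1 - ?t) *\<^sub>R prism_vertex 0 - vector [0, 1]) = 1"
        unfolding t'(3) using t(3) by (simp_all add: norm_real2 prism_vertex_nth del: One_nat_def)
      then have "\<forall>i<5. \<exists>t\<ge>0. t \<le> 1 \<and> norm ((1 - t) *\<^sub>R prism_vertex i + t *\<^sub>R prism_vertex (Suc i mod 5) - vector [0, 1]) = 1"
        unfolding all_less_5_next[of "\<lambda>i i'. \<exists>t\<ge>0. t \<le> 1 \<and> norm ((1 - t) *\<^sub>R prism_vertex i + t *\<^sub>R prism_vertex i' - vector [0, 1]) = 1"]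
        using half t(1,2) t'(1,2) by (intro conjI) (rule exI[of _ "1/2"] exI[of _ ?t] exI[of _ "1 - ?t"]; force)+
      then show ?thesis using i by blast
    qed
    then obtain t where t: "0 \<le> t" "t \<le> 1"
      "norm ((1 - t) *\<^sub>R prism_vertex i + t *\<^sub>R prism_vertex (Suc i mod 5) - vector [0, 1]) = 1" by blast
    let ?p = "(1 - t) *\<^sub>R ?v i + t *\<^sub>R ?v (Suc i mod 5)"
    have "?p \<in> side ?v i" using t by (auto simp: side_def closed_segment_def)
    moreover have "?p - c = \<rho> *\<^sub>R ((1 - t) *\<^sub>R prism_vertex i + t *\<^sub>R prism_vertex (Suc i mod 5) - vector [0, 1])"
      by (simp add: tile_vertex_def c_def algebra_simps)
    then have "norm (?p - c) = inr" using t(3) ab by simp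
    then have "?p \<in> sphere c inr" by (simp add: dist_norm norm_minus_commute)
    ultimately show ?thesis by blast
  qed
  show ?thesis
    unfolding prismatic_pentagon_def unit_circumscribed_pentagon_def circumscribed_about_def
    using area vert ang sub touch r0 by blast
qed

text \<open>In units of the inradius: the base of a tile lies on a line \<open>y = j * row_height\<close>, upwards for positive
  and downwards for negative scale.\<close>

definition row_height :: real where "row_height = 2 + 3 * kap"

text \<open>Consecutive rows are shifted by half a tile, so that each ridge, of height
  \<open>1 + 2 * kap\<close>, meets the upper corners, of height \<open>1 + kap\<close>, of two
  tiles from the opposite line; these heights add up to \<open>row_height\<close>.\<close>

definition base_point :: "int \<Rightarrow> int \<Rightarrow> real^2" where
  "base_point j m = vector [of_int (2 * m + j), of_int j * row_height]"

definition prism_tiling :: "(real^2) set set" where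
  "prism_tiling = {prism_tile (s * inr) (inr *\<^sub>R base_point j m) |s j m. s = 1 \<or> s = -1}"

lemma in_placed_tile:
  assumes s: "s = 1 \<or> s = -1"
  shows "inr *\<^sub>R z \<in> prism_tile (s * inr) (inr *\<^sub>R base_point j m) \<longleftrightarrow>
      \<bar>z$1 - of_int (2*m+j)\<bar> \<le> 1 \<and> 0 \<le> s * (z$2 - of_int j * row_height) \<and>
      s * (z$2 - of_int j * row_height) \<le> 1 + 2*kap - kap * \<bar>z$1 - of_int (2*m+j)\<bar>"
    and "inr *\<^sub>R z \<in> interior (prism_tile (s * inr) (inr *\<^sub>R base_point j m)) \<Longrightarrow>
      \<bar>z$1 - of_int (2*m+j)\<bar> < 1 \<and> 0 < s * (z$2 - of_int j * row_height) \<and>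
      s * (z$2 - of_int j * row_height) < 1 + 2*kap - kap * \<bar>z$1 - of_int (2*m+j)\<bar>"
proof -
  have r0: "s * inr \<noteq> 0" using c0_props s by (auto simp: inr_def)
  define x where "x = s *\<^sub>R (z - base_point j m)"
  have e: "inr *\<^sub>R z = inr *\<^sub>R base_point j m + (s * inr) *\<^sub>R x"
    using s by (auto simp: x_def algebra_simps)
  have x: "\<bar>x$1\<bar> = \<bar>z$1 - of_int (2*m+j)\<bar>" "x$2 = s * (z$2 - of_int j * row_height)"
    using s by (auto simp: x_def base_point_def)
  show "inr *\<^sub>R z \<in> prism_tile (s * inr) (inr *\<^sub>R base_point j m) \<longleftrightarrow>
      \<bar>z$1 - of_int (2*m+j)\<bar> \<le> 1 \<and> 0 \<le> s * (z$2 - of_int j * row_height) \<and>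
      s * (z$2 - of_int j * row_height) \<le> 1 + 2*kap - kap * \<bar>z$1 - of_int (2*m+j)\<bar>"
    unfolding e in_prism_tile[OF r0] x ..
  show "\<bar>z$1 - of_int (2*m+j)\<bar> < 1 \<and> 0 < s * (z$2 - of_int j * row_height) \<and>
      s * (z$2 - of_int j * row_height) < 1 + 2*kap - kap * \<bar>z$1 - of_int (2*m+j)\<bar>"
    if h: "inr *\<^sub>R z \<in> interior (prism_tile (s * inr) (inr *\<^sub>R base_point j m))"
    using interior_prism_tile[OF r0 h[unfolded e]] unfolding x .
qed

text \<open>A tile is lower than \<open>row_height\<close>, so inside a strip between base lines it
  stands on the lower line or hangs from the upper one.\<close>

lemma row_index:
  fixes s y :: real
  assumes "s = 1 \<or> s = -1" "0 \<le> s * (y - of_int j * row_height)" "s * (y - of_int j * row_height) \<le> 1 + 2*kap"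
    and t: "of_int t * row_height < y" "y < of_int (t + 1) * row_height"
  shows "j = (if s = 1 then t else t + 1)"
proof -
  have row_height: "0 < row_height" "1 + 2*kap < row_height" using kap(1) by (auto simp: row_height_def)
  show ?thesis
  proof (cases "s = 1")
    case True
    then have "of_int j * row_height \<le> y" "y < of_int j * row_height + row_height" using assms(2,3) row_height by simp_all
    then have "of_int j * row_height < of_int (t + 1) * row_height" "of_int t * row_height < of_int (j + 1) * row_height"
      using t by (simp_all add: distrib_right)
    then have "j < t + 1" "t < j + 1" using row_height(1) by (simp_all only: mult_less_cancel_right_pos of_int_less_iff)
    then show ?thesis using True by simp
  next
    case False
    then have "s = -1" using assms(1) by simp
    then have "y \<le> of_int j * row_height" "of_int j * row_height - row_height < y" using assms(2,3) row_height by simp_all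
    then have "of_int (j - 1) * row_height < of_int (t + 1) * row_height" "of_int t * row_height < of_int j * row_height"
      using t by (simp_all only: of_int_diff of_int_add of_int_1 left_diff_distrib distrib_right)
    then have "j - 1 < t + 1" "t < j" using row_height(1) by (simp_all only: mult_less_cancel_right_pos of_int_less_iff)
    then show ?thesis using False by simp
  qed
qed

text \<open>In one strip, axes of equally oriented tiles differ by even numbers and must coincide.
  Axes of opposite tiles differ by odd numbers, so the distances from the point to them add up to at
  least 1 and the roof heights there to at most \<open>row_height\<close>. That is the sum of the
  two actual heights, and an interior point makes the comparison strict.\<close>

lemma placed_tiles_disjoint:
  assumes s: "s = 1 \<or> s = -1" "s' = 1 \<or> s' = -1"
    and z: "inr *\<^sub>R z \<in> interior (prism_tile (s * inr) (inr *\<^sub>R base_point j m))"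
    and z': "inr *\<^sub>R z \<in> prism_tile (s' * inr) (inr *\<^sub>R base_point j' m')"
  shows "s = s' \<and> j = j' \<and> m = m'"
proof -
  define u u' where "u = z$1 - of_int (2*m+j)" and "u' = z$1 - of_int (2*m'+j')"
  note a = in_placed_tile(2)[OF s(1) z, folded u_def] and b = z'[unfolded in_placed_tile(1)[OF s(2)], folded u'_def]
  have ka: "0 \<le> kap * \<bar>u\<bar>" "0 \<le> kap * \<bar>u'\<bar>" using kap(1) by auto
  define t where "t = (if s = 1 then j else j - 1)"
  have row_height: "1 + 2*kap < row_height" using kap(1) by (simp add: row_height_def)
  have t: "of_int t * row_height < z$2" "z$2 < of_int (t + 1) * row_height"
    using s(1) a ka row_height by (auto simp: t_def algebra_simps)
  have j: "j = (if s = 1 then t else t + 1)" by (simp add: t_def)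
  have j': "j' = (if s' = 1 then t else t + 1)"
    using b ka by (intro row_index[OF s(2) _ _ t]) auto
  show ?thesis
  proof (cases "s = s'")
    case True
    then have jj: "j = j'" using j j' by simp
    have "\<bar>u - u'\<bar> < 2" using a b by linarith
    moreover have "u - u' = of_int (2 * (m' - m))" unfolding u_def u'_def jj by simp
    ultimately have "\<bar>2 * (m' - m)\<bar> < 2" by linarith
    then have "m = m'" by presburger
    then show ?thesis using True jj by simp
  next
    case False
    have "\<bar>u - u'\<bar> = \<bar>of_int (2 * (m' - m) + (j' - j))\<bar>" unfolding u_def u'_def by (simp add: algebra_simps)
    moreover have "j' - j = 1 \<or> j' - j = -1" using j j' s False by auto
    then have "1 \<le> \<bar>2 * (m' - m) + (j' - j)\<bar>" by presburger
    ultimately have "1 \<le> \<bar>u - u'\<bar>" by linarith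
    then have "1 \<le> \<bar>u\<bar> + \<bar>u'\<bar>" by linarith
    then have "kap * 1 \<le> kap * (\<bar>u\<bar> + \<bar>u'\<bar>)" using kap(1) by (intro mult_left_mono) auto
    then have k: "kap \<le> kap * \<bar>u\<bar> + kap * \<bar>u'\<bar>" by (simp add: distrib_left)
    have "s * (z$2 - of_int j * row_height) + s' * (z$2 - of_int j' * row_height) = row_height"
      using s False j j' by (auto simp: algebra_simps)
    then show ?thesis using a b k by (simp add: row_height_def)
  qed
qed

text \<open>A point above the roof of the nearest upward tile lies in the downward tile whose axis
  is at distance \<open>1 - \<bar>u\<bar>\<close>, because the two roofs coincide.\<close>

lemma placed_tiles_cover: "\<exists>s j m. (s = 1 \<or> s = -1) \<and> inr *\<^sub>R z \<in> prism_tile (s * inr) (inr *\<^sub>R base_point j m)"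
proof -
  have row_height: "0 < row_height" using kap(1) by (simp add: row_height_def)
  define t where "t = \<lfloor>z$2 / row_height\<rfloor>"
  define y where "y = z$2 - of_int t * row_height"
  have "of_int t \<le> z$2 / row_height" "z$2 / row_height < of_int t + 1" unfolding t_def by linarith+
  then have y: "0 \<le> y" "y < row_height" using row_height by (simp_all add: y_def pos_le_divide_eq pos_divide_less_eq algebra_simps)
  define m where "m = \<lfloor>(z$1 - of_int t + 1) / 2\<rfloor>"
  define u where "u = z$1 - of_int (2*m+t)"
  have "of_int m \<le> (z$1 - of_int t + 1) / 2" "(z$1 - of_int t + 1) / 2 < of_int m + 1" unfolding m_def by linarith+
  then have u: "\<bar>u\<bar> \<le> 1" by (simp add: u_def abs_le_iff)
  show ?thesis
  proof (cases "y \<le> 1 + 2*kap - kap * \<bar>u\<bar>")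
    case True
    then have "inr *\<^sub>R z \<in> prism_tile (1 * inr) (inr *\<^sub>R base_point t m)"
      unfolding in_placed_tile(1)[OF disjI1[OF refl]] using u y(1) by (simp add: u_def y_def)
    then show ?thesis by blast
  next
    case False
    define m' where "m' = (if 0 \<le> u then m else m - 1)"
    have u': "\<bar>z$1 - of_int (2*m'+(t+1))\<bar> = 1 - \<bar>u\<bar>" using u by (auto simp: m'_def u_def)
    have "-1 * (z$2 - of_int (t+1) * row_height) = row_height - y" by (simp add: y_def algebra_simps)
    then have "inr *\<^sub>R z \<in> prism_tile (-1 * inr) (inr *\<^sub>R base_point (t+1) m')"
      unfolding in_placed_tile(1)[OF disjI2[OF refl]] u' using u y False by (simp add: row_height_def algebra_simps)
    then show ?thesis by blast
  qed
qed

lemma prism_tiling_prismatic: "P \<in> prism_tiling \<Longrightarrow> prismatic_pentagon P"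
  unfolding prism_tiling_def using prismatic_prism_tile by auto

lemma tiling_prism_tiling: "tiling prism_tiling"
proof -
  have r0: "inr \<noteq> 0" using c0_props by (auto simp: inr_def)
  have poly: "polygon P" if "P \<in> prism_tiling" for P
    using that tile_polygon(1) r0 by (auto simp: prism_tiling_def)
  have "polygonal_region P" if "P \<in> prism_tiling" for P
  proof -
    interpret polygon P by (rule poly[OF that])
    show ?thesis unfolding polygonal_region_def
      using convex_polygon convex by (intro conjI exI[of _ "{P}"]) (auto intro: convex_connected convex_interior)
  qed
  moreover have "\<Union>prism_tiling = UNIV"
  proof -
    have "x \<in> \<Union>prism_tiling" for x
    proof -
      have "x = inr *\<^sub>R ((1 / inr) *\<^sub>R x)" using r0 by simp
      then show ?thesis using placed_tiles_cover[of "(1 / inr) *\<^sub>R x"] unfolding prism_tiling_def by force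
    qed
    then show ?thesis by blast
  qed
  moreover have disj: "interior P \<inter> Q = {}" if P: "P \<in> prism_tiling" and Q: "Q \<in> prism_tiling" and "P \<noteq> Q" for P Q
  proof (rule ccontr)
    assume "interior P \<inter> Q \<noteq> {}"
    then obtain x where x: "x \<in> interior P" "x \<in> Q" by blast
    have e: "x = inr *\<^sub>R ((1 / inr) *\<^sub>R x)" using r0 by simp
    obtain s j m where P': "s = 1 \<or> s = -1" "P = prism_tile (s * inr) (inr *\<^sub>R base_point j m)"
      using P by (auto simp: prism_tiling_def)
    obtain s' j' m' where Q': "s' = 1 \<or> s' = -1" "Q = prism_tile (s' * inr) (inr *\<^sub>R base_point j' m')"
      using Q by (auto simp: prism_tiling_def)
    have "inr *\<^sub>R ((1 / inr) *\<^sub>R x) \<in> interior P" "inr *\<^sub>R ((1 / inr) *\<^sub>R x) \<in> Q"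
      using x unfolding e[symmetric] by this
    then have "s = s' \<and> j = j' \<and> m = m'"
      unfolding P'(2) Q'(2) by (rule placed_tiles_disjoint[OF P'(1) Q'(1)])
    then show False using P'(2) Q'(2) \<open>P \<noteq> Q\<close> by simp
  qed
  have "P \<inter> Q \<subseteq> frontier P \<inter> frontier Q" if "P \<in> prism_tiling" "Q \<in> prism_tiling" "P \<noteq> Q" for P Q
    using disj[OF that] disj[OF that(2,1)] that(3) polygon.closed[OF poly[OF that(1)]] polygon.closed[OF poly[OF that(2)]]
    by (auto simp: frontier_def)
  ultimately show ?thesis unfolding tiling_def by blast
qed

section \<open>Tilings by Cairo and Prismatic pentagons\<close>

text \<open>The vanishing Gram determinant of three vectors in the plane. It will tie the tangent
  length at a corner to the angle there without any orientation.\<close>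

lemma gram2:
  fixes q e f :: "real^2"
  shows "(q \<bullet> q) * (e \<bullet> e * (f \<bullet> f) - (e \<bullet> f)\<^sup>2) =
    (q \<bullet> e)\<^sup>2 * (f \<bullet> f) - 2 * (q \<bullet> e) * (q \<bullet> f) * (e \<bullet> f) + (q \<bullet> f)\<^sup>2 * (e \<bullet> e)"
  unfolding inner_real2 by algebra

text \<open>The point of the circle farthest towards the side lies in \<open>P\<close>, so the line
  of the side is at distance at least \<open>r\<close> from \<open>c\<close>; the touching point
  gives the converse. Equality in Cauchy-Schwarz makes the radius there perpendicular to the
  side.\<close>

lemma (in polygon) tangent_edge:
  assumes u: "u \<in> V" and S: "sphere c r \<subseteq> P" "0 < r" and p: "p \<in> edge u" "dist c p = r"
  shows "cross2 (nxt u - u) (c - u) = r * dist u (nxt u)" "(p - c) \<bullet> (nxt u - u) = 0"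
proof -
  let ?d = "nxt u - u"
  define N :: "real^2" where "N = vector [- ?d$2, ?d$1]"
  have cr: "cross2 ?d y = N \<bullet> y" for y unfolding N_def by (rule cross2_eq_inner)
  have Nd: "N \<bullet> ?d = 0" using cr[of ?d] by (simp only: cross2_simps(9))
  have nN: "norm N = dist u (nxt u)"
    unfolding N_def by (simp add: norm_real2 dist_norm power2_commute add.commute)
  have N0: "0 < norm N" using nN nxt_neq[OF u] by simp
  have NN: "N \<bullet> N = norm N * norm N" by (simp add: dot_square_norm power2_eq_square)
  have "c - (r / norm N) *\<^sub>R N \<in> sphere c r" using S(2) N0 by (simp add: dist_norm)
  then have "0 \<le> N \<bullet> (c - (r / norm N) *\<^sub>R N - u)" using S(1) nxt_left[OF u] unfolding cr by blast
  then have 1: "r * norm N \<le> N \<bullet> (c - u)" using N0 by (simp add: inner_diff_right NN)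
  have "N \<bullet> (p - u) = 0" using p(1) edge_eq[OF u] unfolding cr by blast
  then have 2: "N \<bullet> (p - c) = - (N \<bullet> (c - u))" by (simp add: inner_diff_right)
  have "- (norm N * r) \<le> N \<bullet> (p - c)"
    using Cauchy_Schwarz_ineq2[of N "p - c"] p(2) by (simp add: dist_norm norm_minus_commute abs_le_iff)
  then have 3: "N \<bullet> (c - u) = r * norm N" using 1 2 by (simp add: mult.commute)
  then show "cross2 ?d (c - u) = r * dist u (nxt u)" by (simp only: cr nN)
  let ?z = "p - c + (r / norm N) *\<^sub>R N"
  have "(w + s *\<^sub>R N) \<bullet> (w + s *\<^sub>R N) = w \<bullet> w + 2 * s * (N \<bullet> w) + s\<^sup>2 * (N \<bullet> N)" for w s
    by (simp add: inner_add_left inner_add_right inner_commute power2_eq_square algebra_simps)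
  then have "?z \<bullet> ?z = (p - c) \<bullet> (p - c) + 2 * (r / norm N) * (N \<bullet> (p - c)) + (r / norm N)\<^sup>2 * (N \<bullet> N)" .
  also have "(p - c) \<bullet> (p - c) = r\<^sup>2" using p(2) by (simp add: dot_square_norm dist_norm norm_minus_commute)
  also have "(r / norm N)\<^sup>2 * (N \<bullet> N) = r\<^sup>2" unfolding NN using N0 by (simp add: power2_eq_square)
  also have "2 * (r / norm N) * (N \<bullet> (p - c)) = - 2 * r\<^sup>2" unfolding 2 3 using N0 by (simp add: power2_eq_square)
  finally have "?z = 0" by (simp add: inner_eq_zero_iff)
  then have "p - c = - (r / norm N) *\<^sub>R N" by (simp add: eq_neg_iff_add_eq_0)
  then show "(p - c) \<bullet> ?d = 0" using Nd by simp
qed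

text \<open>The tangent length at a corner is \<open>r\<close> times the cotangent of half its
  angle, so the half perimeter is \<open>r * c0\<^sup>2\<close>. The area, 1, is \<open>r\<close>
  times the half perimeter, hence \<open>r * c0 = 1\<close>. Only the cotangent sum
  \<open>cnt\<close> enters, so both kinds of pentagon are treated at once.\<close>

lemma unit_pentagon:
  assumes up: "unit_circumscribed_pentagon \<theta> P"
    and \<theta>: "\<And>i. i < 5 \<Longrightarrow> \<theta> ! i = 2*pi/3 \<or> \<theta> ! i = pi/2"
    and cnt: "(\<Sum>i<5. if \<theta> ! i = pi/2 then 1 else 1 / sqrt 3) = 2 + sqrt (3::real)"
  shows "convex_polygon P" "measure lebesgue P = 1" "perimeter P = 2 * c0" "\<And>x y. x \<in> P \<Longrightarrow> y \<in> P \<Longrightarrow> dist x y \<le> 4"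
proof -
  obtain v c r where area: "measure lebesgue P = 1" and v: "inj_on v {..<5}" "P = convex hull (v ` {..<5})"
    "\<And>i. i < 5 \<Longrightarrow> side v i edge_of P"
    and ang: "\<And>i. i < 5 \<Longrightarrow> corner_angle (v ((i + 4) mod 5)) (v i) (v (Suc i mod 5)) = \<theta> ! i"
    and r: "0 < r" and S: "sphere c r \<subseteq> P" and touch: "\<And>i. i < 5 \<Longrightarrow> side v i \<inter> sphere c r \<noteq> {}"
    using up unfolding unit_circumscribed_pentagon_def pentagon_vertices_def circumscribed_about_def by blast
  have cP: "convex P" using v(2) by simp
  have "\<not> negligible P" using area by (auto dest: negligible_imp_measure0)
  then have "interior P \<noteq> {}" using negligible_convex_interior[OF cP] by simp
  then show CP: "convex_polygon P" unfolding convex_polygon_def v(2) by (simp add: polytope_convex_hull)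
  show "measure lebesgue P = 1" by (rule area)
  interpret polygon P by unfold_locales (rule CP)
  have sub: "V \<subseteq> v ` {..<5}" unfolding vertices_def v(2) by (rule extreme_points_of_convex_hull)
  have vV: "v i \<in> V" if "i < 5" for i
  proof -
    have "side v i face_of P" using v(3)[OF that] by (simp add: edge_of_def)
    then show ?thesis using extreme_point_of_face[of "side v i" P "v i"]
      by (simp add: side_def extreme_point_of_segment vertices_def)
  qed
  have VV: "V = v ` {..<5}" using sub vV by blast
  have cV: "card V = 5" using VV v(1) by (simp add: card_image)
  have mod5: "Suc i mod 5 < 5" for i by simp
  have vne: "v i \<noteq> v (Suc i mod 5)" if "i < 5" for i
  proof
    assume "v i = v (Suc i mod 5)"
    then have "i = Suc i mod 5" using v(1) that by (auto dest: inj_onD)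
    then show False using that by presburger
  qed
  have two_steps: "Suc (Suc j mod 5) mod 5 \<noteq> j" for j :: nat by presburger
  have side_inj: "inj_on (side v) {..<5}"
  proof (rule inj_onI)
    fix i j assume ij: "i \<in> {..<5::nat}" "j \<in> {..<5}" "side v i = side v j"
    then have "{v i, v (Suc i mod 5)} = {v j, v (Suc j mod 5)}" by (simp add: side_def closed_segment_eq)
    then have "v i = v j \<or> (v i = v (Suc j mod 5) \<and> v (Suc i mod 5) = v j)" by (auto simp: doubleton_eq_iff)
    moreover have "v a = v b \<longleftrightarrow> a = b" if "a < 5" "b < 5" for a b
      using that inj_on_eq_iff[OF v(1)] by simp
    ultimately have "i = j \<or> (i = Suc j mod 5 \<and> Suc i mod 5 = j)" using ij(1,2) mod5 by simp
    moreover have "Suc (Suc j mod 5) mod 5 \<noteq> j" by (rule two_steps)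
    ultimately show "i = j" by metis
  qed
  \<comment> \<open>The given labelling may run clockwise, so sides and edges are matched as sets of
    segments and not vertex by vertex.\<close>
  have sides: "side v ` {..<5} = edge ` V"
  proof (rule card_subset_eq)
    show "side v ` {..<5} \<subseteq> edge ` V" using v(3) edges_eq by auto
    show "card (side v ` {..<5}) = card (edge ` V)" using side_inj edge_inj cV by (simp add: card_image)
  qed (use finite_V in simp)
  \<comment> \<open>Reads the length off from the segment as a set, so that sums over sides can be
    reindexed.\<close>
  have Hseg: "enn2real (hausdorff_length (closed_segment a b)) = dist a b" for a b :: "real^2"
    using antisym[OF hausdorff_length_closed_segment_le[of a b] hausdorff_length_closed_segment_ge[OF order_refl]] by simp
  have per: "perimeter P = (\<Sum>i<5. dist (v i) (v (Suc i mod 5)))"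
  proof -
    have "perimeter P = (\<Sum>u\<in>V. enn2real (hausdorff_length (edge u)))" by (simp add: perimeter_def Hseg)
    also have "\<dots> = (\<Sum>e\<in>edge ` V. enn2real (hausdorff_length e))" by (simp add: sum.reindex[OF edge_inj])
    also have "\<dots> = (\<Sum>i<5. enn2real (hausdorff_length (side v i)))"
      unfolding sides[symmetric] by (simp add: sum.reindex[OF side_inj])
    finally show ?thesis by (simp add: side_def Hseg)
  qed
  have cball: "cball c r \<subseteq> P"
    using Krein_Milman_frontier[of "cball c r"] r S hull_minimal[where S = convex, OF S cP] by (simp add: frontier_cball)
  then have "ball c r \<subseteq> interior P" using interior_mono[of "cball c r" P] by simp
  then have cint: "c \<in> interior P" using r by auto
  have tan_V: "cross2 (nxt u - u) (c - u) = r * dist u (nxt u)" if u: "u \<in> V" for u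
  proof -
    obtain i where i: "i < 5" "edge u = side v i" using sides u by blast
    obtain p where "p \<in> side v i" "p \<in> sphere c r" using touch[OF i(1)] by blast
    then have "p \<in> edge u" "dist c p = r" unfolding i(2) by simp_all
    then show ?thesis using tangent_edge(1)[OF u S r] by blast
  qed
  have area_per: "r * perimeter P = 2"
  proof -
    have "1 = (\<Sum>u\<in>V. cross2 (u - c) (nxt u - c) / 2)" using measure_fan[OF cint] area by simp
    also have "\<dots> = (\<Sum>u\<in>V. r * dist u (nxt u) / 2)"
    proof (rule sum.cong[OF refl])
      fix u assume "u \<in> V"
      have "cross2 (u - c) (nxt u - c) = cross2 (nxt u - u) (c - u)" by (simp add: cross2_def algebra_simps)
      then show "cross2 (u - c) (nxt u - c) / 2 = r * dist u (nxt u) / 2" using tan_V[OF \<open>u \<in> V\<close>] by simp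
    qed
    also have "\<dots> = r * perimeter P / 2" by (simp add: perimeter_def sum_distrib_left sum_divide_distrib)
    finally show ?thesis by simp
  qed
  \<comment> \<open>The length of a tangent from \<open>w\<close> to the circle. Each side is the
    sum of the tangent lengths of its two ends.\<close>
  define \<tau> where "\<tau> w = sqrt ((dist w c)\<^sup>2 - r\<^sup>2)" for w
  have tang: "dist (v i) (v (Suc i mod 5)) = \<tau> (v i) + \<tau> (v (Suc i mod 5)) \<and>
      (c - v i) \<bullet> (v (Suc i mod 5) - v i) = \<tau> (v i) * dist (v i) (v (Suc i mod 5)) \<and>
      (c - v (Suc i mod 5)) \<bullet> (v i - v (Suc i mod 5)) = \<tau> (v (Suc i mod 5)) * dist (v i) (v (Suc i mod 5))
      \<and> r\<^sup>2 \<le> (dist (v i) c)\<^sup>2" if i: "i < 5" for i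
  proof -
    let ?a = "v i" and ?b = "v (Suc i mod 5)"
    obtain u where u: "u \<in> V" "side v i = edge u" using sides i by blast
    obtain p where ps: "p \<in> side v i" "p \<in> sphere c r" using touch[OF i] by blast
    then have p: "p \<in> closed_segment ?a ?b" "dist c p = r" unfolding side_def by simp_all
    have perp: "(p - c) \<bullet> (nxt u - u) = 0" by (rule tangent_edge(2)[OF u(1) S r ps(1)[unfolded u(2)] p(2)])
    have "{?a, ?b} = {u, nxt u}" using u(2) by (simp add: side_def closed_segment_eq)
    then have "?b - ?a = nxt u - u \<or> ?b - ?a = - (nxt u - u)" by (auto simp: doubleton_eq_iff)
    then have perp': "(p - c) \<bullet> (?b - ?a) = 0" using perp by (elim disjE) (simp_all add: inner_diff_right)
    obtain t where t: "0 \<le> t" "t \<le> 1" "p = (1 - t) *\<^sub>R ?a + t *\<^sub>R ?b" using p(1) by (auto simp: closed_segment_def)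
    let ?d = "?b - ?a" and ?L = "dist ?a ?b"
    have pa: "p - ?a = t *\<^sub>R ?d" and pb: "?b - p = (1 - t) *\<^sub>R ?d" unfolding t(3) by (simp_all add: algebra_simps)
    have dd: "?d \<bullet> ?d = ?L * ?L" by (simp add: dist_norm norm_minus_commute dot_square_norm power2_eq_square)
    have pyth: "(dist w c)\<^sup>2 - r\<^sup>2 = k * k * (?L * ?L)" if "p - w = k *\<^sub>R ?d" for w k
    proof -
      have "w - c = (p - c) - k *\<^sub>R ?d" using that by (simp add: algebra_simps)
      moreover have "(g - k *\<^sub>R h) \<bullet> (g - k *\<^sub>R h) = g \<bullet> g - 2 * k * (g \<bullet> h) + k * k * (h \<bullet> h)" for g h :: "real^2"
        by (simp add: inner_diff_left inner_diff_right inner_commute algebra_simps)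
      ultimately have "(w - c) \<bullet> (w - c) = (p - c) \<bullet> (p - c) - 2 * k * ((p - c) \<bullet> ?d) + k * k * (?d \<bullet> ?d)"
        by metis
      moreover have "(p - c) \<bullet> (p - c) = r\<^sup>2" using p(2) by (simp add: dot_square_norm dist_norm norm_minus_commute)
      moreover have "(w - c) \<bullet> (w - c) = (dist w c)\<^sup>2" by (simp add: dot_square_norm dist_norm)
      ultimately show ?thesis using perp' dd by simp
    qed
    have ta: "\<tau> ?a = t * ?L" unfolding \<tau>_def pyth[OF pa] using t by (simp add: real_sqrt_mult)
    have pb': "p - ?b = (t - 1) *\<^sub>R ?d" using pb by (simp add: algebra_simps)
    have "(t - 1) * (t - 1) = (1 - t) * (1 - t)" by (simp add: algebra_simps)
    then have tb: "\<tau> ?b = (1 - t) * ?L" unfolding \<tau>_def pyth[OF pb'] using t by (simp add: real_sqrt_mult)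
    have ca: "c - ?a = t *\<^sub>R ?d - (p - c)" using pa by (simp add: algebra_simps)
    have cb: "c - ?b = (t - 1) *\<^sub>R ?d - (p - c)" using pb' by (simp add: algebra_simps)
    have sub: "(k *\<^sub>R h - g) \<bullet> h = k * (h \<bullet> h) - g \<bullet> h" for g h :: "real^2" and k
      by (simp add: inner_diff_left)
    have 1: "(c - ?a) \<bullet> ?d = t * (?L * ?L)" unfolding ca sub perp' dd by simp
    have 2: "(c - ?b) \<bullet> ?d = (t - 1) * (?L * ?L)" unfolding cb sub perp' dd by simp
    have "(c - ?b) \<bullet> (?a - ?b) = - ((c - ?b) \<bullet> ?d)" by (simp add: inner_diff_right)
    then have 3: "(c - ?b) \<bullet> (?a - ?b) = (1 - t) * (?L * ?L)" unfolding 2 by (simp add: algebra_simps)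
    have "0 \<le> t * t * (?L * ?L)" by simp
    then have "r\<^sup>2 \<le> (dist ?a c)\<^sup>2" using pyth[OF pa] by linarith
    moreover have "t * (?L * ?L) = \<tau> ?a * ?L" "(1 - t) * (?L * ?L) = \<tau> ?b * ?L" unfolding ta tb by simp_all
    moreover have "?L = \<tau> ?a + \<tau> ?b" unfolding ta tb by (simp add: algebra_simps)
    ultimately show ?thesis using 1 3 by metis
  qed
  have tau: "\<tau> (v i) = r * (if \<theta> ! i = pi/2 then 1 else 1 / sqrt 3)" if i: "i < 5" for i
  proof -
    define j where "j = (i + 4) mod 5"
    have j: "j < 5" "Suc j mod 5 = i" using i unfolding j_def by (simp, presburger)
    define a where "a = v j - v i" define b where "b = v (Suc i mod 5) - v i" define q where "q = c - v i"
    have ab0: "0 < norm a" "0 < norm b" using vne[OF j(1)] vne[OF i] j(2) by (auto simp: a_def b_def)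
    have qa: "q \<bullet> a = \<tau> (v i) * norm a" using tang[OF j(1)] j(2) by (simp add: q_def a_def dist_norm)
    have qb: "q \<bullet> b = \<tau> (v i) * norm b" using tang[OF i] by (simp add: q_def b_def dist_norm norm_minus_commute)
    define x where "x = (a \<bullet> b) / (norm a * norm b)"
    have abx: "a \<bullet> b = x * (norm a * norm b)" using ab0 by (simp add: x_def)
    have "\<bar>a \<bullet> b\<bar> \<le> norm a * norm b" by (rule Cauchy_Schwarz_ineq2)
    then have "\<bar>x\<bar> \<le> 1" using ab0 by (simp add: x_def abs_mult)
    moreover have "arccos x = \<theta> ! i" using ang[OF i] by (simp add: corner_angle_def x_def a_def b_def j_def)
    ultimately have x: "x = cos (\<theta> ! i)" using cos_arccos_abs by metis
    have qq: "q \<bullet> q = (\<tau> (v i))\<^sup>2 + r\<^sup>2"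
      using tang[OF i] by (simp add: \<tau>_def q_def dot_square_norm dist_norm norm_minus_commute)
    \<comment> \<open>With \<open>x\<close> the cosine of the corner angle, this is a polynomial
      form of \<open>\<tau> = r * cot (\<theta> / 2)\<close>.\<close>
    have "(norm a * norm b)\<^sup>2 * (((\<tau> (v i))\<^sup>2 + r\<^sup>2) * (1 - x\<^sup>2)) = (norm a * norm b)\<^sup>2 * (2 * (\<tau> (v i))\<^sup>2 * (1 - x))"
      using gram2[of q a b, unfolded qq] unfolding qa qb abx dot_square_norm by algebra
    then have key: "((\<tau> (v i))\<^sup>2 + r\<^sup>2) * (1 - x\<^sup>2) = 2 * (\<tau> (v i))\<^sup>2 * (1 - x)" using ab0 by simp
    have t0: "0 \<le> \<tau> (v i)" using tang[OF i] by (simp add: \<tau>_def)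
    from \<theta>[OF i] show ?thesis
    proof
      assume th: "\<theta> ! i = pi/2"
      have "x = 0" using x unfolding th by simp
      then have "(\<tau> (v i))\<^sup>2 = r\<^sup>2" using key by simp
      then show ?thesis using th t0 r by (simp add: power2_eq_iff_nonneg)
    next
      assume th: "\<theta> ! i = 2*pi/3"
      have "x = -1/2" using x cos_120 unfolding th by simp
      then have "1 - x\<^sup>2 = 3/4" "1 - x = 3/2" by (simp_all add: power2_eq_square)
      note key[unfolded this]
      then have "3 * (\<tau> (v i))\<^sup>2 = r\<^sup>2" unfolding distrib_right by linarith
      then have "(\<tau> (v i))\<^sup>2 = (r / sqrt 3)\<^sup>2" by (simp add: power_divide)
      then have "\<tau> (v i) = r / sqrt 3" using t0 r by (simp add: power2_eq_iff_nonneg)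
      moreover have "\<theta> ! i \<noteq> pi/2" unfolding th using pi_gt_zero by simp
      ultimately show ?thesis by simp
    qed
  qed
  have sum5: "(\<Sum>i<5. f (Suc i mod 5)) = (\<Sum>i<5. f i)" for f :: "nat \<Rightarrow> real"
  proof -
    have m: "Suc 0 mod 5 = 1" "Suc 1 mod 5 = 2" "Suc 2 mod 5 = 3" "Suc 3 mod 5 = 4" "Suc 4 mod 5 = (0::nat)"
      by simp_all
    show ?thesis unfolding lessThan_5 by (simp add: m del: One_nat_def)
  qed
  have "perimeter P = (\<Sum>i<5. \<tau> (v i) + \<tau> (v (Suc i mod 5)))" unfolding per
    by (rule sum.cong) (use tang in blast)+
  also have "\<dots> = 2 * (\<Sum>i<5. \<tau> (v i))" unfolding sum.distrib sum5[of "\<lambda>i. \<tau> (v i)"] by (rule mult_2[symmetric])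
  also have "(\<Sum>i<5. \<tau> (v i)) = (\<Sum>i<5. r * (if \<theta> ! i = pi/2 then 1 else 1 / sqrt 3))"
    by (rule sum.cong) (use tau in auto)
  also have "\<dots> = r * (2 + sqrt 3)" unfolding sum_distrib_left[symmetric] cnt ..
  finally have per2: "perimeter P = 2 * (r * c0\<^sup>2)" by (simp add: c0_props)
  then have "(r * c0)\<^sup>2 = 1" using area_per by (simp add: power2_eq_square algebra_simps)
  then have rc: "r * c0 = 1" using mult_pos_pos[OF r c0_props(1)] by (auto simp: power2_eq_1_iff)
  then show "perimeter P = 2 * c0" unfolding per2 by (simp add: power2_eq_square flip: mult.assoc)
  \<comment> \<open>A crude diameter bound is enough: \<open>r\<close> and the tangent lengths are
    at most 1, so every corner is within 2 of \<open>c\<close>.\<close>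
  have "1 \<le> c0" using sqrt3_bounds by (simp add: c0_def)
  then have r1: "r \<le> 1" using rc r mult_left_mono[of 1 c0 r] by simp
  have "dist c (v i) \<le> 2" if i: "i < 5" for i
  proof -
    have 1: "(\<tau> (v i))\<^sup>2 = (dist (v i) c)\<^sup>2 - r\<^sup>2" using tang[OF i] by (simp add: \<tau>_def)
    have sq: "k\<^sup>2 \<le> 1" if "0 \<le> k" "k \<le> 1" for k :: real using power_mono[OF that(2,1), of 2] by simp
    have "(\<tau> (v i))\<^sup>2 \<le> 1"
    proof (rule sq)
      show "\<tau> (v i) \<le> 1"
        using tau[OF i] r1 r sqrt3_bounds by (auto simp: divide_le_eq split: if_splits)
      show "0 \<le> \<tau> (v i)" using tang[OF i] by (simp add: \<tau>_def)
    qed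
    moreover have "r\<^sup>2 \<le> 1" by (rule sq) (use r r1 in auto)
    ultimately have "(dist (v i) c)\<^sup>2 \<le> 2" using 1 by linarith
    then have "(dist (v i) c)\<^sup>2 \<le> 2\<^sup>2" by simp
    then show ?thesis unfolding dist_commute[of c] by (rule power2_le_imp_le) simp
  qed
  then have "v ` {..<5} \<subseteq> cball c 2" by (intro image_subsetI) (simp only: mem_cball lessThan_iff)
  then have Pc: "P \<subseteq> cball c 2" unfolding v(2) by (rule hull_minimal) (rule convex_cball)
  show "dist x y \<le> 4" if "x \<in> P" "y \<in> P" for x y
  proof -
    have "x \<in> cball c 2" "y \<in> cball c 2" by (rule subsetD[OF Pc that(1)], rule subsetD[OF Pc that(2)])
    then have "dist c x \<le> 2" "dist c y \<le> 2" by (simp_all only: mem_cball)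
    then show ?thesis using dist_triangle[of x y c] by (simp add: dist_commute)
  qed
qed

lemma cairo_or_prismatic:
  assumes "cairo_pentagon P \<or> prismatic_pentagon P"
  shows "convex_polygon P" "measure lebesgue P = 1" "perimeter P = 2 * c0" "\<And>x y. x \<in> P \<Longrightarrow> y \<in> P \<Longrightarrow> dist x y \<le> 4"
proof -
  have s3: "3 / sqrt 3 = sqrt (3::real)" using real_sqrt_mult_self[of 3] by (simp add: field_simps)
  have *: "convex_polygon P \<and> measure lebesgue P = 1 \<and> perimeter P = 2 * c0 \<and> (\<forall>x\<in>P. \<forall>y\<in>P. dist x y \<le> 4)"
  proof -
    obtain \<theta> where up: "unit_circumscribed_pentagon \<theta> P"
      and \<theta>: "\<theta> = [2*pi/3, 2*pi/3, pi/2, 2*pi/3, pi/2] \<or> \<theta> = [2*pi/3, 2*pi/3, 2*pi/3, pi/2, pi/2]"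
      using assms unfolding cairo_pentagon_def prismatic_pentagon_def by blast
    have 1: "\<theta> ! i = 2*pi/3 \<or> \<theta> ! i = pi/2" if "i < 5" for i
    proof -
      have "i \<in> {0, 1, 2, 3, 4}" using that lessThan_5 by blast
      then show ?thesis using \<theta> by auto
    qed
    have 2: "(\<Sum>i<5. if \<theta> ! i = pi/2 then 1 else 1 / sqrt 3) = 2 + sqrt (3::real)"
      using \<theta> s3 by (auto simp: lessThan_5 field_simps)
    show ?thesis using unit_pentagon[OF up 1 2] by blast
  qed
  then show "convex_polygon P" "measure lebesgue P = 1" "perimeter P = 2 * c0" "\<And>x y. x \<in> P \<Longrightarrow> y \<in> P \<Longrightarrow> dist x y \<le> 4"
    by auto
qed

text \<open>Tiles that meet the disc of radius \<open>R\<close> lie in the disc of radius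
  \<open>R + 4\<close>, so there are at most \<open>pi * (R + 4)\<^sup>2\<close> of them. Every
  boundary point lies on at least two frontiers, so half of their total perimeter bounds the
  length.\<close>

theorem perimeter_ratio_le:
  assumes T: "tiling T" and tiles: "\<And>P. P \<in> T \<Longrightarrow> cairo_pentagon P \<or> prismatic_pentagon P"
  shows "perimeter_ratio T \<le> ennreal c0"
proof -
  interpret unit_tiling T
  proof
    show "convex_polygon P \<and> measure lebesgue P = 1" if "P \<in> T" for P
      using cairo_or_prismatic(1,2)[OF tiles[OF that]] by (rule conjI)
  qed (rule T)
  have diam: "dist x y \<le> 4" if "P \<in> T" "x \<in> P" "y \<in> P" for P x y by (rule cairo_or_prismatic(4)[OF tiles[OF that(1)] that(2,3)])
  define M where "M R = {P\<in>T. P \<inter> cball 0 R \<noteq> {}}" for R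
  have cardF: "real (card F) \<le> pi * (R + 4)\<^sup>2" if F: "F \<subseteq> M R" "finite F" and R: "0 \<le> R" for F R
  proof -
    have FT: "F \<subseteq> T" using F by (auto simp: M_def)
    have sub: "P \<inter> cball 0 (R + 4) = P" if P: "P \<in> F" for P
    proof -
      have "P \<in> M R" using P F by blast
      then obtain x where x: "P \<in> T" "x \<in> P" "norm x \<le> R" by (auto simp: M_def)
      have "norm y \<le> R + 4" if "y \<in> P" for y
        using diam[OF x(1,2) that] norm_triangle_sub[of y x] x(3) by (simp add: dist_norm norm_minus_commute)
      then show ?thesis by auto
    qed
    have "real (card F) = (\<Sum>P\<in>F. measure lebesgue (P \<inter> cball 0 (R + 4)))"
      using sub area FT by (simp add: subset_iff)
    also have "\<dots> = measure lebesgue (\<Union>F \<inter> cball 0 (R + 4))" by (rule measure_tiles_cball[OF F(2) FT])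
    also have "\<dots> \<le> measure lebesgue (cball (0::real^2) (R + 4))"
      using lmeasurable_tiles_cball[OF F(2) FT] by (intro measure_mono_fmeasurable) (auto simp: fmeasurableD)
    finally show ?thesis using R by (simp add: content_cball unit_ball_vol_2)
  qed
  have finM: "finite (M R)" for R
  proof (rule ccontr)
    assume inf: "infinite (M R)"
    let ?R = "max 0 R"
    obtain m :: nat where m: "pi * (?R + 4)\<^sup>2 < real m" using reals_Archimedean2 by blast
    obtain F where F: "F \<subseteq> M R" "finite F" "card F = m" using infinite_arbitrarily_large[OF inf, of m] by blast
    have "M R \<subseteq> M ?R" by (auto simp: M_def)
    then show False using cardF[of F ?R] F m by auto
  qed
  \<comment> \<open>The other tiles near \<open>x\<close> are finitely many, so their union is
    closed; if it missed \<open>x\<close>, a small disc around \<open>x\<close> would lie in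
    \<open>P\<close>.\<close>
  have two: "\<exists>Q\<in>T. Q \<noteq> P \<and> x \<in> frontier Q" if P: "P \<in> T" "x \<in> frontier P" for P x
  proof -
    let ?K = "{Q\<in>T. Q \<inter> cball x 1 \<noteq> {}} - {P}"
    have "?K \<subseteq> M (norm x + 1)"
    proof
      fix Q assume "Q \<in> ?K"
      then have "Q \<in> T" "Q \<inter> cball x 1 \<noteq> {}" by blast+
      then obtain y where "Q \<in> T" "y \<in> Q" "dist x y \<le> 1" by auto
      then show "Q \<in> M (norm x + 1)" using norm_triangle_sub[of y x] by (auto simp: M_def dist_norm norm_minus_commute)
    qed
    then have finK: "finite ?K" using finM finite_subset by blast
    have "x \<in> \<Union>?K"
    proof (rule ccontr)
      assume "x \<notin> \<Union>?K"
      then have x: "x \<in> - \<Union>?K" by (simp only: Compl_iff not_False_eq_True)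
      have "closed (\<Union>?K)" using finK polygon.closed[OF polygon] by (intro closed_Union) auto
      then have "open (- \<Union>?K)" by (rule open_Compl)
      then obtain \<epsilon> where \<epsilon>: "0 < \<epsilon>" "ball x \<epsilon> \<subseteq> - \<Union>?K" using x by (rule openE)
      have "ball x (min \<epsilon> 1) \<subseteq> P"
      proof
        fix y assume y: "y \<in> ball x (min \<epsilon> 1)"
        obtain Q where Q: "Q \<in> T" "y \<in> Q" using cover by blast
        have "y \<in> ball x \<epsilon>" using y by simp
        then have "y \<in> - \<Union>?K" using \<epsilon>(2) by (rule rev_subsetD)
        then have "y \<notin> \<Union>?K" by (simp only: Compl_iff not_False_eq_True)
        moreover have "y \<in> cball x 1" using y by simp
        ultimately show "y \<in> P" using Q by blast
      qed
      then have "x \<in> interior P" using \<epsilon>(1) by (auto simp: mem_interior intro!: exI[of _ "min \<epsilon> 1"])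
      then show False using P by (simp add: frontier_def)
    qed
    then obtain Q where Q: "Q \<in> T" "Q \<noteq> P" "x \<in> Q" by blast
    have "x \<in> P" using polygon.frontier_subset[OF polygon[OF P(1)]] P by blast
    then show ?thesis using Int_frontier[OF Q(1) P(1) Q(2)] Q by blast
  qed
  have bound: "hausdorff_length (boundary \<inter> cball 0 R) / ennreal (pi * R\<^sup>2) \<le> ennreal (c0 * (1 + 4 / R)\<^sup>2)" if R: "1 \<le> R" for R
  proof -
    let ?B = "boundary \<inter> cball 0 R"
    have B: "?B = (\<Union>P\<in>M R. frontier P \<inter> cball 0 R)"
      using polygon.frontier_subset[OF polygon] by (auto simp: boundary_def M_def)
    have "closed ?B" unfolding B using finM by (intro closed_UN) auto
    have "of_nat 2 * hausdorff_length ?B \<le> (\<Sum>P\<in>M R. hausdorff_length (frontier P))"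
    proof (rule hausdorff_length_le_sum[OF finM])
      fix x assume x: "x \<in> ?B"
      then obtain P where P: "P \<in> T" "x \<in> frontier P" by (auto simp: boundary_def)
      then obtain Q where Q: "Q \<in> T" "Q \<noteq> P" "x \<in> frontier Q" using two by blast
      have "x \<in> P" "x \<in> Q" "x \<in> cball 0 R" using P Q x polygon.frontier_subset[OF polygon] by blast+
      then have "P \<in> M R" "Q \<in> M R" unfolding M_def using P Q by blast+
      then have "{P, Q} \<subseteq> {P\<in>M R. x \<in> frontier P}" using P Q by simp
      moreover have "finite {P\<in>M R. x \<in> frontier P}" using finM by simp
      ultimately have "card {P, Q} \<le> card {P\<in>M R. x \<in> frontier P}" by (intro card_mono)
      then show "2 \<le> card {P\<in>M R. x \<in> frontier P}" using Q(2) by simp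
    qed (use \<open>closed ?B\<close> in auto)
    also have "\<dots> = (\<Sum>P\<in>M R. ennreal (2 * c0))"
    proof (rule sum.cong[OF refl])
      fix P assume "P \<in> M R"
      then have "P \<in> T" by (simp add: M_def)
      then show "hausdorff_length (frontier P) = ennreal (2 * c0)"
        using polygon.hausdorff_frontier[OF polygon] cairo_or_prismatic(3)[OF tiles] by simp
    qed
    also have "\<dots> = ennreal (\<Sum>P\<in>M R. 2 * c0)" using c0_props(1) by (intro sum_ennreal) auto
    also have "\<dots> \<le> ennreal (2 * (c0 * (pi * (R + 4)\<^sup>2)))"
      using cardF[OF order_refl finM, of R] R c0_props(1) by (intro ennreal_leI) (simp add: mult_ac)
    finally have "2 * hausdorff_length ?B \<le> 2 * ennreal (c0 * (pi * (R + 4)\<^sup>2))"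
      using c0_props(1) by (simp add: ennreal_mult)
    then have "hausdorff_length ?B \<le> ennreal (c0 * (pi * (R + 4)\<^sup>2))"
      by (simp add: ennreal_mult_le_mult_iff)
    then have "hausdorff_length ?B / ennreal (pi * R\<^sup>2) \<le> ennreal (c0 * (pi * (R + 4)\<^sup>2)) / ennreal (pi * R\<^sup>2)"
      by (rule divide_right_mono_ennreal)
    also have "\<dots> = ennreal (c0 * (pi * (R + 4)\<^sup>2) / (pi * R\<^sup>2))" using R c0_props(1) by (intro divide_ennreal) auto
    also have "c0 * (pi * (R + 4)\<^sup>2) / (pi * R\<^sup>2) = c0 * (1 + 4 / R)\<^sup>2"
      using R by (simp add: field_simps power2_eq_square)
    finally show ?thesis .
  qed
  have "((\<lambda>R::real. 4 / R) \<longlongrightarrow> 0) at_top"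
    by (intro tendsto_divide_0[OF tendsto_const] filterlim_at_top_imp_at_infinity filterlim_ident)
  then have "((\<lambda>R::real. c0 * (1 + 4 / R)\<^sup>2) \<longlongrightarrow> c0 * (1 + 0)\<^sup>2) at_top" by (intro tendsto_intros)
  then have lim: "((\<lambda>R::real. ennreal (c0 * (1 + 4 / R)\<^sup>2)) \<longlongrightarrow> ennreal c0) at_top" by (intro tendsto_ennrealI) simp
  have "perimeter_ratio T \<le> Limsup at_top (\<lambda>R::real. ennreal (c0 * (1 + 4 / R)\<^sup>2))"
    unfolding perimeter_ratio_def boundary_def[symmetric]
    by (intro Limsup_mono eventually_mono[OF eventually_ge_at_top[of "1::real"]] bound)
  also have "\<dots> = ennreal c0" by (rule lim_imp_Limsup[OF _ lim]) simp
  finally show ?thesis .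
qed

theorem theorem3p5:
  shows "(\<exists>T. tiling T \<and> (\<forall>P\<in>T. cairo_pentagon P \<or> prismatic_pentagon P)) \<and>
    (\<forall>T\<^sub>0 T.
       tiling T\<^sub>0 \<and> (\<forall>P\<in>T\<^sub>0. cairo_pentagon P \<or> prismatic_pentagon P) \<and>
       tiling T \<and> (\<forall>P\<in>T. convex_polygon P \<and> measure lebesgue P = 1 \<and> num_sides P \<le> 5)
       \<longrightarrow> perimeter_ratio T\<^sub>0 \<le> perimeter_ratio T)"
proof (intro conjI allI impI)
  show "\<exists>T. tiling T \<and> (\<forall>P\<in>T. cairo_pentagon P \<or> prismatic_pentagon P)"
    using tiling_prism_tiling prism_tiling_prismatic by blast
next
  fix T\<^sub>0 T :: "(real^2) set set"
  assume h: "tiling T\<^sub>0 \<and> (\<forall>P\<in>T\<^sub>0. cairo_pentagon P \<or> prismatic_pentagon P) \<and>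
    tiling T \<and> (\<forall>P\<in>T. convex_polygon P \<and> measure lebesgue P = 1 \<and> num_sides P \<le> 5)"
  have "perimeter_ratio T\<^sub>0 \<le> ennreal c0" by (rule perimeter_ratio_le) (use h in auto)
  also have "\<dots> \<le> perimeter_ratio T" by (rule perimeter_ratio_ge) (use h in auto)
  finally show "perimeter_ratio T\<^sub>0 \<le> perimeter_ratio T" .
qed

end
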